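(* Let $\mathbf A\in\mathbb R^{m\times \frac12 n(n+1)}$ have linearly independent rows. Suppose that the centering assumption (A) holds with parameters $L,\delta,\chi_1$ and that the tangent space injectivity assumption (B) holds with parameter $\chi_2$ (both assumptions are stated in the context). Given the scaling point $W\in\mathcal S^n_{++}$ of assumption (A), select an integer $r$ with $\operatorname{rank}(X^\star)\le r<n$, set $\tau=\frac12\lambda_{r+1}(W)$, and define $\mathbf Q,\mathbf\Sigma$ from $W,r,\tau$ as in the context. For $\mathbf G\in\mathcal S^m$ satisfying $\gamma_{\max}\mathbf A\mathbf A^T\succeq \mathbf G\succeq\gamma_{\min}\mathbf A\mathbf A^T$ with $\gamma_{\max}\ge\gamma_{\min}>0$, we have $$\operatorname{cond}\left(\begin{bmatrix}\mathbf G & \mathbf A\mathbf Q\\ \mathbf Q^T\mathbf A^T & -\tau^2\mathbf\Sigma\end{bmatrix}\right)=O\left(\operatorname{cond}(\mathbf A\mathbf A^T)\cdot\gamma_{\max}^{4}\cdot\gamma_{\min}^{-8}\cdot L^{12}\cdot(1-\delta)^{-11}\cdot\chi_1^{2}\cdot\chi_2^{6}\right)$$ for all $0<\mu\le1$, with no dependence on $1/\mu$.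
   Context: Notation. $\mathcal S^n\supseteq\mathcal S^n_+\supseteq\mathcal S^n_{++}$ are the real symmetric, positive semidefinite and positive definite $n\times n$ matrices; $A\succeq B$ means $A-B$ is positive semidefinite; $\lambda_1(W)\ge\dots\ge\lambda_n(W)$ are the ordered eigenvalues; $\|\cdot\|$ is the spectral norm of a matrix (Euclidean norm of a vector), $\|\cdot\|_F$ the Frobenius norm; $\operatorname{cond}(M)=\|M\|\|M^{-1}\|$. $\operatorname{vec}$ is column-stacking and $\otimes$ is the Kronecker product. $\Psi_n\in\mathbb R^{n^2\times n(n+1)/2}$ is the orthonormal basis matrix of $\operatorname{vec}(\mathcal S^n)$ such that $\operatorname{vec}_{\mathcal S}(X):=\Psi_n^T\operatorname{vec}(X)=[X_{11},\sqrt2X_{21},\dots,\sqrt2X_{n1},X_{22},\sqrt2X_{32},\dots,X_{nn}]^T$ for $X\in\mathcal S^n$. For $A,B\in\mathbb R^{n\times r}$, $A\otimes_{\mathcal S}B:=\frac12\Psi_n^T(A\otimes B+B\otimes A)\Psi_r$. $\operatorname{diag}(\cdot,\cdot)$ of matrices is the block-diagonal matrix. Assumption (A). There exist absolute constants $L\ge0$ and $0\le\delta<1$ such that the iterates $X,S\in\mathcal S^n_{++}$, where $W=X^{1/2}(X^{1/2}SX^{1/2})^{-1/2}X^{1/2}$, satisfy $$\left\|\tfrac1\mu X^{1/2}SX^{1/2}-I\right\|\le\delta,\qquad \|X-X^\star\|\le L\mu,\qquad\|S-S^\star\|\le L,$$ with respect to $X^\star,S^\star\in\mathcal S^n_+$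 that satisfy $X^\star S^\star=0$ and $\chi_1^{-1}I\preceq X^\star+S^\star\preceq I$. Here $\mu>0$ is the duality gap (accuracy) parameter, and $1\le\operatorname{rank}(X^\star)<n$. Assumption (B). Factor $X^\star=U^\star U^{\star T}$ with $U^\star\in\mathbb R^{n\times r^\star}$, $r^\star=\operatorname{rank}(X^\star)$. There exists a condition number $1\le\chi_2<\infty$ such that for all $V\in\mathbb R^{n\times r^\star}$, $$\|(\mathbf A\mathbf A^T)^{-1/2}\mathbf A\operatorname{vec}_{\mathcal S}(U^\star V^T+VU^{\star T})\|\ge\chi_2^{-1}\|U^\star V^T+VU^{\star T}\|_F.$$ Construction. Partition an orthonormal eigendecomposition $W=Q\Lambda Q^T+Q_\perp\Lambda_\perp Q_\perp^T$, where $\Lambda$ is the diagonal matrix of the top $r$ eigenvalues, $\Lambda_\perp$ that of the bottom $n-r$, $Q\in\mathbb R^{n\times r}$, and $[Q,Q_\perp]$ is orthogonal. Define $$\mathbf Q=[Q\otimes_{\mathcal S}Q,\ \sqrt2\,\Psi_n^T(Q\otimes Q_\perp)],\qquad \mathbf\Sigma=\operatorname{diag}\big(\Lambda\otimes_{\mathcal S}\Lambda-\tau^2I,\ (\Lambda-\tau I)\otimes\Lambda_\perp\big)^{-1}.$$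
   Formalization: The O-constant may depend on a positive lower bound for L, 1/γ_min, ‖AA^T‖ and ‖(AA^T)^{-1}‖ (and on nothing else); with an absolute constant the bound fails, e.g. on replacing A by tA with G = AA^T and t → ∞. *)

theory Defs
  imports
    "Jordan_Normal_Form.Matrix"
    "Jordan_Normal_Form.Gauss_Jordan_Elimination"
    "Jordan_Normal_Form.Char_Poly"
    "Jordan_Normal_Form.DL_Rank"
begin

text \<open>All dimensions vary inside the main statement (its constant is uniform in them), so
  matrices are the carrier-based ones of the Jordan normal form library, with 0-based indices.\<close>

section \<open>Real matrices\<close>

definition vec_norm :: "real vec \<Rightarrow> real" where
  "vec_norm v = sqrt (v \<bullet> v)"

text \<open>The supremum is over the closed unit ball rather than the sphere so that it ranges over a
  nonempty set also for matrices without columns.\<close>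

definition spectral_norm :: "real mat \<Rightarrow> real" where
  "spectral_norm A = (SUP v \<in> {v \<in> carrier_vec (dim_col A). vec_norm v \<le> 1}. vec_norm (A *\<^sub>v v))"

definition frobenius_norm :: "real mat \<Rightarrow> real" where
  "frobenius_norm A = sqrt (\<Sum>i<dim_row A. \<Sum>j<dim_col A. (A $$ (i, j))\<^sup>2)"

definition sym_mats :: "nat \<Rightarrow> real mat set" where
  "sym_mats n = {A \<in> carrier_mat n n. A\<^sup>T = A}"

definition psd_mats :: "nat \<Rightarrow> real mat set" where
  "psd_mats n = {A \<in> sym_mats n. \<forall>v \<in> carrier_vec n. 0 \<le> v \<bullet> (A *\<^sub>v v)}"

definition pd_mats :: "nat \<Rightarrow> real mat set" where
  "pd_mats n = {A \<in> sym_mats n. \<forall>v \<in> carrier_vec n. v \<noteq> 0\<^sub>v n \<longrightarrow> 0 < v \<bullet> (A *\<^sub>v v)}"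

definition loewner_ge :: "real mat \<Rightarrow> real mat \<Rightarrow> bool" where
  "loewner_ge A B \<longleftrightarrow> A - B \<in> psd_mats (dim_row A)"

definition inv_mat :: "real mat \<Rightarrow> real mat" where
  "inv_mat A = the (mat_inverse A)"

definition cond_number :: "real mat \<Rightarrow> real" where
  "cond_number M = spectral_norm M * spectral_norm (inv_mat M)"

definition sqrt_mat :: "real mat \<Rightarrow> real mat" where
  "sqrt_mat A = (THE B. B \<in> psd_mats (dim_row A) \<and> B * B = A)"

text \<open>Eigenvalues with multiplicity in nonincreasing order. The list exists, and is then unique,
  whenever the characteristic polynomial splits over the reals, in particular for symmetric
  matrices.\<close>

definition eigs_desc :: "real mat \<Rightarrow> real list" where
  "eigs_desc A = (THE es. sorted_wrt (\<ge>) es \<and> char_poly A = (\<Prod>e\<leftarrow>es. [:- e, 1:]))"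

definition ordered_eig :: "real mat \<Rightarrow> nat \<Rightarrow> real" where
  "ordered_eig A k = eigs_desc A ! (k - 1)"

definition mat_rank :: "real mat \<Rightarrow> nat" where
  "mat_rank A = vec_space.rank (dim_row A) A"

definition lin_indpt_rows :: "real mat \<Rightarrow> bool" where
  "lin_indpt_rows A \<longleftrightarrow> distinct (rows A) \<and>
     LinearCombinations.module.lin_indpt class_ring (module_vec TYPE(real) (dim_col A)) (set (rows A))"

definition hcat :: "real mat \<Rightarrow> real mat \<Rightarrow> real mat" where
  "hcat A B = mat_of_cols (dim_row A) (cols A @ cols B)"

section \<open>Symmetric vectorization and Kronecker products\<close>

definition vectorize :: "real mat \<Rightarrow> real vec" where
  "vectorize X = vec (dim_row X * dim_col X) (\<lambda>k. X $$ (k mod dim_row X, k div dim_row X))"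

definition kron :: "real mat \<Rightarrow> real mat \<Rightarrow> real mat" where
  "kron A B = mat (dim_row A * dim_row B) (dim_col A * dim_col B)
     (\<lambda>(i, j). A $$ (i div dim_row B, j div dim_col B) * B $$ (i mod dim_row B, j mod dim_col B))"

text \<open>The positions of the lower triangle, column by column; position \<open>(i, j)\<close> of an
  \<open>n \<times> n\<close> matrix is entry \<open>i + j * n\<close> of its vectorization.\<close>

definition lower_positions :: "nat \<Rightarrow> (nat \<times> nat) list" where
  "lower_positions n = concat (map (\<lambda>j. map (\<lambda>i. (i, j)) [j..<n]) [0..<n])"

definition Psi :: "nat \<Rightarrow> real mat" where
  "Psi n = mat (n * n) (n * (n + 1) div 2) (\<lambda>(p, k). case lower_positions n ! k of (i, j) \<Rightarrow>
     if p = i + j * n \<or> p = j + i * n then (if i = j then 1 else 1 / sqrt 2) else 0)"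

definition vec_S :: "real mat \<Rightarrow> real vec" where
  "vec_S X = (Psi (dim_row X))\<^sup>T *\<^sub>v vectorize X"

definition kron_S :: "real mat \<Rightarrow> real mat \<Rightarrow> real mat" where
  "kron_S A B = (1/2) \<cdot>\<^sub>m ((Psi (dim_row A))\<^sup>T * (kron A B + kron B A) * Psi (dim_col A))"

section \<open>The assumptions\<close>

definition scaling_point :: "real mat \<Rightarrow> real mat \<Rightarrow> real mat" where
  "scaling_point X S = sqrt_mat X * inv_mat (sqrt_mat (sqrt_mat X * S * sqrt_mat X)) * sqrt_mat X"

text \<open>The predicate is about a single iterate \<open>(X, S)\<close> and its accuracy parameter \<open>\<mu>\<close>. Uniformity
  over the iterates comes from the quantifier order of the main statement, whose constant is
  chosen before \<open>\<mu>\<close>, \<open>X\<close> and \<open>S\<close>.\<close>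

definition centering_assumption ::
  "nat \<Rightarrow> real \<Rightarrow> real \<Rightarrow> real \<Rightarrow> real \<Rightarrow> real mat \<Rightarrow> real mat \<Rightarrow> real mat \<Rightarrow> real mat \<Rightarrow> bool" where
  "centering_assumption n L \<delta> chi1 \<mu> X S Xs Ss \<longleftrightarrow>
     0 \<le> L \<and> 0 \<le> \<delta> \<and> \<delta> < 1 \<and> 0 < chi1 \<and> 0 < \<mu> \<and>
     X \<in> pd_mats n \<and> S \<in> pd_mats n \<and> Xs \<in> psd_mats n \<and> Ss \<in> psd_mats n \<and>
     spectral_norm ((1/\<mu>) \<cdot>\<^sub>m (sqrt_mat X * S * sqrt_mat X) - 1\<^sub>m n) \<le> \<delta> \<and>
     spectral_norm (X - Xs) \<le> L * \<mu> \<and>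
     spectral_norm (S - Ss) \<le> L \<and>
     Xs * Ss = 0\<^sub>m n n \<and>
     loewner_ge (Xs + Ss) (inverse chi1 \<cdot>\<^sub>m 1\<^sub>m n) \<and>
     loewner_ge (1\<^sub>m n) (Xs + Ss) \<and>
     1 \<le> mat_rank Xs \<and> mat_rank Xs < n"

definition tangent_injectivity ::
  "nat \<Rightarrow> real mat \<Rightarrow> real \<Rightarrow> real mat \<Rightarrow> real mat \<Rightarrow> bool" where
  "tangent_injectivity n A chi2 Xs Us \<longleftrightarrow>
     1 \<le> chi2 \<and>
     Us \<in> carrier_mat n (mat_rank Xs) \<and> Xs = Us * Us\<^sup>T \<and>
     (\<forall>V \<in> carrier_mat n (mat_rank Xs).
        vec_norm (inv_mat (sqrt_mat (A * A\<^sup>T)) *\<^sub>v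
                    (A *\<^sub>v vec_S (Us * V\<^sup>T + V * Us\<^sup>T)))
        \<ge> inverse chi2 * frobenius_norm (Us * V\<^sup>T + V * Us\<^sup>T))"

section \<open>The construction\<close>

definition top_eig_mat :: "real mat \<Rightarrow> nat \<Rightarrow> real mat" where
  "top_eig_mat W r = mat_diag r (\<lambda>i. ordered_eig W (i + 1))"

definition bottom_eig_mat :: "real mat \<Rightarrow> nat \<Rightarrow> real mat" where
  "bottom_eig_mat W r = mat_diag (dim_row W - r) (\<lambda>i. ordered_eig W (r + i + 1))"

definition eig_partition :: "nat \<Rightarrow> nat \<Rightarrow> real mat \<Rightarrow> real mat \<Rightarrow> real mat \<Rightarrow> bool" where
  "eig_partition n r W Q Qp \<longleftrightarrow>
     Q \<in> carrier_mat n r \<and> Qp \<in> carrier_mat n (n - r) \<and>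
     (hcat Q Qp)\<^sup>T * hcat Q Qp = 1\<^sub>m n \<and>
     W = Q * top_eig_mat W r * Q\<^sup>T + Qp * bottom_eig_mat W r * Qp\<^sup>T"

definition bold_Q :: "real mat \<Rightarrow> real mat \<Rightarrow> real mat" where
  "bold_Q Q Qp = hcat (kron_S Q Q) (sqrt 2 \<cdot>\<^sub>m ((Psi (dim_row Q))\<^sup>T * kron Q Qp))"

definition bold_Sigma :: "real \<Rightarrow> real mat \<Rightarrow> real mat \<Rightarrow> real mat" where
  "bold_Sigma \<tau> \<Lambda> \<Lambda>p = inv_mat (diag_block_mat
     [kron_S \<Lambda> \<Lambda> - \<tau>\<^sup>2 \<cdot>\<^sub>m 1\<^sub>m (dim_row \<Lambda> * (dim_row \<Lambda> + 1) div 2),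
      kron (\<Lambda> - \<tau> \<cdot>\<^sub>m 1\<^sub>m (dim_row \<Lambda>)) \<Lambda>p])"

definition augmented_mat :: "real mat \<Rightarrow> real mat \<Rightarrow> real mat \<Rightarrow> real \<Rightarrow> real mat \<Rightarrow> real mat" where
  "augmented_mat G A BQ \<tau> BSig =
     four_block_mat G (A * BQ) (BQ\<^sup>T * A\<^sup>T) (- (\<tau>\<^sup>2 \<cdot>\<^sub>m BSig))"

section \<open>The range of the asymptotic bound\<close>

text \<open>The O-bound is an asymptotic statement about parameters that may grow, so the quantities
  entering it must stay away from zero: without a positive lower bound on \<open>L\<close>, on
  \<open>1 / \<gamma>min\<close> and on the scale of \<open>A A\<^sup>T\<close> no constant can exist. For instance, with \<open>G = A A\<^sup>T\<close>,
  replacing \<open>A\<close> by \<open>t A\<close> leaves the right-hand side unchanged while the left-hand side grows like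
  \<open>t\<^sup>2\<close>. The lower bound \<open>\<kappa>\<close> is arbitrary: every
  instance satisfying the assumptions lies in the range of some \<open>\<kappa> > 0\<close>, so \<open>\<kappa>\<close> excludes
  nothing; it only records what the hidden constant depends on. The remaining quantities
  \<open>cond (A A\<^sup>T)\<close>, \<open>1 / (1 - \<delta>)\<close>, \<open>chi1\<close>, \<open>chi2\<close> are at least 1 automatically.\<close>

definition bounded_below_by :: "real \<Rightarrow> real mat \<Rightarrow> real \<Rightarrow> real \<Rightarrow> bool" where
  "bounded_below_by \<kappa> A L \<gamma>min \<longleftrightarrow>
     \<kappa> \<le> spectral_norm (A * A\<^sup>T) \<and>
     \<kappa> \<le> spectral_norm (inv_mat (A * A\<^sup>T)) \<and>
     \<kappa> \<le> L \<and> \<kappa> \<le> 1 / \<gamma>min"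

end

(* The scaling point satisfies X / (2 sqrt mu) <= W <= X / ((1 - delta) sqrt mu), and X is within L mu
   of the low-rank matrix Xs = U U^T. Hence the eigenvalues of W beyond index rank Xs are of order
   sqrt mu, and so is tau, while the top ones are of order 1 / sqrt mu; their eigenvectors span a
   space close to the range of U. In the augmented matrix [G, A BQ; (A BQ)^T, -D] the diagonal block
   D = tau^2 Sigma is bounded, and it is bounded away from 0 except on the coordinates involving a
   top eigenvector. Those coordinates parametrize matrices close to tangent matrices
   U V^T + V U^T, on which A is injective by assumption, so the Schur complement
   D + (A BQ)^T G^-1 (A BQ) is bounded below independently of mu. *)

theory Submission
  imports Defs "HOL-Computational_Algebra.Formal_Power_Series"
begin

text \<open>Two obstacles shape the proof. First, a coordinate that couples two top eigenvectors may
  have an entry of D as small as the order of \<mu>^2, so D bounds the Schur complement only while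
  \<mu> stays above a threshold of order (1 - \<delta>) / (L chi1 chi2^2). Below it the top
  eigenvectors are so close to the range of U that replacing a tangent matrix by its perturbation
  costs at most half of the injectivity constant 1 / chi2. Hence a case distinction on \<mu>.
  Second, r may exceed k = rank Xs. Coordinates are therefore split at k, not at r: two indices from
  k on mean two eigenvalues of order sqrt \<mu>, whose product cancels the \<mu> in tau^2 in either
  block of Sigma. Apart from the eigenvalues of W, everything is compared through quadratic forms
  and the Cauchy-Schwarz inequality of a semidefinite form; square roots of definite matrices come
  from a binomial series. The constant depends on \<kappa> because a sum 1 + t is absorbed as (1 + 1
  / \<kappa>) t for t each of L, 1 / gmin and the norms of A A^T and its inverse.\<close>

abbreviation (input) tri :: "nat \<Rightarrow> nat" where
  "tri n \<equiv> n * (n + 1) div 2"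

abbreviation (input) qf :: "real mat \<Rightarrow> real vec \<Rightarrow> real" where
  "qf A v \<equiv> v \<bullet> (A *\<^sub>v v)"

section \<open>Norms and quadratic forms\<close>

lemma scalar_prod_self: "(v::real vec) \<bullet> v = (\<Sum>i<dim_vec v. (v $ i)\<^sup>2)"
  by (simp add: scalar_prod_def power2_eq_square atLeast0LessThan)

lemma scalar_prod_self_nonneg: "0 \<le> (v::real vec) \<bullet> v"
  unfolding scalar_prod_self by (simp add: sum_nonneg)

lemma vec_norm_nonneg [simp]: "0 \<le> vec_norm v"
  by (simp add: vec_norm_def scalar_prod_self_nonneg)

lemma vec_norm_sq: "(vec_norm v)\<^sup>2 = v \<bullet> v"
  by (simp add: vec_norm_def scalar_prod_self_nonneg)

lemma scalar_prod_self_eq_0: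
  assumes "v \<in> carrier_vec n" shows "(v::real vec) \<bullet> v = 0 \<longleftrightarrow> v = 0\<^sub>v n"
proof
  assume "v \<bullet> v = 0"
  then have "\<forall>i<dim_vec v. v $ i = 0"
    unfolding scalar_prod_self by (subst (asm) sum_nonneg_eq_0_iff) auto
  then show "v = 0\<^sub>v n" using assms by (intro eq_vecI) auto
qed auto

lemma scalar_prod_self_pos:
  assumes "v \<in> carrier_vec n" "v \<noteq> 0\<^sub>v n" shows "0 < (v::real vec) \<bullet> v"
  using scalar_prod_self_eq_0[OF assms(1)] scalar_prod_self_nonneg[of v] assms(2) by linarith

lemma vec_norm_eq_0: "v \<in> carrier_vec n \<Longrightarrow> vec_norm v = 0 \<longleftrightarrow> v = 0\<^sub>v n"
  using scalar_prod_self_eq_0[of v n] by (simp add: vec_norm_def)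

lemma vec_norm_smult: "vec_norm (c \<cdot>\<^sub>v v) = \<bar>c\<bar> * vec_norm v"
proof -
  have "(c \<cdot>\<^sub>v v) \<bullet> (c \<cdot>\<^sub>v v) = c\<^sup>2 * (v \<bullet> v)"
    by (simp add: scalar_prod_self power_mult_distrib sum_distrib_left)
  then show ?thesis by (simp add: vec_norm_def real_sqrt_mult)
qed

lemma psd_matsD:
  assumes "A \<in> psd_mats n"
  shows "A \<in> carrier_mat n n" "A\<^sup>T = A" "\<And>v. v \<in> carrier_vec n \<Longrightarrow> 0 \<le> qf A v"
  using assms by (auto simp: psd_mats_def sym_mats_def)

lemma pd_matsD:
  assumes "A \<in> pd_mats n"
  shows "A \<in> carrier_mat n n" "A\<^sup>T = A"
    "\<And>v. v \<in> carrier_vec n \<Longrightarrow> v \<noteq> 0\<^sub>v n \<Longrightarrow> 0 < qf A v"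
  using assms by (auto simp: pd_mats_def sym_mats_def)

lemma pd_imp_psd: "A \<in> pd_mats n \<Longrightarrow> A \<in> psd_mats n"
  unfolding pd_mats_def psd_mats_def
proof safe
  fix v :: "real vec" assume A: "A \<in> sym_mats n" and v: "v \<in> carrier_vec n"
    and h: "\<forall>v\<in>carrier_vec n. v \<noteq> 0\<^sub>v n \<longrightarrow> 0 < qf A v"
  show "0 \<le> qf A v"
  proof (cases "v = 0\<^sub>v n")
    case True
    with A v show ?thesis by (auto simp: sym_mats_def scalar_prod_def)
  next
    case False with h v show ?thesis by force
  qed
qed

lemma scalar_prod_mult_adjoint:
  assumes "A \<in> carrier_mat nr nc" "u \<in> carrier_vec nr" "v \<in> carrier_vec nc"
  shows "u \<bullet> ((A::real mat) *\<^sub>v v) = (A\<^sup>T *\<^sub>v u) \<bullet> v"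
  using transpose_vec_mult_scalar[OF assms(1,3,2)] by simp

lemma sym_scalar_swap:
  assumes "A \<in> carrier_mat n n" "A\<^sup>T = A" "u \<in> carrier_vec n" "v \<in> carrier_vec n"
  shows "u \<bullet> ((A::real mat) *\<^sub>v v) = v \<bullet> (A *\<^sub>v u)"
  using scalar_prod_mult_adjoint[OF assms(1,3,4)] assms
  by (simp add: comm_scalar_prod[of _ n])

lemma quad_form_add:
  assumes A: "A \<in> carrier_mat n n" "(A::real mat)\<^sup>T = A" and u: "u \<in> carrier_vec n" and v: "v \<in> carrier_vec n"
  shows "(u + c \<cdot>\<^sub>v v) \<bullet> (A *\<^sub>v (u + c \<cdot>\<^sub>v v)) =
    qf A u + 2 * c * (u \<bullet> (A *\<^sub>v v)) + c\<^sup>2 * (qf A v)"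
proof -
  have 1: "A *\<^sub>v (u + c \<cdot>\<^sub>v v) = A *\<^sub>v u + c \<cdot>\<^sub>v (A *\<^sub>v v)"
    using A u v by (simp add: mult_add_distrib_mat_vec mult_mat_vec)
  have "(u + c \<cdot>\<^sub>v v) \<bullet> (A *\<^sub>v u + c \<cdot>\<^sub>v (A *\<^sub>v v)) =
     qf A u + c * (u \<bullet> (A *\<^sub>v v)) + (c * (v \<bullet> (A *\<^sub>v u)) + c * (c * (qf A v)))"
    using A u v
    by (simp add: add_scalar_prod_distrib[of _ n] scalar_prod_add_distrib[of _ n] distrib_left)
  then show ?thesis
    unfolding 1 using sym_scalar_swap[OF A v u] by (simp add: power2_eq_square)
qed

text \<open>For c > 0 the minimum over t sits at t = -b / c; for c = 0 the polynomial is affine and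
  must be constant. The degenerate case matters because the forms below are only
  semidefinite.\<close>

lemma nonneg_quadratic_discrim:
  fixes a b c :: real
  assumes "\<And>t. 0 \<le> a + 2 * t * b + t\<^sup>2 * c" "0 \<le> c"
  shows "b\<^sup>2 \<le> a * c"
proof (cases "c = 0")
  case False
  then have c: "c > 0" using assms(2) by simp
  have "0 \<le> a + 2 * (- b / c) * b + (- b / c)\<^sup>2 * c" by (rule assms(1))
  also have "\<dots> = (a * c - b\<^sup>2) / c" using c by (simp add: field_simps power2_eq_square)
  finally show ?thesis using c by (simp add: zero_le_divide_iff)
next
  case True
  show ?thesis
  proof (rule ccontr)
    assume "\<not> ?thesis"
    then have "b \<noteq> 0" using True by auto
    \<comment> \<open>At this t the affine function a + 2 t b equals -1.\<close>
    then show False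
      using assms(1)[of "- (a + 1) / (2 * b)"] True by (simp add: field_simps)
  qed
qed

text \<open>The form is nonnegative on the whole line through u in direction v, which bounds its
  discriminant. Instantiated with the identity, \<open>W\<close>, \<open>G\<close> and various
  square roots, this does the work of a spectral decomposition.\<close>

lemma psd_Cauchy_Schwarz:
  assumes A: "A \<in> psd_mats n" and u: "u \<in> carrier_vec n" and v: "v \<in> carrier_vec n"
  shows "(u \<bullet> (A *\<^sub>v v))\<^sup>2 \<le> (qf A u) * (qf A v)"
proof (rule nonneg_quadratic_discrim)
  fix t
  show "0 \<le> qf A u + 2 * t * (u \<bullet> (A *\<^sub>v v)) + t\<^sup>2 * (qf A v)"
    using psd_matsD(3)[OF A, of "u + t \<cdot>\<^sub>v v"] quad_form_add[OF psd_matsD(1,2)[OF A] u v] u v by simp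
qed (use A v psd_matsD in auto)

lemma one_mat_psd: "1\<^sub>m n \<in> psd_mats n"
  by (auto simp: psd_mats_def sym_mats_def scalar_prod_self_nonneg)

lemma Cauchy_Schwarz_vec_norm:
  assumes "u \<in> carrier_vec n" "v \<in> carrier_vec n"
  shows "\<bar>u \<bullet> v\<bar> \<le> vec_norm u * vec_norm v"
proof -
  have "(u \<bullet> v)\<^sup>2 \<le> (vec_norm u * vec_norm v)\<^sup>2"
    using psd_Cauchy_Schwarz[OF one_mat_psd assms] assms by (simp add: power_mult_distrib vec_norm_sq)
  then show ?thesis by (simp add: abs_le_square_iff[symmetric])
qed

lemma Cauchy_Schwarz_vec_norm':
  assumes "u \<in> carrier_vec n" "v \<in> carrier_vec n"
  shows "u \<bullet> v \<le> vec_norm u * vec_norm v"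
  using Cauchy_Schwarz_vec_norm[OF assms] by linarith

lemma vec_norm_add_sq:
  assumes "u \<in> carrier_vec n" "v \<in> carrier_vec n"
  shows "(u + v) \<bullet> (u + v) = u \<bullet> u + 2 * (u \<bullet> v) + (v::real vec) \<bullet> v"
  using quad_form_add[OF one_carrier_mat transpose_one, OF assms, of 1] assms by simp

lemma vec_norm_triangle:
  assumes "u \<in> carrier_vec n" "v \<in> carrier_vec n"
  shows "vec_norm (u + v) \<le> vec_norm u + vec_norm v"
proof (rule power2_le_imp_le)
  have "(vec_norm (u + v))\<^sup>2 = u \<bullet> u + 2 * (u \<bullet> v) + v \<bullet> v"
    using vec_norm_add_sq[OF assms] by (simp add: vec_norm_sq)
  also have "\<dots> \<le> (vec_norm u + vec_norm v)\<^sup>2"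
    using Cauchy_Schwarz_vec_norm'[OF assms] by (simp add: power2_sum vec_norm_sq)
  finally show "(vec_norm (u + v))\<^sup>2 \<le> (vec_norm u + vec_norm v)\<^sup>2" .
qed simp

lemma vec_norm_uminus: "vec_norm (- v) = vec_norm v"
  by (simp add: vec_norm_def scalar_prod_self)

lemma vec_norm_diff_le:
  assumes "u \<in> carrier_vec n" "v \<in> carrier_vec n"
  shows "vec_norm (u - v) \<le> vec_norm u + vec_norm v"
  using vec_norm_triangle[of u n "- v"] assms by (simp add: vec_norm_uminus minus_add_uminus_vec[of _ n])

lemma vec_norm_diff_ge:
  assumes "u \<in> carrier_vec n" "v \<in> carrier_vec n"
  shows "vec_norm u - vec_norm v \<le> vec_norm (u + v)"
proof -
  have "(u + v) - v = u" using assms by (intro eq_vecI) auto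
  then show ?thesis using vec_norm_diff_le[of "u + v" n v] assms by auto
qed

lemma vec_norm_append:
  "vec_norm (x @\<^sub>v y) = sqrt ((vec_norm x)\<^sup>2 + (vec_norm y)\<^sup>2)"
proof -
  have "(x @\<^sub>v y) \<bullet> (x @\<^sub>v y) = x \<bullet> x + y \<bullet> y"
    by (rule scalar_prod_append) (rule carrier_vec_dim_vec)+
  then show ?thesis unfolding vec_norm_sq by (simp only: vec_norm_def)
qed

lemma vec_norm_append_le: "vec_norm (x @\<^sub>v y) \<le> vec_norm x + vec_norm y"
  unfolding vec_norm_append by (rule sqrt_sum_squares_le_sum) auto

lemma vec_norm_le_append:
  "vec_norm x \<le> vec_norm (x @\<^sub>v y)" "vec_norm y \<le> vec_norm (x @\<^sub>v y)"
  unfolding vec_norm_append by (auto intro: real_le_rsqrt)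

section \<open>The spectral norm\<close>

lemma frobenius_norm_nonneg [simp]: "0 \<le> frobenius_norm A"
  by (simp add: frobenius_norm_def sum_nonneg)

text \<open>Cauchy-Schwarz in each row. It bounds the set in \<open>spectral_norm\<close>, whose
  \<open>SUP\<close> is meaningful only then.\<close>

lemma vec_norm_mult_le_frobenius:
  assumes A: "A \<in> carrier_mat nr nc" and v: "v \<in> carrier_vec nc"
  shows "vec_norm (A *\<^sub>v v) \<le> frobenius_norm A * vec_norm v"
proof (rule power2_le_imp_le)
  have "(vec_norm (A *\<^sub>v v))\<^sup>2 = (\<Sum>i<nr. (row A i \<bullet> v)\<^sup>2)"
    using A by (simp add: vec_norm_sq scalar_prod_self)
  also have "\<dots> \<le> (\<Sum>i<nr. (row A i \<bullet> row A i) * (v \<bullet> v))"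
  proof (rule sum_mono)
    fix i assume "i \<in> {..<nr}"
    then have "row A i \<in> carrier_vec nc" using A by auto
    then show "(row A i \<bullet> v)\<^sup>2 \<le> (row A i \<bullet> row A i) * (v \<bullet> v)"
      using psd_Cauchy_Schwarz[OF one_mat_psd _ v] v by fastforce
  qed
  also have "\<dots> = (frobenius_norm A * vec_norm v)\<^sup>2"
    using A by (simp add: power_mult_distrib vec_norm_sq frobenius_norm_def sum_nonneg
        scalar_prod_self sum_distrib_right)
  finally show "(vec_norm (A *\<^sub>v v))\<^sup>2 \<le> (frobenius_norm A * vec_norm v)\<^sup>2" .
qed simp

lemma spectral_norm_bdd:
  "bdd_above ((\<lambda>v. vec_norm (A *\<^sub>v v)) ` {v \<in> carrier_vec (dim_col A). vec_norm v \<le> 1})"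
proof (rule bdd_aboveI2)
  fix x assume "x \<in> {v \<in> carrier_vec (dim_col A). vec_norm v \<le> 1}"
  then show "vec_norm (A *\<^sub>v x) \<le> frobenius_norm A"
    using vec_norm_mult_le_frobenius[OF carrier_mat_triv, of x A]
    by (auto intro: order_trans[OF _ mult_left_le])
qed

lemma vec_norm_mult_le_spectral:
  assumes A: "A \<in> carrier_mat nr nc" and v: "v \<in> carrier_vec nc"
  shows "vec_norm (A *\<^sub>v v) \<le> spectral_norm A * vec_norm v"
proof (cases "v = 0\<^sub>v nc")
  case True
  then have "A *\<^sub>v v = 0\<^sub>v nr" using A by auto
  then show ?thesis using True by (simp add: vec_norm_def)
next
  case False
  let ?c = "vec_norm v"
  have c: "?c > 0" using False vec_norm_eq_0[OF v] vec_norm_nonneg[of v] by linarith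
  let ?u = "(1 / ?c) \<cdot>\<^sub>v v"
  have u: "?u \<in> {v \<in> carrier_vec (dim_col A). vec_norm v \<le> 1}"
    using A v c by (simp add: vec_norm_smult)
  have "vec_norm (A *\<^sub>v ?u) \<le> spectral_norm A"
    unfolding spectral_norm_def
    by (rule cSUP_upper[OF u spectral_norm_bdd])
  moreover have "vec_norm (A *\<^sub>v ?u) = vec_norm (A *\<^sub>v v) / ?c"
    using mult_mat_vec[OF A v, of "1 / ?c"] c by (simp add: vec_norm_smult)
  ultimately show ?thesis using c by (simp add: field_simps)
qed

lemma spectral_norm_leI:
  assumes "A \<in> carrier_mat nr nc" "0 \<le> c"
    "\<And>v. v \<in> carrier_vec nc \<Longrightarrow> vec_norm (A *\<^sub>v v) \<le> c * vec_norm v"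
  shows "spectral_norm A \<le> c"
  unfolding spectral_norm_def
proof (rule cSUP_least)
  have "0\<^sub>v nc \<in> {v \<in> carrier_vec (dim_col A). vec_norm v \<le> 1}"
    using assms(1) by (auto simp: vec_norm_def)
  then show "{v \<in> carrier_vec (dim_col A). vec_norm v \<le> 1} \<noteq> {}" by blast
next
  fix x assume x: "x \<in> {v \<in> carrier_vec (dim_col A). vec_norm v \<le> 1}"
  then have "vec_norm (A *\<^sub>v x) \<le> c * vec_norm x" using assms by auto
  also have "\<dots> \<le> c" using x assms(2) by (auto intro: mult_left_le)
  finally show "vec_norm (A *\<^sub>v x) \<le> c" .
qed

lemma spectral_norm_nonneg: "0 \<le> spectral_norm A"
proof -
  have "0 \<le> vec_norm (A *\<^sub>v 0\<^sub>v (dim_col A))" by simp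
  also have "\<dots> \<le> spectral_norm A"
    unfolding spectral_norm_def
    by (rule cSUP_upper[OF _ spectral_norm_bdd]) (auto simp: vec_norm_def)
  finally show ?thesis .
qed

lemma quad_form_le_spectral:
  assumes A: "A \<in> carrier_mat n n" and v: "v \<in> carrier_vec n"
  shows "\<bar>qf A v\<bar> \<le> spectral_norm A * (v \<bullet> v)"
proof -
  have "\<bar>qf A v\<bar> \<le> vec_norm v * vec_norm (A *\<^sub>v v)"
    using A v by (intro Cauchy_Schwarz_vec_norm[of _ n]) auto
  also have "\<dots> \<le> vec_norm v * (spectral_norm A * vec_norm v)"
    by (intro mult_left_mono vec_norm_mult_le_spectral[OF A v]) simp
  also have "\<dots> = spectral_norm A * (vec_norm v)\<^sup>2" by (simp add: power2_eq_square)
  finally show ?thesis by (simp add: vec_norm_sq)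
qed

text \<open>Cauchy-Schwarz for the form of \<open>A\<close> at w = A v and v gives |w|^4 \<le> c
  |w|^2 c |v|^2. So a bound on the form of a semidefinite matrix bounds its norm, without
  eigenvalues.\<close>

lemma psd_vec_norm_mult_le:
  assumes A: "A \<in> psd_mats n" and c: "0 \<le> c"
    and le: "\<And>v. v \<in> carrier_vec n \<Longrightarrow> qf A v \<le> c * (v \<bullet> v)" and v: "v \<in> carrier_vec n"
  shows "vec_norm (A *\<^sub>v v) \<le> c * vec_norm v"
proof -
  let ?w = "A *\<^sub>v v"
  have w: "?w \<in> carrier_vec n" using psd_matsD(1)[OF A] v by auto
  have "(?w \<bullet> ?w)\<^sup>2 \<le> (qf A ?w) * (qf A v)"
    by (rule psd_Cauchy_Schwarz[OF A w v])
  also have "\<dots> \<le> (c * (?w \<bullet> ?w)) * (c * (v \<bullet> v))"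
    using le[OF w] le[OF v] psd_matsD(3)[OF A] w v c
    by (intro mult_mono) (auto simp: scalar_prod_self_nonneg)
  finally have *: "(vec_norm ?w)\<^sup>2 * (vec_norm ?w)\<^sup>2 \<le> (vec_norm ?w)\<^sup>2 * (c * vec_norm v)\<^sup>2"
    by (simp add: vec_norm_sq[symmetric] power_mult_distrib power2_eq_square mult_ac)
  show ?thesis
  proof (cases "vec_norm ?w = 0")
    case False
    then have "(vec_norm ?w)\<^sup>2 > 0" by simp
    with * have "(vec_norm ?w)\<^sup>2 \<le> (c * vec_norm v)\<^sup>2"
      by (simp only: mult_le_cancel_left_pos)
    then show ?thesis by (rule power2_le_imp_le) (use c in simp)
  qed (use c in simp)
qed

section \<open>Inverses\<close>

text \<open>\<open>inv_mat\<close> unwraps an option and is unspecified on singular matrices. A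
  trivial kernel excludes determinant 0; every inverse below is justified through this
  criterion.\<close>

lemma inv_mat_of_injective:
  assumes A: "A \<in> carrier_mat n n"
    and inj: "\<And>v. v \<in> carrier_vec n \<Longrightarrow> A *\<^sub>v v = 0\<^sub>v n \<Longrightarrow> v = 0\<^sub>v n"
  shows "invertible_mat A" "inv_mat A \<in> carrier_mat n n"
    "A * inv_mat A = 1\<^sub>m n" "inv_mat A * A = 1\<^sub>m n"
proof -
  have "det A \<noteq> 0" using det_0_iff_vec_prod_zero_field[OF A] inj by auto
  then have "A \<in> Units (ring_mat TYPE(real) n undefined)" by (rule det_non_zero_imp_unit[OF A])
  then obtain B where B: "mat_inverse A = Some B"
    using mat_inverse(1)[OF A, of undefined] by (cases "mat_inverse A") auto
  note * = mat_inverse(2)[OF A B]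
  have i: "inv_mat A = B" by (simp add: inv_mat_def B)
  show "inv_mat A \<in> carrier_mat n n" "A * inv_mat A = 1\<^sub>m n" "inv_mat A * A = 1\<^sub>m n"
    using * i by auto
  then show "invertible_mat A"
    using A unfolding invertible_mat_def inverts_mat_def by (auto intro!: exI[of _ "inv_mat A"])
qed

lemma right_inverse_unique:
  assumes "A \<in> carrier_mat n n" "B \<in> carrier_mat n n" "C \<in> carrier_mat n n"
    "B * (A::real mat) = 1\<^sub>m n" "A * C = 1\<^sub>m n"
  shows "B = C"
proof -
  have "B = B * (A * C)" unfolding assms(5) using assms(2) by simp
  also have "\<dots> = (B * A) * C" using assms(1-3) by simp
  also have "\<dots> = C" unfolding assms(4) using assms(3) by simp
  finally show ?thesis .
qed

lemma inv_mat_eqI: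
  assumes A: "A \<in> carrier_mat n n" and B: "B \<in> carrier_mat n n" and AB: "B * A = 1\<^sub>m n"
  shows "inv_mat A = B"
proof -
  have "v = 0\<^sub>v n" if "v \<in> carrier_vec n" "A *\<^sub>v v = 0\<^sub>v n" for v
  proof -
    have "v = (B * A) *\<^sub>v v" using AB that by simp
    also have "\<dots> = B *\<^sub>v (A *\<^sub>v v)" using A B that by simp
    also have "\<dots> = 0\<^sub>v n" using that B by auto
    finally show ?thesis .
  qed
  from inv_mat_of_injective[OF A this] right_inverse_unique[OF A B _ AB] show ?thesis by metis
qed

lemma inv_mat_transpose:
  assumes A: "A \<in> carrier_mat n n" "A\<^sup>T = A" and i: "inv_mat A \<in> carrier_mat n n" "A * inv_mat A = 1\<^sub>m n"
  shows "(inv_mat A)\<^sup>T = inv_mat A"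
proof -
  have "(inv_mat A)\<^sup>T * A\<^sup>T = 1\<^sub>m n"
    using transpose_mult[OF A(1) i(1)] i(2) by simp
  then show ?thesis using inv_mat_eqI[OF A(1), of "(inv_mat A)\<^sup>T"] A i by simp
qed

lemma inv_mat_vec_cancel:
  assumes A: "A \<in> carrier_mat n n" and i: "inv_mat A \<in> carrier_mat n n"
    "A * inv_mat A = 1\<^sub>m n" "inv_mat A * A = 1\<^sub>m n" and v: "v \<in> carrier_vec n"
  shows "A *\<^sub>v (inv_mat A *\<^sub>v v) = v" "inv_mat A *\<^sub>v (A *\<^sub>v v) = v"
  using assoc_mult_mat_vec[OF A i(1) v] assoc_mult_mat_vec[OF i(1) A v] i v by simp_all

lemma pd_injective:
  assumes A: "A \<in> pd_mats n" and "v \<in> carrier_vec n" "A *\<^sub>v v = 0\<^sub>v n" shows "v = 0\<^sub>v n"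
  using pd_matsD(3)[OF A, of v] assms by (cases "v = 0\<^sub>v n") auto

lemma pd_inv_mat:
  assumes A: "A \<in> pd_mats n"
  shows "invertible_mat A" "inv_mat A \<in> carrier_mat n n"
    "A * inv_mat A = 1\<^sub>m n" "inv_mat A * A = 1\<^sub>m n"
  using inv_mat_of_injective[OF pd_matsD(1)[OF A] pd_injective[OF A]] by blast+

lemma pd_inv_sym:
  assumes A: "A \<in> pd_mats n" shows "(inv_mat A)\<^sup>T = inv_mat A"
  using inv_mat_transpose[of A n] pd_matsD[OF A] pd_inv_mat[OF A] by blast

lemma pd_inv_pd:
  assumes A: "A \<in> pd_mats n" shows "inv_mat A \<in> pd_mats n"
proof -
  note i = pd_inv_mat[OF A] and c = inv_mat_vec_cancel[OF pd_matsD(1)[OF A] pd_inv_mat(2-4)[OF A]]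
  show ?thesis
    unfolding pd_mats_def sym_mats_def
  proof (safe, goal_cases)
    case (3 v)
    let ?w = "inv_mat A *\<^sub>v v"
    have w: "?w \<in> carrier_vec n" using i 3 by auto
    have "?w \<noteq> 0\<^sub>v n"
    proof
      assume "?w = 0\<^sub>v n"
      then have "v = A *\<^sub>v 0\<^sub>v n" using c(1)[OF 3(1)] by simp
      then show False using 3(2) pd_matsD(1)[OF A] by auto
    qed
    then have "0 < qf A ?w" using pd_matsD(3)[OF A w] by simp
    then show ?case using c(1)[OF 3(1)] 3 w by (simp add: comm_scalar_prod[of _ n])
  qed (use i pd_inv_sym[OF A] in auto)
qed

text \<open>With w = A^-1 v, Cauchy-Schwarz gives (v . v)^2 = (v . A w)^2 \<le> (v . A v)(v . A^-1
  v), and the last factor is at most the norm of the inverse times v . v. This is the bound by the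
  least eigenvalue without mentioning it.\<close>

lemma pd_lower_bound:
  assumes A: "A \<in> pd_mats n" and v: "v \<in> carrier_vec n"
  shows "v \<bullet> v \<le> spectral_norm (inv_mat A) * (qf A v)"
proof (cases "v = 0\<^sub>v n")
  case True
  then show ?thesis using psd_matsD(3)[OF pd_imp_psd[OF A] v] spectral_norm_nonneg v by auto
next
  case False
  note i = pd_inv_mat[OF A] and c = inv_mat_vec_cancel[OF pd_matsD(1)[OF A] pd_inv_mat(2-4)[OF A]]
  let ?w = "inv_mat A *\<^sub>v v"
  have w: "?w \<in> carrier_vec n" using i v by auto
  have "(v \<bullet> v)\<^sup>2 = (v \<bullet> (A *\<^sub>v ?w))\<^sup>2" by (simp add: c v)
  also have "\<dots> \<le> (qf A v) * (qf A ?w)"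
    by (rule psd_Cauchy_Schwarz[OF pd_imp_psd[OF A] v w])
  also have "qf A ?w = v \<bullet> ?w" using v w by (simp add: c comm_scalar_prod[of _ n])
  also have "(qf A v) * (v \<bullet> ?w) \<le> (qf A v) * (spectral_norm (inv_mat A) * (v \<bullet> v))"
    using quad_form_le_spectral[OF i(2) v] psd_matsD(3)[OF pd_imp_psd[OF A] v]
    by (intro mult_left_mono) auto
  finally have "(v \<bullet> v) * (v \<bullet> v) \<le> (v \<bullet> v) * (spectral_norm (inv_mat A) * (qf A v))"
    by (simp add: power2_eq_square mult_ac)
  then show ?thesis using scalar_prod_self_pos[OF v False] by simp
qed

section \<open>Square roots of positive definite matrices\<close>

lemma psd_zero_form_imp_zero:
  assumes A: "A \<in> psd_mats n" and v: "v \<in> carrier_vec n" and z: "qf A v = 0"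
  shows "A *\<^sub>v v = 0\<^sub>v n"
proof -
  let ?w = "A *\<^sub>v v"
  have w: "?w \<in> carrier_vec n" using psd_matsD(1)[OF A] v by auto
  have "(?w \<bullet> ?w)\<^sup>2 \<le> 0" using psd_Cauchy_Schwarz[OF A w v] z by simp
  then show ?thesis using scalar_prod_self_eq_0[OF w] by simp
qed

lemma trace_mult_comm:
  assumes "X \<in> carrier_mat n n" "Y \<in> carrier_mat n n"
  shows "(\<Sum>i<n. (X * Y) $$ (i, i)) = (\<Sum>i<n. ((Y::real mat) * X) $$ (i, i))"
proof -
  have "(\<Sum>i<n. (X * Y) $$ (i, i)) = (\<Sum>i<n. \<Sum>j<n. X $$ (i, j) * Y $$ (j, i))"
    using assms by (auto intro!: sum.cong simp: scalar_prod_def atLeast0LessThan)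
  also have "\<dots> = (\<Sum>j<n. \<Sum>i<n. Y $$ (j, i) * X $$ (i, j))"
    by (subst sum.swap) (simp add: mult.commute)
  also have "\<dots> = (\<Sum>i<n. (Y * X) $$ (i, i))"
    using assms by (auto intro!: sum.cong simp: scalar_prod_def atLeast0LessThan)
  finally show ?thesis .
qed

text \<open>With \<open>D = B - C\<close> and \<open>P = B + C\<close> one has \<open>P D = - D P\<close>, so \<open>D P D\<close> has trace zero; it is
  positive semidefinite, which forces \<open>D = 0\<close>.\<close>

lemma psd_sqrt_unique:
  assumes B: "B \<in> psd_mats n" and C: "C \<in> psd_mats n" and A: "B * B \<in> pd_mats n" and eq: "C * C = B * B"
  shows "B = C"
proof -
  note Bc = psd_matsD(1)[OF B] and Cc = psd_matsD(1)[OF C]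
  define D where "D = B - C"
  define P where "P = B + C"
  have D: "D \<in> carrier_mat n n" and P: "P \<in> carrier_mat n n" using Bc Cc by (auto simp: D_def P_def)
  have Ds: "D\<^sup>T = D" using transpose_minus[OF Bc Cc] psd_matsD(2)[OF B] psd_matsD(2)[OF C] by (simp add: D_def)
  have PD: "P * D = B * B + C * B - (B * C + C * C)"
    unfolding P_def D_def using Bc Cc
    by (simp add: add_mult_distrib_mat[of _ n n] mult_minus_distrib_mat[of _ n n])
  have DP: "D * P = B * B + B * C - (C * B + C * C)"
    unfolding P_def D_def using Bc Cc
    by (simp add: minus_mult_distrib_mat[OF Bc Cc add_carrier_mat[OF Cc]] mult_add_distrib_mat[OF Bc Bc Cc]
        mult_add_distrib_mat[OF Cc Bc Cc])
  have anti: "P * D = - (D * P)"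
    unfolding PD DP eq using Bc Cc by (intro eq_matI) auto
  have "(\<Sum>i<n. (D * (P * D)) $$ (i, i)) = - (\<Sum>i<n. (D * (D * P)) $$ (i, i))"
    unfolding anti using D P by (simp add: sum_negf)
  also have "(\<Sum>i<n. (D * (D * P)) $$ (i, i)) = (\<Sum>i<n. ((D * P) * D) $$ (i, i))"
    using D P by (intro trace_mult_comm) auto
  also have "(D * P) * D = D * (P * D)" using D P by simp
  finally have tr: "(\<Sum>i<n. (D * (P * D)) $$ (i, i)) = 0" by simp
  have diag: "(D * (P * D)) $$ (i, i) = col D i \<bullet> (B *\<^sub>v col D i) + col D i \<bullet> (C *\<^sub>v col D i)" if i: "i < n" for i
  proof -
    have c: "col D i \<in> carrier_vec n" using D i by auto
    have "row D i = col D i" using Ds D i by (metis carrier_matD(2) row_transpose)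
    moreover have "col (P * D) i = P *\<^sub>v col D i" using P D i by auto
    moreover have "P *\<^sub>v col D i = B *\<^sub>v col D i + C *\<^sub>v col D i"
      unfolding P_def using Bc Cc c by (simp add: add_mult_distrib_mat_vec)
    moreover have "(D * (P * D)) $$ (i, i) = row D i \<bullet> col (P * D) i" using P D i by simp
    ultimately show ?thesis using Bc Cc c by (simp add: scalar_prod_add_distrib[of _ n])
  qed
  have "col D i = 0\<^sub>v n" if i: "i < n" for i
  proof -
    let ?c = "col D i"
    have c: "?c \<in> carrier_vec n" using D i by auto
    have "\<forall>i<n. (D * (P * D)) $$ (i, i) = 0"
    proof -
      have "0 \<le> (D * (P * D)) $$ (i, i)" if "i < n" for i
        unfolding diag[OF that] using psd_matsD(3)[OF B] psd_matsD(3)[OF C] D that by (intro add_nonneg_nonneg) auto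
      then show ?thesis using tr by (subst (asm) sum_nonneg_eq_0_iff) auto
    qed
    \<comment> \<open>A vanishing diagonal entry is a sum of two nonnegative forms, so both are 0.
      Then \<open>B\<close> annihilates the column, and definiteness of \<open>B * B\<close> makes
      the column zero.\<close>
    then have "qf B ?c = 0"
      using diag[OF i] i psd_matsD(3)[OF B c] psd_matsD(3)[OF C c] by fastforce
    then have "B *\<^sub>v ?c = 0\<^sub>v n" by (rule psd_zero_form_imp_zero[OF B c])
    then have "(B * B) *\<^sub>v ?c = 0\<^sub>v n" using Bc c by auto
    then show ?thesis by (rule pd_injective[OF A c])
  qed
  then have "D = 0\<^sub>m n n" using D by (intro mat_col_eqI) auto
  then have z: "D $$ (i, j) = 0" if "i < n" "j < n" for i j using that by simp
  show ?thesis
  proof (rule eq_matI)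
    fix i j assume "i < dim_row C" "j < dim_col C"
    then show "B $$ (i, j) = C $$ (i, j)" using z[of i j] Bc Cc by (simp add: D_def)
  qed (use Bc Cc in auto)
qed

text \<open>Newton's series for (1 - B)^a. Summing entry by entry keeps all limits in the
  reals.\<close>

definition binomial_mat :: "real \<Rightarrow> real mat \<Rightarrow> real mat" where
  "binomial_mat a B = mat (dim_row B) (dim_row B)
     (\<lambda>(i, j). \<Sum>k. (a gchoose k) * (- 1) ^ k * (B ^\<^sub>m k) $$ (i, j))"

lemma pow_mat_add:
  assumes "B \<in> carrier_mat n n" shows "B ^\<^sub>m (p + q) = B ^\<^sub>m p * (B::real mat) ^\<^sub>m q"
proof (induction q)
  case (Suc q)
  then show ?case using assms by (simp add: assoc_mult_mat[of _ n n _ n _ n])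
qed (use assms in simp)

text \<open>Factor by factor, |a - i| \<le> i + 1. With coefficients bounded by 1, geometric decay
  of the powers of \<open>B\<close> suffices for convergence.\<close>

lemma abs_gbinomial_le_1:
  assumes "0 \<le> a" "a \<le> 1" shows "\<bar>(a::real) gchoose k\<bar> \<le> 1"
proof -
  have "\<bar>\<Prod>i = 0..<k. a - of_nat i\<bar> \<le> (\<Prod>i = 0..<k. of_nat (Suc i))"
    unfolding abs_prod by (rule prod_mono) (use assms in auto)
  also have "\<dots> = fact k" by (simp add: fact_prod_Suc)
  finally show ?thesis by (simp add: gbinomial_prod_rev)
qed

context
  fixes B :: "real mat" and n :: nat and \<rho> :: real
  assumes B: "B \<in> carrier_mat n n" and \<rho>: "0 \<le> \<rho>" "\<rho> < 1"
    and entries: "\<And>k i j. i < n \<Longrightarrow> j < n \<Longrightarrow> \<bar>(B ^\<^sub>m k) $$ (i, j)\<bar> \<le> \<rho> ^ k"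
begin

lemma binomial_mat_summable:
  assumes "0 \<le> a" "a \<le> 1" "i < n" "j < n"
  shows "summable (\<lambda>k. norm ((a gchoose k) * (- 1) ^ k * (B ^\<^sub>m k) $$ (i, j)))"
proof (rule summable_comparison_test')
  show "summable (\<lambda>k. \<rho> ^ k)" using \<rho> by (simp add: summable_geometric)
  fix k
  show "norm (norm ((a gchoose k) * (- 1) ^ k * (B ^\<^sub>m k) $$ (i, j))) \<le> \<rho> ^ k"
    using mult_mono[OF abs_gbinomial_le_1[OF assms(1,2), of k] entries[OF assms(3,4), of k]]
    by (simp add: abs_mult power_abs)
qed

text \<open>The Cauchy product in each entry collects the terms of degree k; there the powers of
  \<open>B\<close> combine to \<open>B ^\<^sub>m k\<close>, and Vandermonde's convolution sums the
  coefficients.\<close>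

lemma binomial_mat_mult:
  assumes "0 \<le> a" "a \<le> 1" "0 \<le> b" "b \<le> 1"
  shows "binomial_mat a B * binomial_mat b B = binomial_mat (a + b) B"
proof (rule eq_matI)
  fix i j assume "i < dim_row (binomial_mat (a + b) B)" "j < dim_col (binomial_mat (a + b) B)"
  then have i: "i < n" and j: "j < n" using B by (auto simp: binomial_mat_def)
  define f where "f a i j k = (a gchoose k) * (- 1) ^ k * (B ^\<^sub>m k) $$ (i, j)" for a i j k
  have 1: "(\<lambda>k. \<Sum>l<n. \<Sum>p\<le>k. f a i l p * f b l j (k - p)) sums (\<Sum>l<n. (\<Sum>k. f a i l k) * (\<Sum>k. f b l j k))"
    unfolding f_def using binomial_mat_summable assms i j
    by (intro sums_sum Cauchy_product_sums) auto
  have 2: "(\<Sum>l<n. \<Sum>p\<le>k. f a i l p * f b l j (k - p)) = f (a + b) i j k" for k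
  proof -
    have "(\<Sum>l<n. \<Sum>p\<le>k. f a i l p * f b l j (k - p)) =
        (\<Sum>p\<le>k. \<Sum>l<n. f a i l p * f b l j (k - p))" by (rule sum.swap)
    also have "\<dots> = (\<Sum>p\<le>k. (a gchoose p) * (b gchoose (k - p)) * (- 1) ^ k *
        (\<Sum>l<n. (B ^\<^sub>m p) $$ (i, l) * (B ^\<^sub>m (k - p)) $$ (l, j)))"
    proof (rule sum.cong[OF refl])
      fix p assume "p \<in> {..k}"
      then have "(- 1::real) ^ k = (- 1) ^ p * (- 1) ^ (k - p)" by (simp flip: power_add)
      then show "(\<Sum>l<n. f a i l p * f b l j (k - p)) = (a gchoose p) * (b gchoose (k - p)) * (- 1) ^ k *
          (\<Sum>l<n. (B ^\<^sub>m p) $$ (i, l) * (B ^\<^sub>m (k - p)) $$ (l, j))"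
        unfolding f_def sum_distrib_left by (intro sum.cong) (auto simp: mult_ac)
    qed
    also have "\<dots> = (\<Sum>p\<le>k. (a gchoose p) * (b gchoose (k - p)) * (- 1) ^ k * (B ^\<^sub>m k) $$ (i, j))"
    proof (rule sum.cong[OF refl])
      fix p assume "p \<in> {..k}"
      then have "B ^\<^sub>m k = B ^\<^sub>m p * B ^\<^sub>m (k - p)" using pow_mat_add[OF B, of p "k - p"] by simp
      moreover have "(B ^\<^sub>m p * B ^\<^sub>m (k - p)) $$ (i, j) = (\<Sum>l<n. (B ^\<^sub>m p) $$ (i, l) * (B ^\<^sub>m (k - p)) $$ (l, j))"
        using B i j pow_carrier_mat[OF B, of p] pow_carrier_mat[OF B, of "k - p"]
        by (simp add: scalar_prod_def atLeast0LessThan)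
      ultimately show "(a gchoose p) * (b gchoose (k - p)) * (- 1) ^ k *
          (\<Sum>l<n. (B ^\<^sub>m p) $$ (i, l) * (B ^\<^sub>m (k - p)) $$ (l, j)) =
        (a gchoose p) * (b gchoose (k - p)) * (- 1) ^ k * (B ^\<^sub>m k) $$ (i, j)" by simp
    qed
    also have "\<dots> = f (a + b) i j k"
      unfolding f_def gbinomial_Vandermonde[symmetric] sum_distrib_right by (simp add: atMost_atLeast0)
    finally show ?thesis .
  qed
  show "(binomial_mat a B * binomial_mat b B) $$ (i, j) = binomial_mat (a + b) B $$ (i, j)"
    using B i j sums_unique[OF 1] unfolding 2
    by (simp add: binomial_mat_def scalar_prod_def atLeast0LessThan f_def)
qed (auto simp: binomial_mat_def)

lemma binomial_mat_1: "binomial_mat 1 B = 1\<^sub>m n - B"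
proof (rule eq_matI)
  fix i j assume "i < dim_row (1\<^sub>m n - B)" "j < dim_col (1\<^sub>m n - B)"
  then have i: "i < n" and j: "j < n" using B by auto
  have "((1::real) gchoose k) = 0" if "k \<notin> {0, 1}" for k
    using binomial_gbinomial[of 1 k, where 'a = real] that by (simp add: binomial_eq_0)
  then have "(\<Sum>k. ((1::real) gchoose k) * (- 1) ^ k * (B ^\<^sub>m k) $$ (i, j)) =
     (\<Sum>k\<in>{0, 1}. ((1::real) gchoose k) * (- 1) ^ k * (B ^\<^sub>m k) $$ (i, j))"
    by (intro suminf_finite) auto
  then show "binomial_mat 1 B $$ (i, j) = (1\<^sub>m n - B) $$ (i, j)"
    using i j B by (simp add: binomial_mat_def)
qed (use B in \<open>auto simp: binomial_mat_def\<close>)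

lemma binomial_mat_transpose:
  assumes "B\<^sup>T = B" shows "(binomial_mat a B)\<^sup>T = binomial_mat a B"
proof -
  have "(B ^\<^sub>m k)\<^sup>T = B ^\<^sub>m k" for k
  proof (induction k)
    case (Suc k)
    have "(B ^\<^sub>m Suc k)\<^sup>T = B * B ^\<^sub>m k"
      using B Suc assms transpose_mult[OF pow_carrier_mat[OF B] B] by simp
    then show ?case using pow_mat_add[OF B, of 1 k] B by simp
  qed (use B in auto)
  then have "(B ^\<^sub>m k) $$ (j, i) = (B ^\<^sub>m k) $$ (i, j)" if "i < n" "j < n" for i j k
    using pow_carrier_mat[OF B, of k] that by (metis carrier_matD index_transpose_mat(1))
  then show ?thesis using B by (intro eq_matI) (auto simp: binomial_mat_def)
qed

text \<open>Exponent 1/2 gives the root. Its positivity comes from exponent 1/4: that series T is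
  symmetric with T T = R, so the form of R at v is |T v|^2.\<close>

lemma psd_sqrt_one_minus:
  assumes "B\<^sup>T = B" shows "\<exists>R \<in> psd_mats n. R * R = 1\<^sub>m n - B"
proof (intro bexI)
  let ?R = "binomial_mat (1/2) B" and ?T = "binomial_mat (1/4) B"
  show "?R * ?R = 1\<^sub>m n - B" using binomial_mat_mult[of "1/2" "1/2"] binomial_mat_1 by simp
  have T: "?T \<in> carrier_mat n n" "?T\<^sup>T = ?T" using B binomial_mat_transpose[OF assms] by (auto simp: binomial_mat_def)
  have R: "?R = ?T * ?T" using binomial_mat_mult[of "1/4" "1/4"] by simp
  show "?R \<in> psd_mats n"
    unfolding psd_mats_def sym_mats_def
  proof (safe, goal_cases)
    case (3 v)
    have "qf ?R v = (?T *\<^sub>v v) \<bullet> (?T *\<^sub>v v)"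
      unfolding R using T 3 scalar_prod_mult_adjoint[OF T(1) 3, of "?T *\<^sub>v v"] by simp
    then show ?case by (simp add: scalar_prod_self_nonneg)
  qed (use T R in \<open>simp_all add: binomial_mat_transpose[OF assms] transpose_mult[OF T(1) T(1)]\<close>)
qed

end

lemma smult_mat_mult_vec:
  assumes "A \<in> carrier_mat nr nc" "v \<in> carrier_vec nc"
  shows "(c \<cdot>\<^sub>m A) *\<^sub>v v = c \<cdot>\<^sub>v ((A::real mat) *\<^sub>v v)"
  using assms by (intro eq_vecI) auto

lemma psd_smult: "A \<in> psd_mats n \<Longrightarrow> 0 \<le> c \<Longrightarrow> c \<cdot>\<^sub>m A \<in> psd_mats n"
  unfolding psd_mats_def sym_mats_def
proof (safe, goal_cases)
  case 2 then show ?case by (intro eq_matI) (auto, metis index_transpose_mat(1) carrier_matD)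
next
  case (3 v)
  then have "(c \<cdot>\<^sub>m A) *\<^sub>v v = c \<cdot>\<^sub>v (A *\<^sub>v v)" by (intro eq_vecI) auto
  then show ?case using 3 by (auto simp: scalar_prod_smult_distrib[of _ n])
qed auto

lemma scalar_prod_mult_unit_vec:
  assumes "P \<in> carrier_mat n n" "i < n" "j < n"
  shows "unit_vec n i \<bullet> ((P::real mat) *\<^sub>v unit_vec n j) = P $$ (i, j)"
  using assms by simp

text \<open>Dividing by c, which exceeds the norm of \<open>A\<close>, makes B = 1 - A / c
  semidefinite with norm below 1, so the series applies to it. From A = c (1 - B) the root of
  \<open>A\<close> is sqrt c times that of 1 - B.\<close>

lemma psd_sqrt_exists:
  assumes A: "A \<in> pd_mats n" shows "\<exists>R \<in> psd_mats n. R * R = A"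
proof -
  note Ac = pd_matsD(1)[OF A]
  \<comment> \<open>The added 1 keeps c and \<alpha> positive even for n = 0.\<close>
  define c where "c = spectral_norm A + 1"
  define \<alpha> where "\<alpha> = spectral_norm (inv_mat A) + 1"
  have c: "c \<ge> 1" and \<alpha>: "\<alpha> \<ge> 1" using spectral_norm_nonneg by (auto simp: c_def \<alpha>_def)
  define \<rho> where "\<rho> = 1 - min 1 (1 / (c * \<alpha>))"
  have \<rho>: "0 \<le> \<rho>" "\<rho> < 1" "1 - 1 / (c * \<alpha>) \<le> \<rho>" using c \<alpha> by (auto simp: \<rho>_def)
  define B where "B = 1\<^sub>m n - (1 / c) \<cdot>\<^sub>m A"
  have B: "B \<in> carrier_mat n n" using Ac by (auto simp: B_def)
  have Bs: "B\<^sup>T = B" unfolding B_def using Ac pd_matsD(2)[OF A]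
    by (intro eq_matI) (auto, metis carrier_matD index_transpose_mat(1))
  have Bq: "qf B v = v \<bullet> v - (qf A v) / c" if v: "v \<in> carrier_vec n" for v
  proof -
    have "B *\<^sub>v v = v - (1 / c) \<cdot>\<^sub>v (A *\<^sub>v v)"
      unfolding B_def using Ac v
      by (simp add: minus_mult_distrib_mat_vec[of _ n n] smult_mat_mult_vec[of _ n n])
    then show ?thesis using v Ac by (simp add: scalar_prod_minus_distrib[of _ n])
  qed
  have Bpsd: "B \<in> psd_mats n"
    unfolding psd_mats_def sym_mats_def
  proof (safe, goal_cases)
    case (3 v)
    have "qf A v \<le> c * (v \<bullet> v)"
      using quad_form_le_spectral[OF Ac 3] scalar_prod_self_nonneg[of v] by (simp add: c_def distrib_right)
    then show ?case using c by (simp add: Bq[OF 3] field_simps)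
  qed (use B Bs in auto)
  have Ble: "qf B v \<le> \<rho> * (v \<bullet> v)" if v: "v \<in> carrier_vec n" for v
  proof -
    have "v \<bullet> v \<le> \<alpha> * (qf A v)"
      using pd_lower_bound[OF A v] psd_matsD(3)[OF pd_imp_psd[OF A] v] by (simp add: \<alpha>_def distrib_right)
    then have "(v \<bullet> v) / (c * \<alpha>) \<le> (qf A v) / c" using c \<alpha> by (simp add: field_simps)
    moreover have "(1 - 1 / (c * \<alpha>)) * (v \<bullet> v) \<le> \<rho> * (v \<bullet> v)"
      using \<rho>(3) scalar_prod_self_nonneg by (intro mult_right_mono)
    ultimately show ?thesis unfolding Bq[OF v] by (simp add: algebra_simps)
  qed
  have pw: "vec_norm ((B ^\<^sub>m k) *\<^sub>v v) \<le> \<rho> ^ k * vec_norm v" if v: "v \<in> carrier_vec n" for k v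
    using v
  proof (induction k arbitrary: v)
    case (Suc k)
    have "(B ^\<^sub>m Suc k) *\<^sub>v v = (B ^\<^sub>m k) *\<^sub>v (B *\<^sub>v v)"
      using assoc_mult_mat_vec[OF pow_carrier_mat[OF B] B Suc.prems] by simp
    then have "vec_norm ((B ^\<^sub>m Suc k) *\<^sub>v v) \<le> \<rho> ^ k * vec_norm (B *\<^sub>v v)"
      using Suc.IH[of "B *\<^sub>v v"] B Suc.prems by simp
    also have "\<dots> \<le> \<rho> ^ k * (\<rho> * vec_norm v)"
      using psd_vec_norm_mult_le[OF Bpsd \<rho>(1) Ble Suc.prems] \<rho>(1) by (intro mult_left_mono) auto
    finally show ?case by (simp add: mult_ac)
  qed (use B in simp)
  have ent: "\<bar>(B ^\<^sub>m k) $$ (i, j)\<bar> \<le> \<rho> ^ k" if i: "i < n" and j: "j < n" for i j k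
  proof -
    let ?e = "unit_vec n :: nat \<Rightarrow> real vec"
    have P: "B ^\<^sub>m k \<in> carrier_mat n n" by (rule pow_carrier_mat[OF B])
    have 1: "vec_norm (?e i) = 1" if "i < n" for i using that by (simp add: vec_norm_def)
    have "(B ^\<^sub>m k) $$ (i, j) = ?e i \<bullet> ((B ^\<^sub>m k) *\<^sub>v ?e j)"
      by (rule scalar_prod_mult_unit_vec[OF P i j, symmetric])
    also have "\<bar>\<dots>\<bar> \<le> vec_norm (?e i) * vec_norm ((B ^\<^sub>m k) *\<^sub>v ?e j)"
      using P by (intro Cauchy_Schwarz_vec_norm[of _ n]) auto
    also have "\<dots> \<le> \<rho> ^ k" using pw[of "?e j" k] 1 i j by simp
    finally show ?thesis .
  qed
  obtain R where R: "R \<in> psd_mats n" "R * R = 1\<^sub>m n - B"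
    using psd_sqrt_one_minus[OF B \<rho>(1,2) ent Bs] by blast
  have Rc: "R \<in> carrier_mat n n" using psd_matsD(1)[OF R(1)] .
  have "(sqrt c \<cdot>\<^sub>m R) * (sqrt c \<cdot>\<^sub>m R) = c \<cdot>\<^sub>m (R * R)"
    using Rc c by (intro eq_matI) auto
  also have "\<dots> = A" unfolding R(2) B_def using Ac c by (intro eq_matI) auto
  finally show ?thesis using psd_smult[OF R(1), of "sqrt c"] c by (intro bexI) auto
qed

lemma sqrt_mat_pd:
  assumes A: "A \<in> pd_mats n"
  shows "sqrt_mat A \<in> pd_mats n" "sqrt_mat A * sqrt_mat A = A"
proof -
  have d: "dim_row A = n" using pd_matsD(1)[OF A] by simp
  have "\<exists>!R. R \<in> psd_mats n \<and> R * R = A"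
    using psd_sqrt_exists[OF A] psd_sqrt_unique A by (metis (no_types, lifting))
  then have *: "sqrt_mat A \<in> psd_mats n \<and> sqrt_mat A * sqrt_mat A = A"
    unfolding sqrt_mat_def d by (rule theI')
  then show "sqrt_mat A * sqrt_mat A = A" by simp
  note Rc = psd_matsD(1)[of "sqrt_mat A" n]
  have "0 < v \<bullet> (sqrt_mat A *\<^sub>v v)" if v: "v \<in> carrier_vec n" "v \<noteq> 0\<^sub>v n" for v
  proof (rule ccontr)
    assume "\<not> ?thesis"
    then have "v \<bullet> (sqrt_mat A *\<^sub>v v) = 0" using psd_matsD(3)[of _ n v] * v by force
    then have "sqrt_mat A *\<^sub>v v = 0\<^sub>v n" using psd_zero_form_imp_zero * v by blast
    then have "A *\<^sub>v v = 0\<^sub>v n" using assoc_mult_mat_vec[OF Rc Rc v(1)] * Rc by auto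
    then show False using pd_injective[OF A v(1)] v(2) by simp
  qed
  then show "sqrt_mat A \<in> pd_mats n" using * by (auto simp: psd_mats_def pd_mats_def)
qed

section \<open>Vectorization and Kronecker products\<close>

text \<open>Vectors stacked by columns are indexed by k = i + j * d, while the estimates are double
  sums over (i, j).\<close>

lemma sum_div_mod:
  fixes f :: "nat \<Rightarrow> nat \<Rightarrow> 'a::comm_monoid_add"
  shows "(\<Sum>k<b * d. f (k mod d) (k div d)) = (\<Sum>j<b. \<Sum>i<d. f i j)"
proof -
  have "(\<Sum>i = j * d..<j * d + d. f (i mod d) (i div d)) = (\<Sum>i<d. f i j)" for j
    using sum.shift_bounds_nat_ivl[of "\<lambda>i. f (i mod d) (i div d)" 0 "j * d" d]
    by (simp add: atLeast0LessThan add.commute)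
  then show ?thesis by (simp add: sum.nat_group[symmetric])
qed

lemma pos_less: "(a::nat) < m \<Longrightarrow> b < n \<Longrightarrow> a + b * m < m * n"
proof -
  assume a: "a < m" and b: "b < n"
  have "a + b * m < Suc b * m" using a by simp
  also have "\<dots> \<le> n * m" using b by (intro mult_right_mono) auto
  finally show ?thesis by (simp add: mult.commute)
qed

lemma pos_eq_iff: "(a::nat) < m \<Longrightarrow> i < m \<Longrightarrow> a + b * m = i + j * m \<longleftrightarrow> a = i \<and> b = j"
proof
  assume a: "a < m" "i < m" and e: "a + b * m = i + j * m"
  from e have "(a + b * m) mod m = (i + j * m) mod m" "(a + b * m) div m = (i + j * m) div m" by simp_all
  then show "a = i \<and> b = j" using a by simp
qed simp

lemma vectorize_carrier [simp]: "X \<in> carrier_mat a b \<Longrightarrow> vectorize X \<in> carrier_vec (a * b)"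
  by (auto simp: vectorize_def)

lemma vectorize_index [simp]:
  "X \<in> carrier_mat a b \<Longrightarrow> i < a \<Longrightarrow> j < b \<Longrightarrow> vectorize X $ (i + j * a) = X $$ (i, j)"
  using pos_less[of i a j b] by (simp add: vectorize_def)

lemma vec_pos_eqI:
  assumes "v \<in> carrier_vec (a * b)" "w \<in> carrier_vec (a * b)"
    "\<And>i j. i < a \<Longrightarrow> j < b \<Longrightarrow> v $ (i + j * a) = w $ (i + j * a)"
  shows "v = w"
proof (rule eq_vecI)
  fix k assume "k < dim_vec w"
  then have k: "k < a * b" using assms(2) by simp
  then have "0 < a" by (cases a) auto
  then have "k mod a < a" "k div a < b" using k by (auto simp: less_mult_imp_div_less mult.commute)
  from assms(3)[OF this] show "v $ k = w $ k" by simp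
qed (use assms in auto)

lemma frobenius_norm_vectorize: "frobenius_norm X = vec_norm (vectorize X)"
proof -
  have "vectorize X \<bullet> vectorize X = (\<Sum>k<dim_col X * dim_row X. (X $$ (k mod dim_row X, k div dim_row X))\<^sup>2)"
    by (simp add: scalar_prod_self vectorize_def mult.commute)
  also have "\<dots> = (\<Sum>i<dim_row X. \<Sum>j<dim_col X. (X $$ (i, j))\<^sup>2)"
    by (subst sum.swap) (rule sum_div_mod[of "\<lambda>i j. (X $$ (i, j))\<^sup>2"])
  finally show ?thesis by (simp add: frobenius_norm_def vec_norm_def)
qed

lemma vectorize_add:
  "X \<in> carrier_mat a b \<Longrightarrow> Y \<in> carrier_mat a b \<Longrightarrow> vectorize (X + Y) = vectorize X + vectorize Y"
proof (rule vec_pos_eqI[of _ a b])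
  fix i j assume X: "X \<in> carrier_mat a b" "Y \<in> carrier_mat a b" and i: "i < a" and j: "j < b"
  have "i + j * a < a * b" by (rule pos_less[OF i j])
  then show "vectorize (X + Y) $ (i + j * a) = (vectorize X + vectorize Y) $ (i + j * a)"
    using i j X by (simp add: vectorize_def)
qed auto

lemma vectorize_smult: "vectorize (c \<cdot>\<^sub>m X) = c \<cdot>\<^sub>v vectorize X"
proof (rule vec_pos_eqI[of _ "dim_row X" "dim_col X"])
  fix i j assume i: "i < dim_row X" and j: "j < dim_col X"
  have "i + j * dim_row X < dim_row X * dim_col X" by (rule pos_less[OF i j])
  then show "vectorize (c \<cdot>\<^sub>m X) $ (i + j * dim_row X) = (c \<cdot>\<^sub>v vectorize X) $ (i + j * dim_row X)"
    using i j by (simp add: vectorize_def)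
qed (auto simp: vectorize_def)

lemma frobenius_norm_triangle:
  "X \<in> carrier_mat a b \<Longrightarrow> Y \<in> carrier_mat a b \<Longrightarrow> frobenius_norm (X + Y) \<le> frobenius_norm X + frobenius_norm Y"
  unfolding frobenius_norm_vectorize by (simp add: vectorize_add vec_norm_triangle[of _ "a * b"])

lemma frobenius_norm_diff_ge:
  "X \<in> carrier_mat a b \<Longrightarrow> Y \<in> carrier_mat a b \<Longrightarrow> frobenius_norm X - frobenius_norm Y \<le> frobenius_norm (X + Y)"
  unfolding frobenius_norm_vectorize by (simp add: vectorize_add vec_norm_diff_ge[of _ "a * b"])

lemma frobenius_norm_transpose: "frobenius_norm X\<^sup>T = frobenius_norm X"
  unfolding frobenius_norm_def by (subst sum.swap) simp

lemma frobenius_norm_sq_cols: "(frobenius_norm X)\<^sup>2 = (\<Sum>j<dim_col X. col X j \<bullet> col X j)"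
proof -
  have "(frobenius_norm X)\<^sup>2 = (\<Sum>i<dim_row X. \<Sum>j<dim_col X. (X $$ (i, j))\<^sup>2)"
    by (simp add: frobenius_norm_def sum_nonneg)
  also have "\<dots> = (\<Sum>j<dim_col X. \<Sum>i<dim_row X. (X $$ (i, j))\<^sup>2)" by (rule sum.swap)
  finally show ?thesis by (simp add: scalar_prod_self)
qed

text \<open>The squared Frobenius norm is the sum of the squared column norms, and \<open>E\<close>
  acts on each column of \<open>Y\<close> separately.\<close>

lemma frobenius_norm_mult_le:
  assumes E: "E \<in> carrier_mat a b" and Y: "Y \<in> carrier_mat b c" and \<eta>: "0 \<le> \<eta>"
    and le: "\<And>v. v \<in> carrier_vec b \<Longrightarrow> vec_norm (E *\<^sub>v v) \<le> \<eta> * vec_norm v"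
  shows "frobenius_norm (E * Y) \<le> \<eta> * frobenius_norm Y"
proof (rule power2_le_imp_le)
  have "(frobenius_norm (E * Y))\<^sup>2 = (\<Sum>j<c. (vec_norm (E *\<^sub>v col Y j))\<^sup>2)"
    using E Y by (auto intro!: sum.cong simp: frobenius_norm_sq_cols vec_norm_sq col_mult2[OF E Y] simp del: col_mult)
  also have "\<dots> \<le> (\<Sum>j<c. (\<eta> * vec_norm (col Y j))\<^sup>2)"
    using Y by (intro sum_mono power_mono le) auto
  also have "\<dots> = (\<eta> * frobenius_norm Y)\<^sup>2"
    using Y by (simp add: power_mult_distrib frobenius_norm_sq_cols vec_norm_sq sum_distrib_left)
  finally show "(frobenius_norm (E * Y))\<^sup>2 \<le> (\<eta> * frobenius_norm Y)\<^sup>2" .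
qed (use \<eta> in simp)

lemma kron_carrier: "A \<in> carrier_mat a b \<Longrightarrow> B \<in> carrier_mat c d \<Longrightarrow> kron A B \<in> carrier_mat (a * c) (b * d)"
  by (rule carrier_matI) (auto simp: kron_def)

text \<open>Row i + j * c of the Kronecker product pairs row j of \<open>A\<close> with row i of
  \<open>B\<close>. The identity replaces \<open>kron\<close> by two-sided matrix products, the form
  in which all later arguments take place.\<close>

lemma kron_mult_vectorize:
  assumes A: "A \<in> carrier_mat a b" and B: "B \<in> carrier_mat c d" and X: "X \<in> carrier_mat d b"
  shows "kron A B *\<^sub>v vectorize X = vectorize (B * X * A\<^sup>T)"
proof (rule vec_pos_eqI[of _ c a])
  show "kron A B *\<^sub>v vectorize X \<in> carrier_vec (c * a)"
    using kron_carrier[OF A B] vectorize_carrier[OF X] by (simp add: mult.commute)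
  show "vectorize (B * X * A\<^sup>T) \<in> carrier_vec (c * a)" using assms by (intro vectorize_carrier) auto
  fix i j assume i: "i < c" and j: "j < a"
  have p: "i + j * c < a * c" using pos_less[OF i j] by (simp add: mult.commute)
  have "(kron A B *\<^sub>v vectorize X) $ (i + j * c) =
      (\<Sum>k<b * d. A $$ (j, k div d) * B $$ (i, k mod d) * X $$ (k mod d, k div d))"
    using A B X i p by (simp add: kron_def scalar_prod_def vectorize_def atLeast0LessThan mult.commute[of d b])
  also have "\<dots> = (\<Sum>l<b. \<Sum>k<d. A $$ (j, l) * B $$ (i, k) * X $$ (k, l))"
    by (rule sum_div_mod[of "\<lambda>k l. A $$ (j, l) * B $$ (i, k) * X $$ (k, l)"])
  also have "\<dots> = (\<Sum>l<b. (B * X) $$ (i, l) * A $$ (j, l))"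
    using A B X i j
    by (auto intro!: sum.cong simp: scalar_prod_def atLeast0LessThan sum_distrib_right sum_distrib_left mult_ac)
  also have "\<dots> = (B * X * A\<^sup>T) $$ (i, j)"
    using A B X i j by (simp add: scalar_prod_def atLeast0LessThan del: assoc_mult_mat)
  finally show "(kron A B *\<^sub>v vectorize X) $ (i + j * c) = vectorize (B * X * A\<^sup>T) $ (i + j * c)"
    using A B X i j by (subst vectorize_index[of _ c a]) auto
qed

section \<open>Positions of the lower triangle and the orthonormal basis matrix
  \<open>Psi\<close>\<close>

lemma lower_positions_set: "set (lower_positions n) = {(i, j). j \<le> i \<and> i < n}"
  by (force simp: lower_positions_def)

lemma length_lower_positions: "length (lower_positions n) = tri n"
proof -
  have "length (lower_positions n) = (\<Sum>j<n. n - j)"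
    by (simp add: lower_positions_def length_concat comp_def interv_sum_list_conv_sum_set_nat atLeast0LessThan)
  also have "\<dots> = (\<Sum>j<n. Suc (n - Suc j))" by (intro sum.cong) auto
  also have "\<dots> = (\<Sum>j<n. Suc j)" by (rule sum.nat_diff_reindex)
  also have "\<dots> = tri n" by (induction n) auto
  finally show ?thesis .
qed

text \<open>By counting instead of inspecting the nested list: its set has as many elements as the
  list has entries.\<close>

lemma distinct_lower_positions: "distinct (lower_positions n)"
proof (rule card_distinct)
  have "set (lower_positions n) = (SIGMA i:{..<n}. {..i})" by (auto simp: lower_positions_set)
  then have "card (set (lower_positions n)) = (\<Sum>i<n. Suc i)" by simp
  also have "\<dots> = tri n" by (induction n) auto
  finally show "card (set (lower_positions n)) = length (lower_positions n)"
    by (simp add: length_lower_positions)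
qed

lemma lower_positions_nth:
  assumes "k < tri n" "lower_positions n ! k = (i, j)"
  shows "j \<le> i" "i < n"
  using nth_mem[of k "lower_positions n"] assms by (auto simp: length_lower_positions lower_positions_set)

lemma lower_positions_index:
  assumes "j \<le> i" "i < n"
  obtains k where "k < tri n" "lower_positions n ! k = (i, j)"
proof -
  have "(i, j) \<in> set (lower_positions n)" using assms by (simp add: lower_positions_set)
  then show thesis using that unfolding in_set_conv_nth length_lower_positions by blast
qed

lemma lower_positions_inj:
  "k < tri n \<Longrightarrow> l < tri n \<Longrightarrow> lower_positions n ! k = lower_positions n ! l \<Longrightarrow> k = l"
  using nth_eq_iff_index_eq[OF distinct_lower_positions[of n], of k l] by (simp add: length_lower_positions)

lemma Psi_carrier: "Psi n \<in> carrier_mat (n * n) (tri n)"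
  by (simp add: Psi_def)

lemma Psi_transpose_carrier: "(Psi n)\<^sup>T \<in> carrier_mat (tri n) (n * n)"
  unfolding transpose_carrier_mat by (rule Psi_carrier)

lemma Psi_index:
  assumes a: "a < n" "b < n" and k: "k < tri n" and ij: "lower_positions n ! k = (i, j)"
  shows "Psi n $$ (a + b * n, k) =
    (if a = i \<and> b = j \<or> a = j \<and> b = i then (if i = j then 1 else 1 / sqrt 2) else 0)"
  using pos_less[OF a] lower_positions_nth[OF k ij] a k ij
  by (auto simp: Psi_def pos_eq_iff)

text \<open>Row a + b * n of \<open>Psi\<close> has a single nonzero entry, in the column whose
  position is the pair (a, b) sorted into the lower triangle.\<close>

lemma Psi_mult_index:
  assumes h: "h \<in> carrier_vec (tri n)" and a: "a < n" "b < n"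
    and k: "k < tri n" "lower_positions n ! k = (max a b, min a b)"
  shows "(Psi n *\<^sub>v h) $ (a + b * n) = (if a = b then 1 else 1 / sqrt 2) * h $ k"
proof -
  let ?N = "tri n"
  have p: "a + b * n < n * n" using pos_less[OF a] .
  have "(Psi n *\<^sub>v h) $ (a + b * n) = (\<Sum>l<?N. Psi n $$ (a + b * n, l) * h $ l)"
    using p h Psi_carrier[of n] by (simp add: scalar_prod_def atLeast0LessThan)
  also have "\<dots> = (\<Sum>l<?N. if l = k then (if a = b then 1 else 1 / sqrt 2) * h $ k else 0)"
  proof (rule sum.cong[OF refl])
    fix l assume "l \<in> {..<?N}"
    then have l: "l < ?N" by simp
    obtain i j where ij: "lower_positions n ! l = (i, j)" by (cases "lower_positions n ! l")
    have le: "j \<le> i" using lower_positions_nth[OF l ij] by simp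
    show "Psi n $$ (a + b * n, l) * h $ l = (if l = k then (if a = b then 1 else 1 / sqrt 2) * h $ k else 0)"
    proof (cases "l = k")
      case True
      then show ?thesis using Psi_index[OF a l ij] ij k(2) by (auto simp: max_def min_def split: if_splits)
    next
      case False
      then have "(i, j) \<noteq> (max a b, min a b)" using lower_positions_inj[OF l k(1)] ij k(2) by auto
      then have "Psi n $$ (a + b * n, l) = 0"
        using Psi_index[OF a l ij] le by (auto simp: max_def min_def split: if_splits)
      then show ?thesis using False by simp
    qed
  qed
  also have "\<dots> = (if a = b then 1 else 1 / sqrt 2) * h $ k" using k(1) by simp
  finally show ?thesis .
qed

lemma Psi_transpose_index:
  assumes y: "y \<in> carrier_vec (n * n)"
    and k: "k < tri n" and ij: "lower_positions n ! k = (i, j)"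
  shows "((Psi n)\<^sup>T *\<^sub>v y) $ k = (if i = j then y $ (i + i * n) else (y $ (i + j * n) + y $ (j + i * n)) / sqrt 2)"
proof -
  note le = lower_positions_nth[OF k ij]
  have jn: "j < n" using le by simp
  let ?c = "if i = j then 1 else 1 / sqrt 2 :: real"
  have p: "i + j * n < n * n" "j + i * n < n * n" using pos_less le jn by auto
  have "((Psi n)\<^sup>T *\<^sub>v y) $ k = (\<Sum>q<n * n. Psi n $$ (q, k) * y $ q)"
    using k y Psi_carrier[of n] by (simp add: scalar_prod_def atLeast0LessThan)
  also have "\<dots> = (\<Sum>q<n * n. if q \<in> {i + j * n, j + i * n} then ?c * y $ q else 0)"
    by (rule sum.cong) (use k ij in \<open>auto simp: Psi_def\<close>)
  also have "\<dots> = (\<Sum>q\<in>{i + j * n, j + i * n}. ?c * y $ q)"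
    by (subst sum.inter_restrict[symmetric]) (use p in \<open>auto intro!: sum.cong\<close>)
  \<comment> \<open>The two positions coincide exactly on the diagonal, where the factor is 1
    instead of 1 / sqrt 2.\<close>
  also have "\<dots> = (if i = j then y $ (i + i * n) else (y $ (i + j * n) + y $ (j + i * n)) / sqrt 2)"
    using pos_eq_iff[of i n j j i] le jn by (auto simp: field_simps)
  finally show ?thesis .
qed

text \<open>The inverse of \<open>vec_S\<close>: the symmetric matrix whose symmetric vectorization
  is h.\<close>

definition smat :: "nat \<Rightarrow> real vec \<Rightarrow> real mat" where
  "smat n h = mat n n (\<lambda>(a, b). (Psi n *\<^sub>v h) $ (a + b * n))"

lemma smat_carrier [simp]: "smat n h \<in> carrier_mat n n"
  by (simp add: smat_def)

lemma smat_index: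
  assumes "h \<in> carrier_vec (tri n)" "a < n" "b < n"
    "k < tri n" "lower_positions n ! k = (max a b, min a b)"
  shows "smat n h $$ (a, b) = (if a = b then 1 else 1 / sqrt 2) * h $ k"
  using Psi_mult_index[OF assms] assms(2,3) by (simp add: smat_def)

lemma smat_sym:
  assumes "h \<in> carrier_vec (tri n)" "a < n" "b < n"
  shows "smat n h $$ (a, b) = smat n h $$ (b, a)"
proof -
  have "min a b \<le> max a b" "max a b < n" using assms by auto
  then obtain k where k: "k < tri n" "lower_positions n ! k = (max a b, min a b)"
    by (rule lower_positions_index)
  show ?thesis
    using smat_index[OF assms k] smat_index[OF assms(1,3,2), of k] k by (simp add: max.commute min.commute)
qed

lemma vectorize_smat:
  assumes "h \<in> carrier_vec (tri n)" shows "vectorize (smat n h) = Psi n *\<^sub>v h"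
  by (rule vec_pos_eqI[of _ n n]) (auto simp: smat_def pos_less vectorize_def
      intro!: mult_mat_vec_carrier[OF Psi_carrier assms])

text \<open>Off the diagonal two entries h_k / sqrt 2 are added and divided by sqrt 2 once more; on
  the diagonal there is one entry with factor 1.\<close>

lemma Psi_transpose_Psi:
  assumes h: "h \<in> carrier_vec (tri n)"
  shows "(Psi n)\<^sup>T *\<^sub>v (Psi n *\<^sub>v h) = h"
proof (rule eq_vecI)
  fix k assume "k < dim_vec h"
  then have k: "k < tri n" using h by simp
  obtain i j where ij: "lower_positions n ! k = (i, j)" by (cases "lower_positions n ! k")
  note le = lower_positions_nth[OF k ij]
  have c: "Psi n *\<^sub>v h \<in> carrier_vec (n * n)" by (rule mult_mat_vec_carrier[OF Psi_carrier h])
  have mx: "lower_positions n ! k = (max i j, min i j)" "lower_positions n ! k = (max j i, min j i)"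
    using ij le by (auto simp: max_def min_def)
  show "((Psi n)\<^sup>T *\<^sub>v (Psi n *\<^sub>v h)) $ k = h $ k"
    using Psi_transpose_index[OF c k ij] Psi_mult_index[OF h _ _ k mx(1)] Psi_mult_index[OF h _ _ k mx(2)] le
    by (auto simp: add_divide_distrib[symmetric])
qed (use h Psi_carrier[of n] in auto)

text \<open>\<open>Psi\<close> times its transpose averages the entries (a, b) and (b, a); it is the
  projection onto vectorized symmetric matrices.\<close>

lemma Psi_Psi_transpose:
  assumes Y: "Y \<in> carrier_mat n n" "Y\<^sup>T = Y"
  shows "Psi n *\<^sub>v ((Psi n)\<^sup>T *\<^sub>v vectorize Y) = vectorize Y"
proof (rule vec_pos_eqI[of _ n n])
  have P: "(Psi n)\<^sup>T *\<^sub>v vectorize Y \<in> carrier_vec (tri n)"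
    by (rule mult_mat_vec_carrier[OF Psi_transpose_carrier vectorize_carrier[OF Y(1)]])
  then show "Psi n *\<^sub>v ((Psi n)\<^sup>T *\<^sub>v vectorize Y) \<in> carrier_vec (n * n)"
    by (rule mult_mat_vec_carrier[OF Psi_carrier])
  fix a b assume a: "a < n" and b: "b < n"
  have "min a b \<le> max a b" "max a b < n" using a b by auto
  then obtain k where k: "k < tri n" "lower_positions n ! k = (max a b, min a b)"
    by (rule lower_positions_index)
  have s: "Y $$ (b, a) = Y $$ (a, b)" using Y a b by (metis carrier_matD index_transpose_mat(1))
  show "(Psi n *\<^sub>v ((Psi n)\<^sup>T *\<^sub>v vectorize Y)) $ (a + b * n) = vectorize Y $ (a + b * n)"
    using Psi_mult_index[OF P a b k] Psi_transpose_index[OF vectorize_carrier[OF Y(1)] k] Y a b s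
    by (auto simp: max_def min_def split: if_splits)
qed (use Y in auto)

lemma vec_S_norm:
  assumes Y: "Y \<in> carrier_mat n n" "Y\<^sup>T = Y"
  shows "vec_norm (vec_S Y) = frobenius_norm Y"
proof -
  have P: "(Psi n)\<^sup>T *\<^sub>v vectorize Y \<in> carrier_vec (tri n)"
    by (rule mult_mat_vec_carrier[OF Psi_transpose_carrier vectorize_carrier[OF Y(1)]])
  have "vec_S Y \<bullet> vec_S Y = vectorize Y \<bullet> (Psi n *\<^sub>v ((Psi n)\<^sup>T *\<^sub>v vectorize Y))"
    using scalar_prod_mult_adjoint[OF Psi_carrier vectorize_carrier[OF Y(1)] P] Y
    by (simp add: vec_S_def)
  then show ?thesis
    unfolding frobenius_norm_vectorize by (simp add: vec_norm_def Psi_Psi_transpose[OF Y])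
qed

lemma vec_S_carrier: "Y \<in> carrier_mat n n \<Longrightarrow> vec_S Y \<in> carrier_vec (tri n)"
  unfolding vec_S_def
  using mult_mat_vec_carrier[OF Psi_transpose_carrier vectorize_carrier[of Y n n]] by simp

lemma vec_S_add:
  assumes "X \<in> carrier_mat n n" "Y \<in> carrier_mat n n"
  shows "vec_S (X + Y) = vec_S X + vec_S Y"
  using mult_add_distrib_mat_vec[OF Psi_transpose_carrier[of n], of "vectorize X" "vectorize Y"] assms
  by (simp add: vec_S_def vectorize_add)

text \<open>Each row of the transposed \<open>Psi\<close> weighs (i, j) and (j, i) equally, so
  \<open>vec_S\<close> sees only the symmetric part. This is how the one-sided second block of
  \<open>bold_Q\<close> comes to represent symmetric matrices.\<close>

lemma vec_S_transpose:
  assumes Y: "Y \<in> carrier_mat n n"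
  shows "vec_S Y\<^sup>T = vec_S Y"
proof (rule eq_vecI)
  fix k assume "k < dim_vec (vec_S Y)"
  then have k: "k < tri n" using vec_S_carrier[OF Y] by simp
  obtain i j where ij: "lower_positions n ! k = (i, j)" by (cases "lower_positions n ! k")
  have "j < n" "i < n" using lower_positions_nth[OF k ij] by auto
  then show "vec_S Y\<^sup>T $ k = vec_S Y $ k"
    using Psi_transpose_index[OF vectorize_carrier k ij, of Y] Y
      Psi_transpose_index[OF vectorize_carrier k ij, of "Y\<^sup>T"] by (auto simp: vec_S_def)
qed (use vec_S_carrier[of Y n] vec_S_carrier[of "Y\<^sup>T" n] Y in auto)

lemma vec_S_smult: "Y \<in> carrier_mat n n \<Longrightarrow> vec_S (c \<cdot>\<^sub>m Y) = c \<cdot>\<^sub>v vec_S Y"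
  using mult_mat_vec[OF Psi_transpose_carrier[of n], of "vectorize Y" c]
  by (simp add: vec_S_def vectorize_smult)

lemma smat_norm:
  assumes h: "h \<in> carrier_vec (tri n)"
  shows "frobenius_norm (smat n h) = vec_norm h"
proof -
  have c: "Psi n *\<^sub>v h \<in> carrier_vec (n * n)" by (rule mult_mat_vec_carrier[OF Psi_carrier h])
  have "(Psi n *\<^sub>v h) \<bullet> (Psi n *\<^sub>v h) = ((Psi n)\<^sup>T *\<^sub>v (Psi n *\<^sub>v h)) \<bullet> h"
    by (rule scalar_prod_mult_adjoint[OF Psi_carrier c h])
  then show ?thesis
    unfolding frobenius_norm_vectorize vec_norm_def vectorize_smat[OF h] Psi_transpose_Psi[OF h] by simp
qed

section \<open>Ordered eigenvalues\<close>

lemma sum_lessThan_add: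
  fixes f :: "nat \<Rightarrow> 'a::comm_monoid_add"
  shows "(\<Sum>k<a + b. f k) = (\<Sum>k<a. f k) + (\<Sum>k<b. f (a + k))"
  by (induction b) (auto simp: add.assoc)

lemma hcat_carrier: "A \<in> carrier_mat n a \<Longrightarrow> B \<in> carrier_mat n b \<Longrightarrow> hcat A B \<in> carrier_mat n (a + b)"
  by (auto simp: hcat_def)

lemma hcat_index:
  assumes "A \<in> carrier_mat n a" "B \<in> carrier_mat n b" "i < n" "j < a + b"
  shows "hcat A B $$ (i, j) = (if j < a then A $$ (i, j) else B $$ (i, j - a))"
  using assms by (auto simp: hcat_def mat_of_cols_index nth_append)

lemma hcat_mult_vec:
  assumes A: "A \<in> carrier_mat n a" and B: "B \<in> carrier_mat n b"
    and x: "x \<in> carrier_vec a" and y: "y \<in> carrier_vec b"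
  shows "hcat A B *\<^sub>v (x @\<^sub>v y) = A *\<^sub>v x + B *\<^sub>v y"
proof (rule eq_vecI)
  fix i assume "i < dim_vec (A *\<^sub>v x + B *\<^sub>v y)"
  then have i: "i < n" using B by simp
  have "(hcat A B *\<^sub>v (x @\<^sub>v y)) $ i = (\<Sum>k<a + b. hcat A B $$ (i, k) * (x @\<^sub>v y) $ k)"
    using i x y hcat_carrier[OF A B] by (simp add: scalar_prod_def atLeast0LessThan)
  also have "\<dots> = (A *\<^sub>v x + B *\<^sub>v y) $ i"
    unfolding sum_lessThan_add using i x y A B
    by (simp add: scalar_prod_def atLeast0LessThan hcat_index[OF A B])
  finally show "(hcat A B *\<^sub>v (x @\<^sub>v y)) $ i = (A *\<^sub>v x + B *\<^sub>v y) $ i" .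
qed (use A B in \<open>auto simp: hcat_def\<close>)

lemma mat_diag_conj_index:
  assumes A: "A \<in> carrier_mat n k" and B: "B \<in> carrier_mat m k" and i: "i < n" and j: "j < m"
  shows "(A * mat_diag k f * (B::real mat)\<^sup>T) $$ (i, j) = (\<Sum>l<k. f l * A $$ (i, l) * B $$ (j, l))"
  unfolding mat_diag_mult_right[OF A] using A B i j
  by (auto intro!: sum.cong simp: scalar_prod_def atLeast0LessThan)

lemma proots_linear_factors: "proots (\<Prod>e\<leftarrow>es. [:- e, 1:] :: real poly) = mset es"
proof (induction es)
  case (Cons e es)
  have "(\<Prod>e\<leftarrow>es. [:- e, 1:] :: real poly) \<noteq> 0" by (auto simp: prod_list_zero_iff)
  then have "proots ([:- e, 1:] * (\<Prod>e\<leftarrow>es. [:- e, 1:])) = {#e#} + mset es"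
    using Cons by (subst proots_mult) (simp_all del: mult_pCons_left)
  then show ?case by (simp del: mult_pCons_left)
qed simp

text \<open>Justifies the \<open>THE\<close> in \<open>eigs_desc\<close>: sorting any factorization
  gives existence, and a sorted list is determined by the multiset of roots.\<close>

lemma eigs_desc_eq:
  assumes "char_poly W = (\<Prod>e\<leftarrow>es. [:- e, 1:])"
  shows "sorted_wrt (\<ge>) (eigs_desc W)" "length (eigs_desc W) = length es"
proof -
  have ex1: "\<exists>!es. sorted_wrt (\<ge>) es \<and> char_poly W = (\<Prod>e\<leftarrow>es. [:- e, 1:])"
  proof (rule ex1I[of _ "rev (sort es)"])
    have "prod_list (map f (rev (sort es))) = prod_list (map f es)" for f :: "real \<Rightarrow> real poly"
      unfolding prod_mset_prod_list[symmetric] mset_map by simp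
    then show "sorted_wrt (\<ge>) (rev (sort es)) \<and> char_poly W = (\<Prod>e\<leftarrow>rev (sort es). [:- e, 1:])"
      using assms by (simp add: sorted_wrt_rev)
  next
    fix fs assume fs: "sorted_wrt (\<ge>) fs \<and> char_poly W = (\<Prod>e\<leftarrow>fs. [:- e, 1:])"
    then have "mset (rev fs) = mset es"
      using assms proots_linear_factors[of fs] proots_linear_factors[of es] by simp
    moreover have "sorted (rev fs)" using fs by (simp add: sorted_wrt_rev)
    ultimately have "sort es = rev fs" by (simp add: properties_for_sort)
    then show "fs = rev (sort es)" by simp
  qed
  note * = theI'[OF ex1, folded eigs_desc_def]
  show "sorted_wrt (\<ge>) (eigs_desc W)" using * by blast
  have "mset (eigs_desc W) = mset es"
    using * assms proots_linear_factors[of "eigs_desc W"] proots_linear_factors[of es] by simp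
  then show "length (eigs_desc W) = length es" by (rule mset_eq_length)
qed

text \<open>Padded with zero rows, \<open>A\<close> becomes a square matrix whose transpose
  annihilates the last unit vector. So its determinant is 0, and a kernel vector of the padded
  matrix is one of \<open>A\<close>.\<close>

lemma wide_kernel:
  fixes A :: "real mat"
  assumes A: "A \<in> carrier_mat k m" and km: "k < m"
  shows "\<exists>v \<in> carrier_vec m. v \<noteq> 0\<^sub>v m \<and> A *\<^sub>v v = 0\<^sub>v k"
proof -
  define M where "M = mat m m (\<lambda>(i, j). if i < k then A $$ (i, j) else 0)"
  have M: "M \<in> carrier_mat m m" by (simp add: M_def)
  have "M\<^sup>T *\<^sub>v unit_vec m (m - 1) = 0\<^sub>v m"
    using km M by (intro eq_vecI) (auto simp: M_def)
  moreover have "unit_vec m (m - 1) \<noteq> (0\<^sub>v m :: real vec)" using km by simp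
  ultimately have "\<exists>v. v \<in> carrier_vec m \<and> v \<noteq> 0\<^sub>v m \<and> M\<^sup>T *\<^sub>v v = 0\<^sub>v m"
    by (intro exI[of _ "unit_vec m (m - 1)"] conjI unit_vec_carrier)
  then have "det M\<^sup>T = 0" using det_0_iff_vec_prod_zero_field[of "M\<^sup>T" m] M by simp
  then have "det M = 0" using det_transpose[OF M] by simp
  then obtain v where v: "v \<in> carrier_vec m" "v \<noteq> 0\<^sub>v m" "M *\<^sub>v v = 0\<^sub>v m"
    using det_0_iff_vec_prod_zero_field[OF M] by auto
  have "A *\<^sub>v v = 0\<^sub>v k"
  proof (rule eq_vecI)
    fix i assume i: "i < dim_vec (0\<^sub>v k :: real vec)"
    then have "row A i = row M i" using A km by (intro eq_vecI) (auto simp: M_def)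
    then have "(A *\<^sub>v v) $ i = (M *\<^sub>v v) $ i" using i A M km by simp
    then show "(A *\<^sub>v v) $ i = 0\<^sub>v k $ i" using v i km by simp
  qed (use A in auto)
  then show ?thesis using v by blast
qed

text \<open>Eigenvalues are indexed from 0, so \<open>lam k\<close> is eigenvalue number k + 1. The
  columns of \<open>Z\<close> are the eigenvectors.\<close>

locale eigenbasis =
  fixes n :: nat and W Z :: "real mat" and lam :: "nat \<Rightarrow> real"
  assumes Z: "Z \<in> carrier_mat n n" and ZtZ: "Z\<^sup>T * Z = 1\<^sub>m n"
    and W_eq: "W = Z * mat_diag n lam * Z\<^sup>T"
    and lam_mono: "i \<le> j \<Longrightarrow> j < n \<Longrightarrow> lam j \<le> lam i"
begin

lemma ZZt: "Z * Z\<^sup>T = 1\<^sub>m n"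
  using mat_mult_left_right_inverse[OF _ Z ZtZ] Z by simp

lemma Z_inner:
  assumes x: "x \<in> carrier_vec n" and y: "y \<in> carrier_vec n"
  shows "(Z *\<^sub>v x) \<bullet> (Z *\<^sub>v y) = x \<bullet> y"
proof -
  have "(Z *\<^sub>v x) \<bullet> (Z *\<^sub>v y) = (Z\<^sup>T *\<^sub>v (Z *\<^sub>v x)) \<bullet> y"
    using Z x y by (intro scalar_prod_mult_adjoint) auto
  also have "Z\<^sup>T *\<^sub>v (Z *\<^sub>v x) = (Z\<^sup>T * Z) *\<^sub>v x"
    using Z x assoc_mult_mat_vec[of "Z\<^sup>T" n n Z n x] by simp
  finally show ?thesis using x by (simp add: ZtZ)
qed

lemma Z_norm: "x \<in> carrier_vec n \<Longrightarrow> vec_norm (Z *\<^sub>v x) = vec_norm x"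
  by (simp add: vec_norm_def Z_inner)

lemma W_Z:
  assumes x: "x \<in> carrier_vec n"
  shows "W *\<^sub>v (Z *\<^sub>v x) = Z *\<^sub>v vec n (\<lambda>i. lam i * x $ i)"
proof -
  have D: "mat_diag n lam *\<^sub>v x = vec n (\<lambda>i. lam i * x $ i)"
  proof (rule eq_vecI)
    fix i assume "i < dim_vec (vec n (\<lambda>i. lam i * x $ i))"
    then have i: "i < n" by simp
    have "(mat_diag n lam *\<^sub>v x) $ i = (\<Sum>j<n. (if i = j then lam j else 0) * x $ j)"
      using x i by (simp add: mat_diag_def scalar_prod_def atLeast0LessThan)
    also have "\<dots> = (\<Sum>j<n. if i = j then lam j * x $ j else 0)" by (intro sum.cong) auto
    finally show "(mat_diag n lam *\<^sub>v x) $ i = vec n (\<lambda>i. lam i * x $ i) $ i" using i by simp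
  qed (simp add: mat_diag_def)
  have "W *\<^sub>v (Z *\<^sub>v x) = (Z * mat_diag n lam) *\<^sub>v ((Z\<^sup>T * Z) *\<^sub>v x)"
    unfolding W_eq using Z x mat_diag_dim[of n lam] mult_carrier_mat[OF Z mat_diag_dim[of n lam]]
    by (simp add: assoc_mult_mat_vec[of "Z * mat_diag n lam" n n "Z\<^sup>T" n]
        assoc_mult_mat_vec[of "Z\<^sup>T" n n Z n x] del: assoc_mult_mat)
  also have "\<dots> = Z *\<^sub>v (mat_diag n lam *\<^sub>v x)"
    using Z x mat_diag_dim[of n lam] by (simp add: ZtZ assoc_mult_mat_vec[of Z n n "mat_diag n lam" n x])
  finally show ?thesis unfolding D .
qed

lemma W_quad:
  assumes x: "x \<in> carrier_vec n"
  shows "(Z *\<^sub>v x) \<bullet> (W *\<^sub>v (Z *\<^sub>v x)) = (\<Sum>i<n. lam i * (x $ i)\<^sup>2)"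
  unfolding W_Z[OF x] using x
  by (subst Z_inner) (auto intro!: sum.cong simp: scalar_prod_def atLeast0LessThan power2_eq_square)

text \<open>One half of Courant-Fischer, in eigenbasis coordinates; \<open>W_quad_le\<close> is the
  other.\<close>

lemma W_quad_ge:
  assumes x: "x \<in> carrier_vec n" and k: "k < n" and z: "\<And>i. k < i \<Longrightarrow> i < n \<Longrightarrow> x $ i = 0"
  shows "lam k * (x \<bullet> x) \<le> (Z *\<^sub>v x) \<bullet> (W *\<^sub>v (Z *\<^sub>v x))"
proof -
  have "lam k * (x \<bullet> x) = (\<Sum>i<n. lam k * (x $ i)\<^sup>2)" using x by (simp add: scalar_prod_self sum_distrib_left)
  also have "\<dots> \<le> (\<Sum>i<n. lam i * (x $ i)\<^sup>2)"
  proof (rule sum_mono)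
    fix i assume "i \<in> {..<n}"
    then show "lam k * (x $ i)\<^sup>2 \<le> lam i * (x $ i)\<^sup>2"
      using z[of i] lam_mono[of i k] k by (cases "k < i") (auto intro: mult_right_mono)
  qed
  finally show ?thesis by (simp add: W_quad[OF x])
qed

lemma W_quad_le:
  assumes x: "x \<in> carrier_vec n" and k: "k < n" and z: "\<And>i. i < k \<Longrightarrow> x $ i = 0"
  shows "(Z *\<^sub>v x) \<bullet> (W *\<^sub>v (Z *\<^sub>v x)) \<le> lam k * (x \<bullet> x)"
proof -
  have "(\<Sum>i<n. lam i * (x $ i)\<^sup>2) \<le> (\<Sum>i<n. lam k * (x $ i)\<^sup>2)"
  proof (rule sum_mono)
    fix i assume "i \<in> {..<n}"
    then show "lam i * (x $ i)\<^sup>2 \<le> lam k * (x $ i)\<^sup>2"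
      using z[of i] lam_mono[of k i] by (cases "i < k") (auto intro: mult_right_mono)
  qed
  also have "\<dots> = lam k * (x \<bullet> x)" using x by (simp add: scalar_prod_self sum_distrib_left)
  finally show ?thesis by (simp add: W_quad[OF x])
qed

lemma W_unit: "i < n \<Longrightarrow> (Z *\<^sub>v unit_vec n i) \<bullet> (W *\<^sub>v (Z *\<^sub>v unit_vec n i)) = lam i"
  by (simp add: W_quad if_distrib[of "\<lambda>x. x\<^sup>2"] if_distrib[of "\<lambda>x. _ * x"] cong: if_cong)

end

text \<open>\<open>ordered_eig\<close> rests on a \<open>THE\<close> over factorizations of the
  characteristic polynomial, so at first its values carry no order. The partition itself makes
  \<open>W\<close> similar to a diagonal matrix; hence the polynomial splits, and
  \<open>eigs_desc W\<close> is a sorted list of length n.\<close>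

lemma eig_partition_eigenbasis:
  assumes ep: "eig_partition n r W Q Qp" and r: "r \<le> n"
  shows "eigenbasis n W (hcat Q Qp) (\<lambda>i. ordered_eig W (i + 1))"
    "W \<in> carrier_mat n n" "Q \<in> carrier_mat n r" "Qp \<in> carrier_mat n (n - r)"
proof -
  let ?lam = "\<lambda>i. ordered_eig W (i + 1)" and ?Z = "hcat Q Qp"
  show Q: "Q \<in> carrier_mat n r" and Qp: "Qp \<in> carrier_mat n (n - r)"
    using ep by (auto simp: eig_partition_def)
  have W: "W = Q * top_eig_mat W r * Q\<^sup>T + Qp * bottom_eig_mat W r * Qp\<^sup>T"
    and ZtZ: "?Z\<^sup>T * ?Z = 1\<^sub>m n" using ep unfolding eig_partition_def by auto
  \<comment> \<open>A sum has the dimensions of its second summand, whose outer factors are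
    \<open>Qp\<close> and its transpose. They are read off first because
    \<open>bottom_eig_mat\<close> has size \<open>dim_row W - r\<close>.\<close>
  have dW: "dim_row W = n" "dim_col W = n" using Qp by (subst W, simp)+
  then show Wc: "W \<in> carrier_mat n n" by auto
  have Z: "?Z \<in> carrier_mat n n" using hcat_carrier[OF Q Qp] r by simp
  have W_eq: "W = ?Z * mat_diag n ?lam * ?Z\<^sup>T"
  proof (rule eq_matI)
    fix i j assume "i < dim_row (?Z * mat_diag n ?lam * ?Z\<^sup>T)" "j < dim_col (?Z * mat_diag n ?lam * ?Z\<^sup>T)"
    then have i: "i < n" and j: "j < n" using Z by auto
    have "W $$ (i, j) = (Q * top_eig_mat W r * Q\<^sup>T) $$ (i, j) + (Qp * bottom_eig_mat W r * Qp\<^sup>T) $$ (i, j)"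
      using i j Q Qp by (subst W) simp
    also have "\<dots> = (\<Sum>l<r. ?lam l * Q $$ (i, l) * Q $$ (j, l)) +
       (\<Sum>l<n - r. ?lam (r + l) * Qp $$ (i, l) * Qp $$ (j, l))"
      unfolding top_eig_mat_def bottom_eig_mat_def dW
      using mat_diag_conj_index[OF Q Q i j] mat_diag_conj_index[OF Qp Qp i j] by (simp add: add.assoc)
    also have "\<dots> = (\<Sum>l<r + (n - r). ?lam l * ?Z $$ (i, l) * ?Z $$ (j, l))"
      unfolding sum_lessThan_add by (simp add: hcat_index[OF Q Qp] i j)
    also have "\<dots> = (?Z * mat_diag n ?lam * ?Z\<^sup>T) $$ (i, j)"
      using mat_diag_conj_index[OF Z Z i j] r by simp
    finally show "W $$ (i, j) = (?Z * mat_diag n ?lam * ?Z\<^sup>T) $$ (i, j)" .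
  qed (use Z dW in auto)
  have "?Z * ?Z\<^sup>T = 1\<^sub>m n" using mat_mult_left_right_inverse[OF _ Z ZtZ] Z by simp
  then have "similar_mat W (mat_diag n ?lam)"
    using Z ZtZ W_eq Wc by (intro similar_matI[of _ _ ?Z "?Z\<^sup>T" n]) auto
  then have "char_poly W = char_poly (mat_diag n ?lam)" by (rule char_poly_similar)
  also have "\<dots> = (\<Prod>e\<leftarrow>diag_mat (mat_diag n ?lam). [:- e, 1:])"
    by (rule char_poly_upper_triangular[OF mat_diag_dim]) (auto simp: mat_diag_def)
  finally have cp: "char_poly W = (\<Prod>e\<leftarrow>diag_mat (mat_diag n ?lam). [:- e, 1:])" .
  have len: "length (eigs_desc W) = n" using eigs_desc_eq(2)[OF cp] by (simp add: diag_mat_def mat_diag_def)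
  show "eigenbasis n W ?Z ?lam"
  proof
    fix i j :: nat assume "i \<le> j" "j < n"
    then show "?lam j \<le> ?lam i"
      using sorted_wrt_nth_less[OF eigs_desc_eq(1)[OF cp], of i j] len
      by (cases "i = j") (auto simp: ordered_eig_def)
  qed (fact Z ZtZ W_eq)+
qed

section \<open>The scaling point\<close>

lemma sandwich_pd:
  assumes R: "R \<in> pd_mats n" and S: "S \<in> pd_mats n" shows "R * S * R \<in> pd_mats n"
    "v \<in> carrier_vec n \<Longrightarrow> qf (R * S * R) v = (R *\<^sub>v v) \<bullet> (S *\<^sub>v (R *\<^sub>v v))"
proof -
  note Rc = pd_matsD(1)[OF R] and Sc = pd_matsD(1)[OF S]
  show q: "qf (R * S * R) v = (R *\<^sub>v v) \<bullet> (S *\<^sub>v (R *\<^sub>v v))" if v: "v \<in> carrier_vec n" for v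
  proof -
    have "(R * S * R) *\<^sub>v v = R *\<^sub>v (S *\<^sub>v (R *\<^sub>v v))"
      using Rc Sc v assoc_mult_mat_vec[of "R * S" n n R n v] assoc_mult_mat_vec[of R n n S n "R *\<^sub>v v"]
      by (simp del: assoc_mult_mat)
    then show ?thesis
      using scalar_prod_mult_adjoint[OF Rc v, of "S *\<^sub>v (R *\<^sub>v v)"] Rc Sc v pd_matsD(2)[OF R] by simp
  qed
  show "R * S * R \<in> pd_mats n"
    unfolding pd_mats_def sym_mats_def
  proof (safe, goal_cases)
    case 2
    have "(R * S * R)\<^sup>T = R\<^sup>T * (S\<^sup>T * R\<^sup>T)"
      using Rc Sc transpose_mult[of "R * S" n n R n] transpose_mult[OF Rc Sc] by simp
    then show ?case using Rc Sc pd_matsD(2)[OF R] pd_matsD(2)[OF S] by simp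
  next
    case (3 v)
    have "R *\<^sub>v v \<noteq> 0\<^sub>v n" using pd_injective[OF R 3(1)] 3 by auto
    then show ?case unfolding q[OF 3(1)] using pd_matsD(3)[OF S] Rc 3 by auto
  qed (use Rc Sc in auto)
qed

text \<open>Here W = R T^-1 R with R R = X and T T = R S R. Centering puts T T between (1 -
  \<delta>) \<mu> and 2 \<mu>, so T^-1 is pinched around 1 / sqrt \<mu> and W around X / sqrt \<mu>.
  The last claim combines (1 - \<delta>) \<mu> \<le> R S R with S \<le> \<sigma>, which gives R S R
  \<le> \<sigma> X.\<close>

lemma scaling_point_bounds:
  assumes X: "X \<in> pd_mats n" and S: "S \<in> pd_mats n" and \<mu>: "0 < \<mu>" and \<delta>: "0 \<le> \<delta>" "\<delta> < 1"
    and cent: "spectral_norm ((1/\<mu>) \<cdot>\<^sub>m (sqrt_mat X * S * sqrt_mat X) - 1\<^sub>m n) \<le> \<delta>"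
  defines "W \<equiv> scaling_point X S"
  shows "W \<in> pd_mats n"
    and "\<And>v. v \<in> carrier_vec n \<Longrightarrow> (1 - \<delta>) * sqrt \<mu> * (qf W v) \<le> qf X v"
    and "\<And>v. v \<in> carrier_vec n \<Longrightarrow> qf X v \<le> 2 * sqrt \<mu> * (qf W v)"
    and "\<And>v \<sigma>. (\<And>u. u \<in> carrier_vec n \<Longrightarrow> qf S u \<le> \<sigma> * (u \<bullet> u)) \<Longrightarrow>
      v \<in> carrier_vec n \<Longrightarrow> (1 - \<delta>) * \<mu> * (v \<bullet> v) \<le> \<sigma> * (qf X v)"
proof -
  define R where "R = sqrt_mat X"
  define Y where "Y = R * S * R"
  define T where "T = sqrt_mat Y"
  define J where "J = inv_mat T"
  have R: "R \<in> pd_mats n" and RR: "R * R = X" using sqrt_mat_pd[OF X] by (auto simp: R_def)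
  note Rc = pd_matsD(1)[OF R] and Sc = pd_matsD(1)[OF S]
  have Y: "Y \<in> pd_mats n" unfolding Y_def by (rule sandwich_pd(1)[OF R S])
  have T: "T \<in> pd_mats n" and TT: "T * T = Y" using sqrt_mat_pd[OF Y] by (auto simp: T_def)
  note Tc = pd_matsD(1)[OF T] and Yc = pd_matsD(1)[OF Y]
  have J: "J \<in> pd_mats n" unfolding J_def by (rule pd_inv_pd[OF T])
  note Jc = pd_matsD(1)[OF J]
  have TJ: "T *\<^sub>v (J *\<^sub>v v) = v" if "v \<in> carrier_vec n" for v
    unfolding J_def using inv_mat_vec_cancel[OF Tc pd_inv_mat(2-4)[OF T] that] by simp
  have W: "W = R * J * R" unfolding W_def scaling_point_def J_def T_def Y_def R_def ..
  show "W \<in> pd_mats n" unfolding W by (rule sandwich_pd(1)[OF R J])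
  have Wq: "qf W v = (R *\<^sub>v v) \<bullet> (J *\<^sub>v (R *\<^sub>v v))" if "v \<in> carrier_vec n" for v
    unfolding W by (rule sandwich_pd(2)[OF R J that])
  have sq: "qf (M * M) v = (M *\<^sub>v v) \<bullet> (M *\<^sub>v v)" if "v \<in> carrier_vec n" "M \<in> pd_mats n" for v M
    using scalar_prod_mult_adjoint[OF pd_matsD(1)[OF that(2)] that(1), of "M *\<^sub>v v"] that
      pd_matsD(1,2)[OF that(2)] by simp
  have Xq: "qf X v = (R *\<^sub>v v) \<bullet> (R *\<^sub>v v)" if "v \<in> carrier_vec n" for v
    unfolding RR[symmetric] by (rule sq[OF that R])
  have Yb: "\<bar>qf Y v - \<mu> * (v \<bullet> v)\<bar> \<le> \<delta> * \<mu> * (v \<bullet> v)" if v: "v \<in> carrier_vec n" for v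
  proof -
    let ?D = "(1/\<mu>) \<cdot>\<^sub>m Y - 1\<^sub>m n"
    have D: "?D \<in> carrier_mat n n" using Yc by auto
    have "?D *\<^sub>v v = (1/\<mu>) \<cdot>\<^sub>v (Y *\<^sub>v v) - v"
      using Yc v by (simp add: minus_mult_distrib_mat_vec[of _ n n] smult_mat_mult_vec[of _ n n])
    then have "qf ?D v = (qf Y v) / \<mu> - v \<bullet> v"
      using Yc v by (simp add: scalar_prod_minus_distrib[of _ n])
    moreover have "\<bar>qf ?D v\<bar> \<le> \<delta> * (v \<bullet> v)"
      using quad_form_le_spectral[OF D v] cent mult_right_mono[OF _ scalar_prod_self_nonneg[of v], of "spectral_norm ?D" \<delta>]
      unfolding Y_def R_def by linarith
    ultimately have "\<mu> * \<bar>(qf Y v) / \<mu> - v \<bullet> v\<bar> \<le> \<mu> * (\<delta> * (v \<bullet> v))" using \<mu> by simp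
    moreover have "\<mu> * \<bar>(qf Y v) / \<mu> - v \<bullet> v\<bar> = \<bar>\<mu> * ((qf Y v) / \<mu> - v \<bullet> v)\<bar>"
      using \<mu> by (simp add: abs_mult)
    ultimately show ?thesis using \<mu> by (simp add: algebra_simps)
  qed
  have Tq: "(1 - \<delta>) * \<mu> * (v \<bullet> v) \<le> (T *\<^sub>v v) \<bullet> (T *\<^sub>v v)" "(T *\<^sub>v v) \<bullet> (T *\<^sub>v v) \<le> 2 * \<mu> * (v \<bullet> v)"
    if v: "v \<in> carrier_vec n" for v
  proof -
    have e: "(T *\<^sub>v v) \<bullet> (T *\<^sub>v v) = qf Y v" unfolding TT[symmetric] by (rule sq[OF v T, symmetric])
    have "\<delta> * (\<mu> * (v \<bullet> v)) \<le> 1 * (\<mu> * (v \<bullet> v))"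
      using \<delta> \<mu> scalar_prod_self_nonneg[of v] by (intro mult_right_mono) auto
    then show "(1 - \<delta>) * \<mu> * (v \<bullet> v) \<le> (T *\<^sub>v v) \<bullet> (T *\<^sub>v v)" "(T *\<^sub>v v) \<bullet> (T *\<^sub>v v) \<le> 2 * \<mu> * (v \<bullet> v)"
      unfolding e using Yb[OF v] by (auto simp: algebra_simps abs_le_iff)
  qed
  let ?s = "sqrt \<mu>"
  have s: "?s > 0" "?s\<^sup>2 = \<mu>" using \<mu> by auto
  {
    fix v :: "real vec" assume v: "v \<in> carrier_vec n"
    let ?u = "R *\<^sub>v v"
    have u: "?u \<in> carrier_vec n" using Rc v by auto
    let ?w = "J *\<^sub>v ?u"
    have w: "?w \<in> carrier_vec n" using Jc u by auto
    \<comment> \<open>The inequality (1 - \<delta>)^2 \<le> 1 - \<delta> trades the square root of 1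
      - \<delta> for 1 - \<delta> itself, so that only integer powers occur later.\<close>
    have "((1 - \<delta>) * ?s * vec_norm ?w)\<^sup>2 = (1 - \<delta>) * ((1 - \<delta>) * \<mu> * (?w \<bullet> ?w))"
      unfolding power_mult_distrib vec_norm_sq s(2) by (simp add: power2_eq_square)
    also have "\<dots> \<le> 1 * ((1 - \<delta>) * \<mu> * (?w \<bullet> ?w))"
      using \<delta> \<mu> scalar_prod_self_nonneg[of ?w] by (intro mult_right_mono) auto
    also have "\<dots> \<le> (vec_norm ?u)\<^sup>2" using Tq(1)[OF w] by (simp add: TJ u vec_norm_sq)
    finally have wu: "(1 - \<delta>) * ?s * vec_norm ?w \<le> vec_norm ?u" by (rule power2_le_imp_le) simp
    have "(1 - \<delta>) * ?s * (?u \<bullet> ?w) \<le> (1 - \<delta>) * ?s * (vec_norm ?u * vec_norm ?w)"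
      using \<delta> s by (intro mult_left_mono Cauchy_Schwarz_vec_norm'[OF u w]) auto
    also have "\<dots> = vec_norm ?u * ((1 - \<delta>) * ?s * vec_norm ?w)" by (simp only: mult_ac)
    also have "\<dots> \<le> vec_norm ?u * vec_norm ?u" using wu by (intro mult_left_mono) auto
    also have "\<dots> = ?u \<bullet> ?u" using vec_norm_sq[of ?u] by (simp add: power2_eq_square)
    finally show "(1 - \<delta>) * ?s * (qf W v) \<le> qf X v"
      unfolding Wq[OF v] Xq[OF v] .
    \<comment> \<open>Cauchy-Schwarz in the form of T between u and w = T^-1 u. The form of T at w
      is u . w, which is the form of W at v.\<close>
    have "(?u \<bullet> ?u)\<^sup>2 = (?u \<bullet> (T *\<^sub>v ?w))\<^sup>2" by (simp add: TJ u)
    also have "\<dots> \<le> (qf T ?u) * (qf T ?w)"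
      by (rule psd_Cauchy_Schwarz[OF pd_imp_psd[OF T] u w])
    also have "qf T ?w = ?u \<bullet> ?w" using u w by (simp add: TJ comm_scalar_prod[of _ n])
    also have "(qf T ?u) * (?u \<bullet> ?w) \<le> (2 * ?s * (?u \<bullet> ?u)) * (?u \<bullet> ?w)"
    proof (rule mult_right_mono)
      have "(vec_norm (T *\<^sub>v ?u))\<^sup>2 \<le> 2 * \<mu> * (?u \<bullet> ?u)" using Tq(2)[OF u] by (simp add: vec_norm_sq)
      also have "\<dots> \<le> (2 * ?s * vec_norm ?u)\<^sup>2"
        using s scalar_prod_self_nonneg[of ?u] by (simp add: power_mult_distrib vec_norm_sq)
      finally have "vec_norm (T *\<^sub>v ?u) \<le> 2 * ?s * vec_norm ?u" by (rule power2_le_imp_le) (use s in simp)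
      then have "vec_norm ?u * vec_norm (T *\<^sub>v ?u) \<le> vec_norm ?u * (2 * ?s * vec_norm ?u)"
        by (intro mult_left_mono) auto
      moreover have "qf T ?u \<le> vec_norm ?u * vec_norm (T *\<^sub>v ?u)"
        using Tc u by (intro Cauchy_Schwarz_vec_norm'[of _ n]) auto
      ultimately show "qf T ?u \<le> 2 * ?s * (?u \<bullet> ?u)"
        using vec_norm_sq[of ?u] by (simp add: power2_eq_square mult_ac)
      show "0 \<le> ?u \<bullet> ?w" using psd_matsD(3)[OF pd_imp_psd[OF J] u] .
    qed
    finally have *: "(?u \<bullet> ?u) * (?u \<bullet> ?u) \<le> (?u \<bullet> ?u) * (2 * ?s * (?u \<bullet> ?w))"
      by (simp add: power2_eq_square mult_ac)
    have "?u \<bullet> ?u \<le> 2 * ?s * (?u \<bullet> ?w)"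
    proof (cases "?u \<bullet> ?u = 0")
      case True
      then show ?thesis using psd_matsD(3)[OF pd_imp_psd[OF J] u] s by simp
    next
      case False
      then show ?thesis using * scalar_prod_self_nonneg[of ?u] by simp
    qed
    then show "qf X v \<le> 2 * ?s * (qf W v)" unfolding Wq[OF v] Xq[OF v] .
  }
  fix v :: "real vec" and \<sigma> assume S_le: "\<And>u. u \<in> carrier_vec n \<Longrightarrow> qf S u \<le> \<sigma> * (u \<bullet> u)"
    and v: "v \<in> carrier_vec n"
  have "(T *\<^sub>v v) \<bullet> (T *\<^sub>v v) = qf Y v" unfolding TT[symmetric] by (rule sq[OF v T, symmetric])
  also have "\<dots> = (R *\<^sub>v v) \<bullet> (S *\<^sub>v (R *\<^sub>v v))" unfolding Y_def by (rule sandwich_pd(2)[OF R S v])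
  also have "\<dots> \<le> \<sigma> * (qf X v)" unfolding Xq[OF v] using Rc v by (intro S_le) auto
  finally show "(1 - \<delta>) * \<mu> * (v \<bullet> v) \<le> \<sigma> * (qf X v)" using Tq(1)[OF v] by simp
qed

section \<open>The column space of the bold basis matrix\<close>

lemma mat_conj_index:
  assumes A: "A \<in> carrier_mat n a" and F: "F \<in> carrier_mat a b" and B: "B \<in> carrier_mat m b"
    and i: "i < n" and j: "j < m"
  shows "(A * F * (B::real mat)\<^sup>T) $$ (i, j) = (\<Sum>k<a. \<Sum>l<b. A $$ (i, k) * F $$ (k, l) * B $$ (j, l))"
proof -
  have "(A * F * B\<^sup>T) $$ (i, j) = (\<Sum>l<b. (\<Sum>k<a. A $$ (i, k) * F $$ (k, l)) * B $$ (j, l))"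
    using A F B i j by (simp add: scalar_prod_def atLeast0LessThan del: assoc_mult_mat)
  also have "\<dots> = (\<Sum>l<b. \<Sum>k<a. A $$ (i, k) * F $$ (k, l) * B $$ (j, l))"
    by (simp add: sum_distrib_right)
  also have "\<dots> = (\<Sum>k<a. \<Sum>l<b. A $$ (i, k) * F $$ (k, l) * B $$ (j, l))" by (rule sum.swap)
  finally show ?thesis .
qed

lemma kron_S_self:
  assumes A: "A \<in> carrier_mat n r"
  shows "kron_S A A = (Psi n)\<^sup>T * kron A A * Psi r"
proof -
  let ?K = "kron A A" and ?T = "(Psi n)\<^sup>T" and ?P = "Psi r"
  have K: "?K \<in> carrier_mat (n * n) (r * r)" by (rule kron_carrier[OF A A])
  have "?K + ?K = 2 \<cdot>\<^sub>m ?K" by (intro eq_matI) auto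
  moreover have "?T * (2 \<cdot>\<^sub>m ?K) = 2 \<cdot>\<^sub>m (?T * ?K)"
    by (rule mult_smult_distrib[OF Psi_transpose_carrier K])
  moreover have "(2 \<cdot>\<^sub>m (?T * ?K)) * ?P = 2 \<cdot>\<^sub>m (?T * ?K * ?P)"
    by (rule mult_smult_assoc_mat[OF mult_carrier_mat[OF Psi_transpose_carrier K] Psi_carrier])
  moreover have "dim_row A = n" "dim_col A = r" using A by auto
  ultimately have "kron_S A A = (1/2) \<cdot>\<^sub>m (2 \<cdot>\<^sub>m (?T * ?K * ?P))" by (simp only: kron_S_def)
  also have "\<dots> = ?T * ?K * ?P" by (intro eq_matI) auto
  finally show ?thesis .
qed

lemma kron_S_self_carrier:
  "A \<in> carrier_mat n r \<Longrightarrow> kron_S A A \<in> carrier_mat (tri n) (tri r)"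
  unfolding kron_S_self
  by (rule mult_carrier_mat[OF mult_carrier_mat[OF Psi_transpose_carrier kron_carrier] Psi_carrier])

lemma kron_S_self_mult:
  assumes A: "A \<in> carrier_mat n r" and h: "h \<in> carrier_vec (tri r)"
  shows "kron_S A A *\<^sub>v h = vec_S (A * smat r h * A\<^sup>T)"
proof -
  have K: "kron A A \<in> carrier_mat (n * n) (r * r)" by (rule kron_carrier[OF A A])
  have Ph: "Psi r *\<^sub>v h \<in> carrier_vec (r * r)" by (rule mult_mat_vec_carrier[OF Psi_carrier h])
  have "kron_S A A *\<^sub>v h = (Psi n)\<^sup>T *\<^sub>v (kron A A *\<^sub>v (Psi r *\<^sub>v h))"
    unfolding kron_S_self[OF A]
      assoc_mult_mat_vec[OF mult_carrier_mat[OF Psi_transpose_carrier K] Psi_carrier h]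
      assoc_mult_mat_vec[OF Psi_transpose_carrier K Ph] ..
  also have "kron A A *\<^sub>v (Psi r *\<^sub>v h) = vectorize (A * smat r h * A\<^sup>T)"
    unfolding vectorize_smat[OF h, symmetric] by (rule kron_mult_vectorize[OF A A smat_carrier])
  finally show ?thesis using A by (simp add: vec_S_def)
qed

text \<open>The eigenbasis coordinates of the symmetric matrix with vectorization
  \<open>bold_Q Q Qp *\<^sub>v (h1 @\<^sub>v h2)\<close>.\<close>

definition coord_mat :: "nat \<Rightarrow> nat \<Rightarrow> real vec \<Rightarrow> real vec \<Rightarrow> real mat" where
  "coord_mat r m h1 h2 = mat (r + m) (r + m) (\<lambda>(i, j).
     if i < r \<and> j < r then smat r h1 $$ (i, j)
     else if i < r then h2 $ (j - r + i * m) / sqrt 2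
     else if j < r then h2 $ (i - r + j * m) / sqrt 2 else 0)"

lemma coord_mat_carrier: "coord_mat r m h1 h2 \<in> carrier_mat (r + m) (r + m)"
  by (simp add: coord_mat_def)

lemma coord_mat_sym:
  assumes h1: "h1 \<in> carrier_vec (tri r)"
  shows "(coord_mat r m h1 h2)\<^sup>T = coord_mat r m h1 h2"
  by (intro eq_matI) (auto simp: coord_mat_def smat_sym[OF h1])

lemma bold_Q_carrier:
  assumes Q: "Q \<in> carrier_mat n r" and Qp: "Qp \<in> carrier_mat n m"
  shows "bold_Q Q Qp \<in> carrier_mat (tri n) (tri r + r * m)"
proof -
  have "(Psi (dim_row Q))\<^sup>T * kron Q Qp \<in> carrier_mat (tri n) (r * m)"
    using mult_carrier_mat[OF Psi_transpose_carrier[of n] kron_carrier[OF Q Qp]] Q by simp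
  then show ?thesis
    unfolding bold_Q_def by (intro hcat_carrier[OF kron_S_self_carrier[OF Q]]) simp
qed

text \<open>Reading h2 as a column-stacked m by r matrix N turns the second block into sqrt 2 times
  the symmetric vectorization of Qp N Q^T. Only the symmetric part survives, so N and its transpose
  fill the off-diagonal blocks, each divided by sqrt 2.\<close>

lemma bold_Q_mult:
  assumes Q: "Q \<in> carrier_mat n r" and Qp: "Qp \<in> carrier_mat n m" and n: "n = r + m"
    and h1: "h1 \<in> carrier_vec (tri r)" and h2: "h2 \<in> carrier_vec (r * m)"
  shows "bold_Q Q Qp *\<^sub>v (h1 @\<^sub>v h2) = vec_S (hcat Q Qp * coord_mat r m h1 h2 * (hcat Q Qp)\<^sup>T)"
proof -
  define N where "N = mat m r (\<lambda>(b, a). h2 $ (b + a * m))"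
  have N: "N \<in> carrier_mat m r" by (simp add: N_def)
  have vN: "vectorize N = h2"
  proof (rule vec_pos_eqI[of _ m r])
    fix i j assume "i < m" "j < r"
    then show "vectorize N $ (i + j * m) = h2 $ (i + j * m)" using N by (simp add: N_def vectorize_def pos_less)
  qed (use N h2 in \<open>auto simp: mult.commute\<close>)
  define Y where "Y = Qp * N * Q\<^sup>T"
  have Y: "Y \<in> carrier_mat n n" using Q Qp N by (auto simp: Y_def)
  define S where "S = Q * smat r h1 * Q\<^sup>T"
  have S: "S \<in> carrier_mat n n" using Q by (auto simp: S_def)
  have K: "kron Q Qp \<in> carrier_mat (n * n) (r * m)" by (rule kron_carrier[OF Q Qp])
  have dQ: "dim_row Q = n" using Q by simp
  have B: "sqrt 2 \<cdot>\<^sub>m ((Psi n)\<^sup>T * kron Q Qp) \<in> carrier_mat (tri n) (r * m)"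
    using mult_carrier_mat[OF Psi_transpose_carrier[of n] K] by simp
  have "bold_Q Q Qp *\<^sub>v (h1 @\<^sub>v h2) = kron_S Q Q *\<^sub>v h1 + (sqrt 2 \<cdot>\<^sub>m ((Psi n)\<^sup>T * kron Q Qp)) *\<^sub>v h2"
    unfolding bold_Q_def dQ by (rule hcat_mult_vec[OF kron_S_self_carrier[OF Q] B h1 h2])
  also have "kron_S Q Q *\<^sub>v h1 = vec_S S" unfolding S_def by (rule kron_S_self_mult[OF Q h1])
  also have "(sqrt 2 \<cdot>\<^sub>m ((Psi n)\<^sup>T * kron Q Qp)) *\<^sub>v h2 = sqrt 2 \<cdot>\<^sub>v ((Psi n)\<^sup>T *\<^sub>v (kron Q Qp *\<^sub>v h2))"
    using smult_mat_mult_vec[OF mult_carrier_mat[OF Psi_transpose_carrier[of n] K] h2]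
      assoc_mult_mat_vec[OF Psi_transpose_carrier[of n] K h2] by simp
  also have "kron Q Qp *\<^sub>v h2 = vectorize Y"
    unfolding Y_def vN[symmetric] by (rule kron_mult_vectorize[OF Q Qp N])
  also have "sqrt 2 \<cdot>\<^sub>v ((Psi n)\<^sup>T *\<^sub>v vectorize Y) = vec_S ((1 / sqrt 2) \<cdot>\<^sub>m (Y + Y\<^sup>T))"
  proof -
    \<comment> \<open>\<open>Y\<close> and its transpose have the same image, and 2 / sqrt 2 = sqrt
      2.\<close>
    have "vec_S ((1 / sqrt 2) \<cdot>\<^sub>m (Y + Y\<^sup>T)) = (1 / sqrt 2) \<cdot>\<^sub>v (vec_S Y + vec_S Y)"
      using Y by (simp add: vec_S_smult[of _ n] vec_S_add[of _ n] vec_S_transpose[of _ n])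
    also have "\<dots> = sqrt 2 \<cdot>\<^sub>v vec_S Y"
      by (intro eq_vecI) (auto simp: field_simps)
    finally show ?thesis using Y by (simp add: vec_S_def)
  qed
  also have "vec_S S + vec_S ((1 / sqrt 2) \<cdot>\<^sub>m (Y + Y\<^sup>T)) = vec_S (S + (1 / sqrt 2) \<cdot>\<^sub>m (Y + Y\<^sup>T))"
    using S Y by (intro vec_S_add[symmetric]) auto
  also have "S + (1 / sqrt 2) \<cdot>\<^sub>m (Y + Y\<^sup>T) = hcat Q Qp * coord_mat r m h1 h2 * (hcat Q Qp)\<^sup>T"
  proof (rule eq_matI)
    let ?Z = "hcat Q Qp" and ?F = "coord_mat r m h1 h2"
    have Z: "?Z \<in> carrier_mat n (r + m)" by (rule hcat_carrier[OF Q Qp])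
    fix p q assume "p < dim_row (?Z * ?F * ?Z\<^sup>T)" "q < dim_col (?Z * ?F * ?Z\<^sup>T)"
    then have p: "p < n" and q: "q < n" using Z by auto
    have "(?Z * ?F * ?Z\<^sup>T) $$ (p, q) =
       (\<Sum>k<r + m. \<Sum>l<r + m. ?Z $$ (p, k) * ?F $$ (k, l) * ?Z $$ (q, l))"
      by (rule mat_conj_index[OF Z coord_mat_carrier Z p q])
    also have "\<dots> = (\<Sum>k<r. \<Sum>l<r. Q $$ (p, k) * smat r h1 $$ (k, l) * Q $$ (q, l))
      + (\<Sum>k<r. \<Sum>l<m. Q $$ (p, k) * (N $$ (l, k) / sqrt 2) * Qp $$ (q, l))
      + (\<Sum>k<m. \<Sum>l<r. Qp $$ (p, k) * (N $$ (k, l) / sqrt 2) * Q $$ (q, l))"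
      unfolding sum_lessThan_add
      by (simp add: sum.distrib hcat_index[OF Q Qp] p q coord_mat_def N_def)
    also have "(\<Sum>k<r. \<Sum>l<r. Q $$ (p, k) * smat r h1 $$ (k, l) * Q $$ (q, l)) = S $$ (p, q)"
      unfolding S_def by (rule mat_conj_index[OF Q smat_carrier Q p q, symmetric])
    also have "(\<Sum>k<m. \<Sum>l<r. Qp $$ (p, k) * (N $$ (k, l) / sqrt 2) * Q $$ (q, l)) = Y $$ (p, q) / sqrt 2"
      unfolding Y_def mat_conj_index[OF Qp N Q p q] by (simp add: sum_divide_distrib)
    also have "(\<Sum>k<r. \<Sum>l<m. Q $$ (p, k) * (N $$ (l, k) / sqrt 2) * Qp $$ (q, l)) = Y $$ (q, p) / sqrt 2"
      unfolding Y_def mat_conj_index[OF Qp N Q q p] sum_divide_distrib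
      by (subst sum.swap) (intro sum.cong, auto)
    finally show "(S + (1 / sqrt 2) \<cdot>\<^sub>m (Y + Y\<^sup>T)) $$ (p, q) = (?Z * ?F * ?Z\<^sup>T) $$ (p, q)"
      using S Y p q by (simp add: add_divide_distrib)
  qed (use S Y Q in \<open>auto simp: hcat_def\<close>)
  finally show ?thesis .
qed

text \<open>Each entry of h2 occurs twice with factor 1 / sqrt 2, so its square is counted once in
  total; on the top block \<open>smat\<close> is isometric. This is what makes \<open>bold_Q\<close>
  an isometry.\<close>

lemma coord_mat_norm:
  assumes h1: "h1 \<in> carrier_vec (tri r)" and h2: "h2 \<in> carrier_vec (r * m)"
  shows "frobenius_norm (coord_mat r m h1 h2) = vec_norm (h1 @\<^sub>v h2)"
proof -
  let ?F = "coord_mat r m h1 h2"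
  have c: "(\<Sum>k<r. \<Sum>l<m. (h2 $ (l + k * m))\<^sup>2) = (vec_norm h2)\<^sup>2"
  proof -
    have "(\<Sum>k<r. \<Sum>l<m. (h2 $ (l + k * m))\<^sup>2) = (\<Sum>k<r * m. (h2 $ (k mod m + k div m * m))\<^sup>2)"
      by (rule sum_div_mod[symmetric])
    then show ?thesis using h2 by (simp add: vec_norm_sq scalar_prod_self)
  qed
  have "(\<Sum>k<r + m. \<Sum>l<r + m. (?F $$ (k, l))\<^sup>2) = (\<Sum>k<r. \<Sum>l<r. (smat r h1 $$ (k, l))\<^sup>2)
      + (\<Sum>k<r. \<Sum>l<m. (h2 $ (l + k * m))\<^sup>2 / 2)
      + (\<Sum>k<m. \<Sum>l<r. (h2 $ (k + l * m))\<^sup>2 / 2)"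
    unfolding sum_lessThan_add by (simp add: sum.distrib coord_mat_def power_divide)
  also have "(\<Sum>k<m. \<Sum>l<r. (h2 $ (k + l * m))\<^sup>2 / 2) = (\<Sum>l<r. \<Sum>k<m. (h2 $ (k + l * m))\<^sup>2 / 2)"
    by (rule sum.swap)
  also have "(\<Sum>k<r. \<Sum>l<r. (smat r h1 $$ (k, l))\<^sup>2) = (frobenius_norm (smat r h1))\<^sup>2"
    unfolding frobenius_norm_def carrier_matD[OF smat_carrier] by (simp add: sum_nonneg)
  finally have "(\<Sum>k<r + m. \<Sum>l<r + m. (?F $$ (k, l))\<^sup>2) = (vec_norm h1)\<^sup>2 + (vec_norm h2)\<^sup>2"
    by (simp add: sum_divide_distrib[symmetric] c smat_norm[OF h1])
  then show ?thesis
    using coord_mat_carrier[of r m h1 h2] by (simp add: frobenius_norm_def vec_norm_append)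
qed

text \<open>A pair in \<open>lower_positions\<close> has its smaller index second, so k \<le> j
  already puts both indices at k or beyond. The conclusion leaves only the first k rows and columns,
  the shape of a tangent matrix.\<close>

lemma coord_mat_support:
  assumes h1: "h1 \<in> carrier_vec (tri r)" and k: "k \<le> r"
    and z1: "\<And>l i j. l < tri r \<Longrightarrow> lower_positions r ! l = (i, j) \<Longrightarrow> k \<le> j \<Longrightarrow> h1 $ l = 0"
    and z2: "\<And>a b. k \<le> a \<Longrightarrow> a < r \<Longrightarrow> b < m \<Longrightarrow> h2 $ (b + a * m) = 0"
    and ij: "k \<le> i" "i < r + m" "k \<le> j" "j < r + m"
  shows "coord_mat r m h1 h2 $$ (i, j) = 0"
proof (cases "i < r \<and> j < r")
  case True
  have "min i j \<le> max i j" "max i j < r" using True by auto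
  then obtain l where l: "l < tri r" "lower_positions r ! l = (max i j, min i j)"
    by (rule lower_positions_index)
  have "h1 $ l = 0" using z1[OF l] ij by simp
  then have "smat r h1 $$ (i, j) = 0" using smat_index[OF h1 _ _ l] True by simp
  then show ?thesis using ij True by (simp add: coord_mat_def)
next
  case False
  then show ?thesis
    using ij z2[of i "j - r"] z2[of j "i - r"] by (auto simp: coord_mat_def simp del: Nat.add_diff_assoc2)
qed

lemma frobenius_norm_isometry:
  assumes E: "E \<in> carrier_mat a b" and Y: "Y \<in> carrier_mat b c"
    and eq: "\<And>v. v \<in> carrier_vec b \<Longrightarrow> vec_norm (E *\<^sub>v v) = vec_norm v"
  shows "frobenius_norm (E * Y) = frobenius_norm Y"
proof -
  have "(frobenius_norm (E * Y))\<^sup>2 = (\<Sum>j<c. (vec_norm (E *\<^sub>v col Y j))\<^sup>2)"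
    using E Y by (auto intro!: sum.cong simp: frobenius_norm_sq_cols vec_norm_sq col_mult2[OF E Y] simp del: col_mult)
  also have "\<dots> = (\<Sum>j<c. (vec_norm (col Y j))\<^sup>2)"
    using Y by (intro sum.cong) (auto simp: eq)
  also have "\<dots> = (frobenius_norm Y)\<^sup>2"
    using Y by (simp add: frobenius_norm_sq_cols vec_norm_sq)
  finally show ?thesis by simp
qed

section \<open>Congruence with the eigenbasis and the distance to tangent matrices\<close>

context eigenbasis
begin

lemma conj_frobenius_norm:
  assumes F: "F \<in> carrier_mat n n"
  shows "frobenius_norm (Z * F * Z\<^sup>T) = frobenius_norm F"
proof -
  have "frobenius_norm (Z * F * Z\<^sup>T) = frobenius_norm (Z * (F * Z\<^sup>T))" using Z F by simp
  also have "\<dots> = frobenius_norm (F * Z\<^sup>T)"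
    using Z F Z_norm by (intro frobenius_norm_isometry[of _ n n _ n]) auto
  also have "\<dots> = frobenius_norm (F * Z\<^sup>T)\<^sup>T" by (rule frobenius_norm_transpose[symmetric])
  also have "(F * Z\<^sup>T)\<^sup>T = Z * F\<^sup>T" using transpose_mult[of F n n "Z\<^sup>T" n] F Z by simp
  also have "frobenius_norm (Z * F\<^sup>T) = frobenius_norm F\<^sup>T"
    using Z F Z_norm by (intro frobenius_norm_isometry[of _ n n _ n]) auto
  finally show ?thesis by (simp add: frobenius_norm_transpose)
qed

lemma conj_sym:
  assumes F: "F \<in> carrier_mat n n" "F\<^sup>T = F"
  shows "(Z * F * Z\<^sup>T)\<^sup>T = Z * F * Z\<^sup>T"
proof -
  have "(Z * F * Z\<^sup>T)\<^sup>T = Z * (Z * F)\<^sup>T" using transpose_mult[of "Z * F" n n "Z\<^sup>T" n] F Z by simp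
  also have "(Z * F)\<^sup>T = F * Z\<^sup>T" using transpose_mult[of Z n n F n] F Z by simp
  finally show ?thesis using Z F by simp
qed

text \<open>If the range of \<open>U\<close> captures the dominant eigenspace of \<open>W\<close>, the span of the top \<open>k\<close>
  eigenvectors is close to it: for \<open>q = W u\<close> in that span the component \<open>e\<close> orthogonal to \<open>U\<close>
  has \<open>e \<bullet> e = e \<bullet> W u\<close>, and Cauchy--Schwarz in the form of \<open>W\<close> applies.\<close>

lemma top_eigenspace_near_range:
  assumes W: "W \<in> psd_mats n" and U: "U \<in> carrier_mat n k" and k: "0 < k" "k \<le> n"
    and inj: "\<And>y. y \<in> carrier_vec k \<Longrightarrow> U *\<^sub>v y = 0\<^sub>v n \<Longrightarrow> y = 0\<^sub>v k"
    and low: "0 < l" "l \<le> lam (k - 1)"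
    and up: "\<And>e. e \<in> carrier_vec n \<Longrightarrow> U\<^sup>T *\<^sub>v e = 0\<^sub>v k \<Longrightarrow> qf W e \<le> w * (e \<bullet> e)"
    and \<eta>: "0 \<le> \<eta>" "w \<le> l * \<eta>\<^sup>2"
  defines "Q1 \<equiv> Z * mat n k (\<lambda>(i, j). if i = j then 1 else 0)"
  shows "\<exists>C E. C \<in> carrier_mat k k \<and> E \<in> carrier_mat n k \<and> Q1 = U * C + E \<and>
    (\<forall>y \<in> carrier_vec k. vec_norm (E *\<^sub>v y) \<le> \<eta> * vec_norm y)"
proof -
  have Q1: "Q1 \<in> carrier_mat n k" using Z by (simp add: Q1_def)
  define N where "N = U\<^sup>T * U"
  have N: "N \<in> carrier_mat k k" using U by (simp add: N_def)
  have "y = 0\<^sub>v k" if y: "y \<in> carrier_vec k" "N *\<^sub>v y = 0\<^sub>v k" for y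
  proof -
    have "N *\<^sub>v y = U\<^sup>T *\<^sub>v (U *\<^sub>v y)" unfolding N_def using U y by simp
    then have "U\<^sup>T *\<^sub>v (U *\<^sub>v y) = 0\<^sub>v k" using y(2) by simp
    then have "(U *\<^sub>v y) \<bullet> (U *\<^sub>v y) = 0"
      using scalar_prod_mult_adjoint[OF U _ y(1), of "U *\<^sub>v y"] U y
      by (simp add: scalar_prod_left_zero[OF y(1)])
    then have "U *\<^sub>v y = 0\<^sub>v n" using scalar_prod_self_eq_0[of "U *\<^sub>v y" n] U y by simp
    then show ?thesis using inj y by blast
  qed
  note Ni = inv_mat_of_injective[OF N this]
  \<comment> \<open>Least squares: U C is the orthogonal projection of Q1 onto the range of
    \<open>U\<close>, and E below is the residual.\<close>
  define C where "C = inv_mat N * (U\<^sup>T * Q1)"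
  define E where "E = Q1 - U * C"
  have C: "C \<in> carrier_mat k k" using Ni U Q1 by (simp add: C_def)
  have E: "E \<in> carrier_mat n k" using Q1 U C by (simp add: E_def minus_carrier_mat)
  have QE: "Q1 = U * C + E" unfolding E_def using Q1 U C by (intro eq_matI) auto
  have orth: "U\<^sup>T *\<^sub>v (E *\<^sub>v y) = 0\<^sub>v k" if y: "y \<in> carrier_vec k" for y
  proof -
    have "U\<^sup>T * E = U\<^sup>T * Q1 - U\<^sup>T * (U * C)"
      unfolding E_def using U Q1 C by (simp add: mult_minus_distrib_mat[of _ k n])
    also have "U\<^sup>T * (U * C) = N * C" unfolding N_def using U C by simp
    also have "N * C = (N * inv_mat N) * (U\<^sup>T * Q1)"
      unfolding C_def using U Q1 by (intro assoc_mult_mat[symmetric, OF N Ni(2)]) auto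
    also have "N * inv_mat N = 1\<^sub>m k" by (rule Ni(3))
    also have "1\<^sub>m k * (U\<^sup>T * Q1) = U\<^sup>T * Q1" using U Q1 by simp
    also have "U\<^sup>T * Q1 - U\<^sup>T * Q1 = 0\<^sub>m k k" using U Q1 by (intro minus_r_inv_mat) simp
    finally have "(U\<^sup>T * E) *\<^sub>v y = 0\<^sub>m k k *\<^sub>v y" by simp
    also have "\<dots> = 0\<^sub>v k" using y by (intro eq_vecI) auto
    finally have "(U\<^sup>T * E) *\<^sub>v y = 0\<^sub>v k" .
    then show ?thesis using U E y by simp
  qed
  have "vec_norm (E *\<^sub>v y) \<le> \<eta> * vec_norm y" if y: "y \<in> carrier_vec k" for y
  proof -
    let ?e = "E *\<^sub>v y"
    \<comment> \<open>Dividing by the top eigenvalues, all at least l > 0, exhibits Q1 y as the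
      image of Z u under \<open>W\<close>.\<close>
    define u where "u = vec n (\<lambda>i. if i < k then y $ i / lam i else 0)"
    have u: "u \<in> carrier_vec n" by (simp add: u_def)
    have e: "?e \<in> carrier_vec n" using E y by simp
    have lp: "l \<le> lam i" if "i < k" for i using lam_mono[of i "k - 1"] that k low by force
    have J: "mat n k (\<lambda>(i, j). if i = j then 1 else 0) *\<^sub>v y = vec n (\<lambda>i. lam i * u $ i)" (is "?J *\<^sub>v y = _")
    proof (rule eq_vecI)
      fix i assume "i < dim_vec (vec n (\<lambda>i. lam i * u $ i))"
      then have i: "i < n" by simp
      have "(?J *\<^sub>v y) $ i = (\<Sum>j<k. (if i = j then 1 else 0) * y $ j)"
        using i y by (simp add: scalar_prod_def atLeast0LessThan)
      also have "\<dots> = (\<Sum>j<k. if i = j then y $ j else 0)" by (intro sum.cong) auto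
      also have "\<dots> = lam i * u $ i" using lp[of i] low i by (auto simp: u_def)
      finally show "(?J *\<^sub>v y) $ i = vec n (\<lambda>i. lam i * u $ i) $ i" using i by simp
    qed simp
    have Qy: "Q1 *\<^sub>v y = W *\<^sub>v (Z *\<^sub>v u)"
      unfolding W_Z[OF u] J[symmetric] Q1_def
      by (rule assoc_mult_mat_vec[OF Z _ y]) simp
    have "?e \<bullet> (Q1 *\<^sub>v y) = ?e \<bullet> (U *\<^sub>v (C *\<^sub>v y)) + ?e \<bullet> ?e"
    proof -
      have "Q1 *\<^sub>v y = (U * C) *\<^sub>v y + ?e"
        unfolding QE[THEN arg_cong[of _ _ "\<lambda>M. M *\<^sub>v y"]] using U C E y
        by (intro add_mult_distrib_mat_vec[of _ n k]) auto
      then show ?thesis using U C y e by (simp add: scalar_prod_add_distrib[of _ n])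
    qed
    also have "?e \<bullet> (U *\<^sub>v (C *\<^sub>v y)) = 0"
      using scalar_prod_mult_adjoint[OF U e, of "C *\<^sub>v y"] C y orth[OF y] by simp
    finally have ee: "?e \<bullet> ?e = ?e \<bullet> (W *\<^sub>v (Z *\<^sub>v u))" unfolding Qy by simp
    have "(Z *\<^sub>v u) \<bullet> (W *\<^sub>v (Z *\<^sub>v u)) = (\<Sum>i<n. if i < k then (y $ i)\<^sup>2 / lam i else 0)"
      unfolding W_quad[OF u]
    proof (rule sum.cong[OF refl])
      fix i assume "i \<in> {..<n}"
      then show "lam i * (u $ i)\<^sup>2 = (if i < k then (y $ i)\<^sup>2 / lam i else 0)"
        using lp[of i] low by (auto simp: u_def power2_eq_square)
    qed
    also have "\<dots> = (\<Sum>i<k. (y $ i)\<^sup>2 / lam i)"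
      using k by (simp add: sum.If_cases Int_def lessThan_def[symmetric] cong: conj_cong)
        (intro sum.cong, auto)
    also have "\<dots> \<le> (\<Sum>i<k. (y $ i)\<^sup>2 / l)"
      using lp low by (intro sum_mono divide_left_mono) (auto intro: mult_pos_pos less_le_trans)
    also have "\<dots> = (y \<bullet> y) / l" using y by (simp add: scalar_prod_self sum_divide_distrib)
    finally have q: "(Z *\<^sub>v u) \<bullet> (W *\<^sub>v (Z *\<^sub>v u)) \<le> (y \<bullet> y) / l" .
    have "(?e \<bullet> ?e)\<^sup>2 \<le> (qf W ?e) * ((Z *\<^sub>v u) \<bullet> (W *\<^sub>v (Z *\<^sub>v u)))"
      unfolding ee[THEN arg_cong[of _ _ "\<lambda>x. x\<^sup>2"]] using psd_Cauchy_Schwarz[OF W e, of "Z *\<^sub>v u"] Z u by simp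
    also have "\<dots> \<le> (w * (?e \<bullet> ?e)) * ((y \<bullet> y) / l)"
    proof (rule mult_mono[OF up[OF e orth[OF y]] q])
      show "0 \<le> w * (?e \<bullet> ?e)" using up[OF e orth[OF y]] psd_matsD(3)[OF W e] by linarith
      show "0 \<le> (Z *\<^sub>v u) \<bullet> (W *\<^sub>v (Z *\<^sub>v u))" using psd_matsD(3)[OF W] Z u by simp
    qed
    \<comment> \<open>The quotient of the two bounds on \<open>W\<close>, off the range of
      \<open>U\<close> and on the top eigenspace, controls the squared distance; it is at most
      \<eta>^2.\<close>
    also have "\<dots> = (w / l) * ((?e \<bullet> ?e) * (y \<bullet> y))" by simp
    also have "\<dots> \<le> \<eta>\<^sup>2 * ((?e \<bullet> ?e) * (y \<bullet> y))"
      using \<eta> low by (intro mult_right_mono mult_nonneg_nonneg scalar_prod_self_nonneg) (simp add: field_simps)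
    finally have *: "(?e \<bullet> ?e) * (?e \<bullet> ?e) \<le> (?e \<bullet> ?e) * (\<eta>\<^sup>2 * (y \<bullet> y))"
      by (simp add: power2_eq_square mult_ac)
    have "?e \<bullet> ?e \<le> \<eta>\<^sup>2 * (y \<bullet> y)"
    proof (cases "?e \<bullet> ?e = 0")
      case True then show ?thesis by (simp add: scalar_prod_self_nonneg)
    next
      case False
      then have "0 < ?e \<bullet> ?e" using scalar_prod_self_nonneg[of ?e] by linarith
      with * show ?thesis by (simp only: mult_le_cancel_left_pos)
    qed
    then have "(vec_norm ?e)\<^sup>2 \<le> (\<eta> * vec_norm y)\<^sup>2" by (simp add: power_mult_distrib vec_norm_sq)
    then show ?thesis by (rule power2_le_imp_le) (use \<eta> in simp)
  qed
  then show ?thesis using C E QE by blast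
qed

text \<open>A matrix F without lower right block is J Y^T + Y J^T for the embedding J of the first k
  coordinates. Conjugation turns J into the top eigenvectors U C + E, so U C yields a tangent matrix
  with V = Z Y C^T, and E yields an error. The error appears together with its transpose, hence the
  factor 2.\<close>

lemma near_tangent:
  assumes U: "U \<in> carrier_mat n k" and k: "k \<le> n" and F: "F \<in> carrier_mat n n" "F\<^sup>T = F"
    and supp: "\<And>i j. k \<le> i \<Longrightarrow> i < n \<Longrightarrow> k \<le> j \<Longrightarrow> j < n \<Longrightarrow> F $$ (i, j) = 0"
    and C: "C \<in> carrier_mat k k" and E: "E \<in> carrier_mat n k"
    and Q1: "Z * mat n k (\<lambda>(i, j). if i = j then 1 else 0) = U * C + E"
    and Eb: "\<And>y. y \<in> carrier_vec k \<Longrightarrow> vec_norm (E *\<^sub>v y) \<le> \<eta> * vec_norm y" and \<eta>: "0 \<le> \<eta>"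
  shows "\<exists>V E'. V \<in> carrier_mat n k \<and> E' \<in> carrier_mat n n \<and> E'\<^sup>T = E' \<and>
    Z * F * Z\<^sup>T = (U * V\<^sup>T + V * U\<^sup>T) + E' \<and> frobenius_norm E' \<le> 2 * \<eta> * frobenius_norm F"
proof -
  define J where "J = mat n k (\<lambda>(i, j). if i = j then 1 else 0 :: real)"
  \<comment> \<open>The top k by k block is reached by J Y^T and by its transpose, hence the factor
    1 / 2; the entries below it are reached only once.\<close>
  define Y where "Y = mat n k (\<lambda>(i, j). (if i < k then 1 / 2 else 1) * F $$ (i, j))"
  have J: "J \<in> carrier_mat n k" and Y: "Y \<in> carrier_mat n k" by (auto simp: J_def Y_def)
  have Fs: "F $$ (i, j) = F $$ (j, i)" if "i < n" "j < n" for i j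
    using F that by (metis carrier_matD index_transpose_mat(1))
  have JY: "(J * Y\<^sup>T) $$ (i, j) = (if i < k then Y $$ (j, i) else 0)" if i: "i < n" and j: "j < n" for i j
  proof -
    have "(J * Y\<^sup>T) $$ (i, j) = (\<Sum>l<k. (if i = l then 1 else 0) * Y $$ (j, l))"
      using i j J Y by (simp add: scalar_prod_def atLeast0LessThan J_def)
    also have "\<dots> = (\<Sum>l<k. if i = l then Y $$ (j, l) else 0)" by (intro sum.cong) auto
    finally show ?thesis by simp
  qed
  have "F = J * Y\<^sup>T + (J * Y\<^sup>T)\<^sup>T"
  proof (rule eq_matI)
    fix i j assume "i < dim_row (J * Y\<^sup>T + (J * Y\<^sup>T)\<^sup>T)" "j < dim_col (J * Y\<^sup>T + (J * Y\<^sup>T)\<^sup>T)"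
    then have i: "i < n" and j: "j < n" using J Y by auto
    have "(J * Y\<^sup>T + (J * Y\<^sup>T)\<^sup>T) $$ (i, j) = (J * Y\<^sup>T) $$ (i, j) + (J * Y\<^sup>T) $$ (j, i)"
      using i j J Y by simp
    then show "F $$ (i, j) = (J * Y\<^sup>T + (J * Y\<^sup>T)\<^sup>T) $$ (i, j)"
      unfolding JY[OF i j] JY[OF j i] using i j k supp[of i j] Fs[OF i j] by (auto simp: Y_def)
  qed (use F J Y in auto)
  moreover define V0 where "V0 = Z * Y"
  have V0: "V0 \<in> carrier_mat n k" using Z Y by (simp add: V0_def)
  have "Z * (J * Y\<^sup>T + (J * Y\<^sup>T)\<^sup>T) * Z\<^sup>T = (Z * J) * V0\<^sup>T + ((Z * J) * V0\<^sup>T)\<^sup>T"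
  proof -
    have G: "J * Y\<^sup>T \<in> carrier_mat n n" using J Y by simp
    have ZJ: "Z * (J * Y\<^sup>T) * Z\<^sup>T = (Z * J) * V0\<^sup>T"
    proof -
      have "Z * (J * Y\<^sup>T) = Z * J * Y\<^sup>T" using Z J Y by (intro assoc_mult_mat[symmetric]) auto
      also have "\<dots> * Z\<^sup>T = (Z * J) * (Y\<^sup>T * Z\<^sup>T)" using Z J Y by (intro assoc_mult_mat) auto
      finally show ?thesis unfolding V0_def transpose_mult[OF Z Y] .
    qed
    have "Z * (J * Y\<^sup>T + (J * Y\<^sup>T)\<^sup>T) * Z\<^sup>T = Z * (J * Y\<^sup>T) * Z\<^sup>T + Z * (J * Y\<^sup>T)\<^sup>T * Z\<^sup>T"
      using Z G by (simp add: mult_add_distrib_mat[of Z n n] add_mult_distrib_mat[of _ n n] del: assoc_mult_mat)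
    also note ZJ
    also have "Z * (J * Y\<^sup>T)\<^sup>T * Z\<^sup>T = (Z * (J * Y\<^sup>T) * Z\<^sup>T)\<^sup>T"
      using transpose_mult[of "Z * (J * Y\<^sup>T)" n n "Z\<^sup>T" n] transpose_mult[OF Z G] Z G by simp
    also note ZJ
    finally show ?thesis .
  qed
  moreover define B where "B = E * V0\<^sup>T"
  define V where "V = V0 * C\<^sup>T"
  have B: "B \<in> carrier_mat n n" and V: "V \<in> carrier_mat n k" using E V0 C by (auto simp: B_def V_def)
  have "(Z * J) * V0\<^sup>T = U * V\<^sup>T + B"
  proof -
    have "(Z * J) * V0\<^sup>T = (U * C) * V0\<^sup>T + B"
      unfolding J_def Q1 B_def using U C E V0 by (intro add_mult_distrib_mat[of _ n k]) auto
    also have "(U * C) * V0\<^sup>T = U * V\<^sup>T"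
      unfolding V_def using U C V0 transpose_mult[of V0 n k "C\<^sup>T" k] by simp
    finally show ?thesis .
  qed
  ultimately have "Z * F * Z\<^sup>T = (U * V\<^sup>T + B) + (U * V\<^sup>T + B)\<^sup>T" by simp
  also have "\<dots> = (U * V\<^sup>T + V * U\<^sup>T) + (B + B\<^sup>T)"
  proof -
    have "(U * V\<^sup>T + B)\<^sup>T = V * U\<^sup>T + B\<^sup>T"
      using transpose_add[of "U * V\<^sup>T" n n B] transpose_mult[of U n k "V\<^sup>T" n] U V B by simp
    then show ?thesis using U V B by (intro eq_matI) auto
  qed
  finally have eq: "Z * F * Z\<^sup>T = (U * V\<^sup>T + V * U\<^sup>T) + (B + B\<^sup>T)" .
  have "frobenius_norm Y \<le> frobenius_norm F"
  proof -
    have "(\<Sum>i<n. \<Sum>j<k. (Y $$ (i, j))\<^sup>2) \<le> (\<Sum>i<n. \<Sum>j<n. (F $$ (i, j))\<^sup>2)"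
    proof (rule sum_mono)
      fix i assume i: "i \<in> {..<n}"
      have "(\<Sum>j<k. (Y $$ (i, j))\<^sup>2) \<le> (\<Sum>j<k. (F $$ (i, j))\<^sup>2)"
        using i by (intro sum_mono) (auto simp: Y_def power_divide)
      also have "\<dots> \<le> (\<Sum>j<n. (F $$ (i, j))\<^sup>2)" using k by (intro sum_mono2) auto
      finally show "(\<Sum>j<k. (Y $$ (i, j))\<^sup>2) \<le> (\<Sum>j<n. (F $$ (i, j))\<^sup>2)" .
    qed
    then show ?thesis using Y F by (simp add: frobenius_norm_def)
  qed
  moreover have "frobenius_norm V0 = frobenius_norm Y"
    unfolding V0_def using Z_norm by (intro frobenius_norm_isometry[OF Z Y]) auto
  moreover have "frobenius_norm B \<le> \<eta> * frobenius_norm V0"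
    unfolding B_def using frobenius_norm_mult_le[OF E _ \<eta> Eb, of "V0\<^sup>T" n] V0
    by (simp add: frobenius_norm_transpose)
  moreover have "frobenius_norm (B + B\<^sup>T) \<le> frobenius_norm B + frobenius_norm B\<^sup>T"
    using B by (intro frobenius_norm_triangle[of _ n n]) auto
  moreover have "\<eta> * frobenius_norm Y \<le> \<eta> * frobenius_norm F"
    using calculation(1) \<eta> by (rule mult_left_mono)
  ultimately have "frobenius_norm (B + B\<^sup>T) \<le> 2 * \<eta> * frobenius_norm F"
    by (simp add: frobenius_norm_transpose)
  moreover have "(B + B\<^sup>T)\<^sup>T = B + B\<^sup>T" using B by (intro eq_matI) auto
  ultimately show ?thesis using eq V B by (intro exI[of _ V] exI[of _ "B + B\<^sup>T"]) auto
qed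

end

section \<open>Quasidefinite block matrices\<close>

text \<open>Cancels one norm in estimates of the shape |v|^2 \<le> |v| c, the case v = 0
  included.\<close>

lemma le_of_mult_self_le:
  fixes a b c :: real
  assumes "0 \<le> a" "a * a \<le> a * b" "0 \<le> b" shows "a \<le> b"
proof (cases "a = 0")
  case False
  then show ?thesis using assms by (simp add: mult_le_cancel_left)
qed (use assms in simp)

text \<open>The Loewner bounds on \<open>G\<close> in terms of quadratic forms, so that comparisons
  of inverses can be obtained from Cauchy-Schwarz.\<close>

locale gram_comparison =
  fixes m p :: nat and A G :: "real mat" and gmin gmax :: real
  assumes A: "A \<in> carrier_mat m p" and N: "A * A\<^sup>T \<in> pd_mats m"
    and G: "G \<in> sym_mats m" and gmin: "0 < gmin" and gmax: "0 < gmax"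
    and G_ge: "x \<in> carrier_vec m \<Longrightarrow> gmin * (qf (A * A\<^sup>T) x) \<le> qf G x"
    and G_le: "x \<in> carrier_vec m \<Longrightarrow> qf G x \<le> gmax * (qf (A * A\<^sup>T) x)"
begin

text \<open>The condition number of A A^T is \<open>beta * alpha\<close>, so each of the two may
  enter the final bound only to the first power.\<close>

definition "alpha = spectral_norm (inv_mat (A * A\<^sup>T))"
definition "beta = spectral_norm (A * A\<^sup>T)"

lemma alpha_nonneg: "0 \<le> alpha" and beta_nonneg: "0 \<le> beta"
  by (simp_all add: alpha_def beta_def spectral_norm_nonneg)

lemma Nq:
  assumes x: "x \<in> carrier_vec m"
  shows "qf (A * A\<^sup>T) x = (A\<^sup>T *\<^sub>v x) \<bullet> (A\<^sup>T *\<^sub>v x)"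
  using scalar_prod_mult_adjoint[OF A x, of "A\<^sup>T *\<^sub>v x"] A x by simp

lemma G_pd: "G \<in> pd_mats m"
  unfolding pd_mats_def
proof (safe intro!: G)
  fix v :: "real vec" assume v: "v \<in> carrier_vec m" "v \<noteq> 0\<^sub>v m"
  then show "0 < qf G v" using G_ge[OF v(1)] pd_matsD(3)[OF N v] gmin
    by (meson less_le_trans mult_pos_pos)
qed

lemma Gc: "G \<in> carrier_mat m m" using pd_matsD(1)[OF G_pd] .

lemma transpose_norm_le:
  assumes x: "x \<in> carrier_vec m" shows "vec_norm (A\<^sup>T *\<^sub>v x) \<le> sqrt beta * vec_norm x"
proof (rule power2_le_imp_le)
  have "(vec_norm (A\<^sup>T *\<^sub>v x))\<^sup>2 \<le> beta * (x \<bullet> x)"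
    unfolding vec_norm_sq Nq[OF x, symmetric] beta_def
    using quad_form_le_spectral[OF pd_matsD(1)[OF N] x] by linarith
  also have "\<dots> = (sqrt beta * vec_norm x)\<^sup>2" by (simp add: power_mult_distrib beta_nonneg vec_norm_sq)
  finally show "(vec_norm (A\<^sup>T *\<^sub>v x))\<^sup>2 \<le> (sqrt beta * vec_norm x)\<^sup>2" .
qed (simp add: beta_nonneg)

lemma norm_le:
  assumes t: "t \<in> carrier_vec p" shows "vec_norm (A *\<^sub>v t) \<le> sqrt beta * vec_norm t"
proof (rule le_of_mult_self_le)
  let ?a = "A *\<^sub>v t"
  have a: "?a \<in> carrier_vec m" using A t by simp
  have "vec_norm ?a * vec_norm ?a = ?a \<bullet> ?a" using vec_norm_sq[of ?a] by (simp add: power2_eq_square)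
  also have "\<dots> = (A\<^sup>T *\<^sub>v ?a) \<bullet> t" by (rule scalar_prod_mult_adjoint[OF A a t])
  also have "\<dots> \<le> vec_norm (A\<^sup>T *\<^sub>v ?a) * vec_norm t" using A a t by (intro Cauchy_Schwarz_vec_norm'[of _ p]) auto
  also have "\<dots> \<le> (sqrt beta * vec_norm ?a) * vec_norm t" by (intro mult_right_mono transpose_norm_le[OF a]) simp
  finally show "vec_norm ?a * vec_norm ?a \<le> vec_norm ?a * (sqrt beta * vec_norm t)" by (simp only: mult_ac)
qed (simp_all add: beta_nonneg)

lemma G_norm_le:
  assumes x: "x \<in> carrier_vec m" shows "vec_norm (G *\<^sub>v x) \<le> gmax * beta * vec_norm x"
proof (rule psd_vec_norm_mult_le[OF pd_imp_psd[OF G_pd] _ _ x])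
  fix v :: "real vec" assume v: "v \<in> carrier_vec m"
  have "qf G v \<le> gmax * (qf (A * A\<^sup>T) v)" by (rule G_le[OF v])
  also have "\<dots> \<le> gmax * (beta * (v \<bullet> v))"
    using quad_form_le_spectral[OF pd_matsD(1)[OF N] v] gmax by (intro mult_left_mono) (auto simp: beta_def)
  finally show "qf G v \<le> gmax * beta * (v \<bullet> v)" by simp
qed (use gmax beta_nonneg in simp)

lemma lower_G:
  assumes x: "x \<in> carrier_vec m" shows "gmin * (x \<bullet> x) \<le> alpha * (qf G x)"
proof -
  have "gmin * (x \<bullet> x) \<le> gmin * (alpha * (qf (A * A\<^sup>T) x))"
    using pd_lower_bound[OF N x] gmin by (intro mult_left_mono) (auto simp: alpha_def)
  also have "\<dots> = alpha * (gmin * (qf (A * A\<^sup>T) x))" by simp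
  also have "\<dots> \<le> alpha * (qf G x)" by (intro mult_left_mono G_ge[OF x] alpha_nonneg)
  finally show ?thesis .
qed

lemma inv_G: "inv_mat G \<in> carrier_mat m m" "\<And>x. x \<in> carrier_vec m \<Longrightarrow> G *\<^sub>v (inv_mat G *\<^sub>v x) = x"
  "\<And>x. x \<in> carrier_vec m \<Longrightarrow> inv_mat G *\<^sub>v (G *\<^sub>v x) = x"
  using inv_mat_vec_cancel[OF Gc pd_inv_mat(2-4)[OF G_pd]] pd_inv_mat(2)[OF G_pd] by auto

lemma inv_G_norm_le:
  assumes f: "f \<in> carrier_vec m" shows "vec_norm (inv_mat G *\<^sub>v f) \<le> alpha / gmin * vec_norm f"
proof (rule le_of_mult_self_le)
  let ?x = "inv_mat G *\<^sub>v f"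
  have x: "?x \<in> carrier_vec m" using inv_G(1) f by simp
  have "gmin * (vec_norm ?x * vec_norm ?x) = gmin * (?x \<bullet> ?x)"
    using vec_norm_sq[of ?x] by (simp add: power2_eq_square)
  also have "\<dots> \<le> alpha * (?x \<bullet> f)" using lower_G[OF x] inv_G(2)[OF f] by simp
  also have "\<dots> \<le> alpha * (vec_norm ?x * vec_norm f)"
    by (intro mult_left_mono Cauchy_Schwarz_vec_norm'[OF x f] alpha_nonneg)
  finally show "vec_norm ?x * vec_norm ?x \<le> vec_norm ?x * (alpha / gmin * vec_norm f)"
    using gmin by (simp add: field_simps)
qed (use gmin alpha_nonneg in simp_all)

text \<open>Estimating y = A^T x first gives gmin |y|^2 \<le> y . t, and then |x|^2 \<le> alpha
  |y|^2. Composing the norms of G^-1 and \<open>A\<close> would give alpha sqrt beta in place of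
  sqrt alpha; as this bound is squared later, the condition number would enter the final product
  squared.\<close>

lemma inv_G_A_norm_le:
  assumes t: "t \<in> carrier_vec p"
  shows "vec_norm (inv_mat G *\<^sub>v (A *\<^sub>v t)) \<le> sqrt alpha / gmin * vec_norm t"
proof -
  let ?x = "inv_mat G *\<^sub>v (A *\<^sub>v t)"
  have a: "A *\<^sub>v t \<in> carrier_vec m" using A t by simp
  have x: "?x \<in> carrier_vec m" using inv_G(1) a by simp
  let ?y = "vec_norm (A\<^sup>T *\<^sub>v ?x)"
  have y2: "?y * ?y = qf (A * A\<^sup>T) ?x"
    using Nq[OF x] vec_norm_sq[of "A\<^sup>T *\<^sub>v ?x"] by (simp add: power2_eq_square)
  have "gmin * (?y * ?y) \<le> ?x \<bullet> (A *\<^sub>v t)" unfolding y2 using G_ge[OF x] inv_G(2)[OF a] by simp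
  also have "\<dots> = (A\<^sup>T *\<^sub>v ?x) \<bullet> t" by (rule scalar_prod_mult_adjoint[OF A x t])
  also have "\<dots> \<le> ?y * vec_norm t" using A x t by (intro Cauchy_Schwarz_vec_norm'[of _ p]) auto
  finally have "?y * ?y \<le> ?y * (vec_norm t / gmin)" using gmin by (simp add: field_simps)
  then have "?y \<le> vec_norm t / gmin" by (rule le_of_mult_self_le[rotated]) (use gmin in auto)
  then have yt: "?y * ?y \<le> (vec_norm t / gmin) * (vec_norm t / gmin)" by (intro mult_mono) (use gmin in auto)
  have "(vec_norm ?x)\<^sup>2 \<le> alpha * (?y * ?y)"
    unfolding y2 vec_norm_sq using pd_lower_bound[OF N x] by (simp add: alpha_def)
  also have "\<dots> \<le> alpha * ((vec_norm t / gmin) * (vec_norm t / gmin))"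
    by (intro mult_left_mono yt alpha_nonneg)
  also have "\<dots> = (sqrt alpha / gmin * vec_norm t)\<^sup>2"
    by (simp add: power_mult_distrib power_divide alpha_nonneg power2_eq_square)
  finally show ?thesis by (rule power2_le_imp_le) (use gmin alpha_nonneg in simp)
qed

text \<open>Put a = A t, z = R a and w = R z, so that w solves A A^T w = a. The first bound follows
  from |z|^2 = A^T w . t and |A^T w| = |z|. The second is the antitonicity of inversion: with x =
  G^-1 a, Cauchy-Schwarz in the form of \<open>G\<close> gives |z|^4 = (w . G x)^2 \<le> gmax |z|^2
  (a . x).\<close>

lemma whitened_le_inv_G:
  assumes t: "t \<in> carrier_vec p"
  defines "R \<equiv> inv_mat (sqrt_mat (A * A\<^sup>T))"
  shows "R \<in> carrier_mat m m" "vec_norm (R *\<^sub>v (A *\<^sub>v t)) \<le> vec_norm t"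
    "(vec_norm (R *\<^sub>v (A *\<^sub>v t)))\<^sup>2 \<le> gmax * ((A *\<^sub>v t) \<bullet> (inv_mat G *\<^sub>v (A *\<^sub>v t)))"
proof -
  define P where "P = sqrt_mat (A * A\<^sup>T)"
  have P: "P \<in> pd_mats m" "P * P = A * A\<^sup>T" using sqrt_mat_pd[OF N] by (auto simp: P_def)
  note Pc = pd_matsD(1)[OF P(1)]
  show Rc: "R \<in> carrier_mat m m" using pd_inv_mat(2)[OF P(1)] by (simp add: R_def P_def)
  have Rs: "R\<^sup>T = R" using pd_inv_sym[OF P(1)] by (simp add: R_def P_def)
  have cancel: "P *\<^sub>v (R *\<^sub>v v) = v" "R *\<^sub>v (P *\<^sub>v v) = v" if "v \<in> carrier_vec m" for v
    using inv_mat_vec_cancel[OF Pc pd_inv_mat(2-4)[OF P(1)] that] by (auto simp: R_def P_def)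
  have Psym: "u \<bullet> (P *\<^sub>v v) = (P *\<^sub>v u) \<bullet> v" if "u \<in> carrier_vec m" "v \<in> carrier_vec m" for u v
    using scalar_prod_mult_adjoint[OF Pc that] pd_matsD(2)[OF P(1)] by simp
  have Rsym: "u \<bullet> (R *\<^sub>v v) = (R *\<^sub>v u) \<bullet> v" if "u \<in> carrier_vec m" "v \<in> carrier_vec m" for u v
    using scalar_prod_mult_adjoint[OF Rc that] Rs by simp
  let ?a = "A *\<^sub>v t"
  have a: "?a \<in> carrier_vec m" using A t by simp
  let ?z = "R *\<^sub>v ?a"
  have z: "?z \<in> carrier_vec m" using Rc a by simp
  let ?w = "R *\<^sub>v ?z"
  have w: "?w \<in> carrier_vec m" using Rc z by simp
  have wN: "qf (A * A\<^sup>T) ?w = ?z \<bullet> ?z"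
  proof -
    have "(A * A\<^sup>T) *\<^sub>v ?w = P *\<^sub>v (P *\<^sub>v ?w)" unfolding P(2)[symmetric] using Pc w by simp
    then show ?thesis using Psym[OF w, of "P *\<^sub>v ?w"] Pc w z cancel(1)[OF z] by simp
  qed
  have zz: "?z \<bullet> ?z = ?w \<bullet> ?a" using Rsym[OF z a] by simp
  have "vec_norm ?z * vec_norm ?z = ?w \<bullet> ?a" using zz vec_norm_sq[of ?z] by (simp add: power2_eq_square)
  also have "\<dots> = (A\<^sup>T *\<^sub>v ?w) \<bullet> t" by (rule scalar_prod_mult_adjoint[OF A w t])
  also have "\<dots> \<le> vec_norm (A\<^sup>T *\<^sub>v ?w) * vec_norm t" using A w t by (intro Cauchy_Schwarz_vec_norm'[of _ p]) auto
  also have "vec_norm (A\<^sup>T *\<^sub>v ?w) = vec_norm ?z"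
    using wN Nq[OF w] by (simp add: vec_norm_def)
  finally show "vec_norm ?z \<le> vec_norm t" by (rule le_of_mult_self_le[rotated]) auto
  let ?x = "inv_mat G *\<^sub>v ?a"
  have x: "?x \<in> carrier_vec m" using inv_G(1) a by simp
  have xa: "?x \<bullet> ?a = ?a \<bullet> ?x" using x a by (rule comm_scalar_prod)
  have xq: "0 \<le> ?a \<bullet> ?x" using psd_matsD(3)[OF pd_imp_psd[OF G_pd] x] inv_G(2)[OF a] xa by simp
  have "(?z \<bullet> ?z)\<^sup>2 = (?w \<bullet> (G *\<^sub>v ?x))\<^sup>2" unfolding zz inv_G(2)[OF a] ..
  also have "\<dots> \<le> (qf G ?w) * (qf G ?x)"
    by (rule psd_Cauchy_Schwarz[OF pd_imp_psd[OF G_pd] w x])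
  also have "qf G ?x = ?a \<bullet> ?x" unfolding inv_G(2)[OF a] by (rule xa)
  also have "(qf G ?w) * (?a \<bullet> ?x) \<le> (gmax * (?z \<bullet> ?z)) * (?a \<bullet> ?x)"
    using G_le[OF w] xq unfolding wN by (intro mult_right_mono)
  finally have "(?z \<bullet> ?z) * (?z \<bullet> ?z) \<le> (?z \<bullet> ?z) * (gmax * (?a \<bullet> ?x))"
    by (simp add: power2_eq_square mult_ac)
  then have "?z \<bullet> ?z \<le> gmax * (?a \<bullet> ?x)"
    by (rule le_of_mult_self_le[OF scalar_prod_self_nonneg]) (use xq gmax in simp)
  then show "(vec_norm ?z)\<^sup>2 \<le> gmax * (?a \<bullet> ?x)" by (simp add: vec_norm_sq)
qed

text \<open>Eliminating \<open>x = G\<^sup>-\<^sup>1 (f - A B y)\<close> leaves the Schur complement \<open>D + (A B)\<^sup>T G\<^sup>-\<^sup>1 A B\<close> acting on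
  \<open>y\<close>, which is bounded below by \<open>k0\<close>.\<close>

lemma quasidefinite_cond:
  assumes B: "B \<in> carrier_mat p q" and Bn: "\<And>y. y \<in> carrier_vec q \<Longrightarrow> vec_norm (B *\<^sub>v y) = vec_norm y"
    and d: "\<And>i. i < q \<Longrightarrow> 0 \<le> d i \<and> d i \<le> dmax" and dmax: "0 \<le> dmax" and k0: "0 < k0"
    and schur: "\<And>y. y \<in> carrier_vec q \<Longrightarrow> k0 * (y \<bullet> y) \<le>
      (\<Sum>i<q. d i * (y $ i)\<^sup>2) + (A *\<^sub>v (B *\<^sub>v y)) \<bullet> (inv_mat G *\<^sub>v (A *\<^sub>v (B *\<^sub>v y)))"
  defines "M \<equiv> four_block_mat G (A * B) (B\<^sup>T * A\<^sup>T) (- mat_diag q d)"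
  shows "invertible_mat M" "spectral_norm M \<le> gmax * beta + 2 * sqrt beta + dmax"
    "spectral_norm (inv_mat M) \<le> alpha / gmin + (1 + sqrt alpha / gmin)\<^sup>2 / k0"
proof -
  let ?D = "mat_diag q d"
  have AB: "A * B \<in> carrier_mat m q" and BA: "B\<^sup>T * A\<^sup>T \<in> carrier_mat q m" using A B by auto
  have M: "M \<in> carrier_mat (m + q) (m + q)" unfolding M_def using Gc by (intro four_block_carrier_mat) auto
  have Dv: "- ?D *\<^sub>v y = - vec q (\<lambda>i. d i * y $ i)" if y: "y \<in> carrier_vec q" for y
  proof (rule eq_vecI)
    fix i assume "i < dim_vec (- vec q (\<lambda>i. d i * y $ i))"
    then have i: "i < q" by simp
    have "(- ?D *\<^sub>v y) $ i = (\<Sum>j<q. - (if i = j then d j else 0) * y $ j)"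
      using i y by (simp add: scalar_prod_def atLeast0LessThan mat_diag_def sum_negf)
    also have "\<dots> = (\<Sum>j<q. if i = j then - (d j * y $ j) else 0)" by (intro sum.cong) auto
    finally show "(- ?D *\<^sub>v y) $ i = (- vec q (\<lambda>i. d i * y $ i)) $ i" using i by simp
  qed (simp add: mat_diag_def)
  let ?By = "\<lambda>y. A *\<^sub>v (B *\<^sub>v y)"
  let ?dy = "\<lambda>y. vec q (\<lambda>i. d i * y $ i)"
  have Mxy: "M *\<^sub>v (x @\<^sub>v y) = (G *\<^sub>v x + ?By y) @\<^sub>v (B\<^sup>T *\<^sub>v (A\<^sup>T *\<^sub>v x) - ?dy y)"
    if x: "x \<in> carrier_vec m" and y: "y \<in> carrier_vec q" for x y
  proof -
    have "(B\<^sup>T * A\<^sup>T) *\<^sub>v x = B\<^sup>T *\<^sub>v (A\<^sup>T *\<^sub>v x)" "(A * B) *\<^sub>v y = ?By y" using A B x y by simp_all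
    moreover have "B\<^sup>T *\<^sub>v (A\<^sup>T *\<^sub>v x) + - ?dy y = B\<^sup>T *\<^sub>v (A\<^sup>T *\<^sub>v x) - ?dy y"
      using A B x by (intro minus_add_uminus_vec[symmetric, of _ q]) auto
    ultimately show ?thesis
      unfolding M_def using four_block_mat_mult_vec[OF Gc AB BA _ x y, of "- ?D"] Dv[OF y] by simp
  qed
  have split: "\<exists>x \<in> carrier_vec m. \<exists>y \<in> carrier_vec q. v = x @\<^sub>v y" if "v \<in> carrier_vec (m + q)" for v :: "real vec"
    using that by (intro bexI[of _ "vec_first v m"] bexI[of _ "vec_last v q"]) auto
  have By: "?By y \<in> carrier_vec m" if "y \<in> carrier_vec q" for y using A B that by simp
  have dyn: "vec_norm (?dy y) \<le> dmax * vec_norm y" if y: "y \<in> carrier_vec q" for y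
  proof (rule power2_le_imp_le)
    have "(vec_norm (?dy y))\<^sup>2 = (\<Sum>i<q. (d i)\<^sup>2 * (y $ i)\<^sup>2)"
      by (simp add: vec_norm_sq scalar_prod_self power_mult_distrib)
    also have "\<dots> \<le> (\<Sum>i<q. dmax\<^sup>2 * (y $ i)\<^sup>2)"
      using d by (intro sum_mono mult_right_mono power_mono) auto
    also have "\<dots> = (dmax * vec_norm y)\<^sup>2"
      using y by (simp add: power_mult_distrib vec_norm_sq scalar_prod_self sum_distrib_left)
    finally show "(vec_norm (?dy y))\<^sup>2 \<le> (dmax * vec_norm y)\<^sup>2" .
  qed (use dmax in simp)
  have Byn: "vec_norm (?By y) \<le> sqrt beta * vec_norm y" if y: "y \<in> carrier_vec q" for y
    using norm_le[of "B *\<^sub>v y"] B y Bn[OF y] by simp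
  have Btn: "vec_norm (B\<^sup>T *\<^sub>v (A\<^sup>T *\<^sub>v x)) \<le> sqrt beta * vec_norm x" if x: "x \<in> carrier_vec m" for x
  proof (rule le_of_mult_self_le)
    let ?c = "B\<^sup>T *\<^sub>v (A\<^sup>T *\<^sub>v x)"
    have c: "?c \<in> carrier_vec q" and Ax: "A\<^sup>T *\<^sub>v x \<in> carrier_vec p" using A B x by auto
    have "vec_norm ?c * vec_norm ?c = ?c \<bullet> ?c" using vec_norm_sq[of ?c] by (simp add: power2_eq_square)
    also have "\<dots> = (A\<^sup>T *\<^sub>v x) \<bullet> (B *\<^sub>v ?c)" by (rule scalar_prod_mult_adjoint[OF B Ax c, symmetric])
    also have "\<dots> \<le> vec_norm (A\<^sup>T *\<^sub>v x) * vec_norm (B *\<^sub>v ?c)"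
      using Ax B c by (intro Cauchy_Schwarz_vec_norm'[of _ p]) auto
    also have "\<dots> \<le> (sqrt beta * vec_norm x) * vec_norm ?c"
      unfolding Bn[OF c] by (intro mult_right_mono transpose_norm_le[OF x]) simp
    finally show "vec_norm ?c * vec_norm ?c \<le> vec_norm ?c * (sqrt beta * vec_norm x)" by (simp only: mult_ac)
  qed (simp_all add: beta_nonneg)
  show "spectral_norm M \<le> gmax * beta + 2 * sqrt beta + dmax"
  proof (rule spectral_norm_leI[OF M])
    show "0 \<le> gmax * beta + 2 * sqrt beta + dmax" using gmax beta_nonneg dmax by simp
    fix v :: "real vec" assume "v \<in> carrier_vec (m + q)"
    then obtain x y where x: "x \<in> carrier_vec m" and y: "y \<in> carrier_vec q" and v: "v = x @\<^sub>v y"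
      using split by blast
    have "vec_norm (M *\<^sub>v v) \<le> vec_norm (G *\<^sub>v x + ?By y) + vec_norm (B\<^sup>T *\<^sub>v (A\<^sup>T *\<^sub>v x) - ?dy y)"
      unfolding v Mxy[OF x y] by (rule vec_norm_append_le)
    also have "\<dots> \<le> (vec_norm (G *\<^sub>v x) + vec_norm (?By y)) + (vec_norm (B\<^sup>T *\<^sub>v (A\<^sup>T *\<^sub>v x)) + vec_norm (?dy y))"
      using Gc A B x y By[OF y]
      by (intro add_mono vec_norm_triangle[of _ m] vec_norm_diff_le[of _ q]) auto
    also have "\<dots> \<le> (gmax * beta * vec_norm x + sqrt beta * vec_norm y) + (sqrt beta * vec_norm x + dmax * vec_norm y)"
      by (intro add_mono G_norm_le[OF x] Byn[OF y] Btn[OF x] dyn[OF y])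
    also have "\<dots> \<le> (gmax * beta * vec_norm v + sqrt beta * vec_norm v) + (sqrt beta * vec_norm v + dmax * vec_norm v)"
      unfolding v using gmax beta_nonneg dmax vec_norm_le_append[of x y] vec_norm_le_append[of y x]
      by (intro add_mono mult_left_mono) auto
    finally show "vec_norm (M *\<^sub>v v) \<le> (gmax * beta + 2 * sqrt beta + dmax) * vec_norm v"
      by (simp add: algebra_simps)
  qed
  \<comment> \<open>With b = sqrt alpha / gmin and F the norm of M v, the first block equation gives
    |x| \<le> (alpha / gmin) F + b |y|, and the Schur complement gives |y| \<le> (1 + b) F /
    k0.\<close>
  define c where "c = alpha / gmin + (1 + sqrt alpha / gmin)\<^sup>2 / k0"
  have c0: "0 \<le> c" unfolding c_def using alpha_nonneg gmin k0 by simp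
  have low: "vec_norm v \<le> c * vec_norm (M *\<^sub>v v)" if vc: "v \<in> carrier_vec (m + q)" for v
  proof -
    obtain x y where x: "x \<in> carrier_vec m" and y: "y \<in> carrier_vec q" and v: "v = x @\<^sub>v y"
      using split[OF vc] by blast
    define f where "f = G *\<^sub>v x + ?By y"
    define g where "g = B\<^sup>T *\<^sub>v (A\<^sup>T *\<^sub>v x) - ?dy y"
    have f: "f \<in> carrier_vec m" and g: "g \<in> carrier_vec q"
      using Gc A B x y by (auto simp: f_def g_def)
    define F where "F = vec_norm (M *\<^sub>v v)"
    have fF: "vec_norm f \<le> F" and gF: "vec_norm g \<le> F"
      unfolding F_def v Mxy[OF x y] f_def g_def by (rule vec_norm_le_append)+
    have F0: "0 \<le> F" by (simp add: F_def)
    let ?J = "inv_mat G" and ?b = "sqrt alpha / gmin"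
    have b0: "0 \<le> ?b" using alpha_nonneg gmin by simp
    let ?Jy = "?J *\<^sub>v ?By y"
    have Jy: "?Jy \<in> carrier_vec m" and Jf: "?J *\<^sub>v f \<in> carrier_vec m" using inv_G(1) By[OF y] f by auto
    have "?J *\<^sub>v f = x + ?Jy"
      unfolding f_def using inv_G(1) Gc x By[OF y] inv_G(3)[OF x]
      by (simp add: mult_add_distrib_mat_vec[of _ m m])
    then have xe: "x = ?J *\<^sub>v f - ?Jy" using x Jy inv_G(1) by (intro eq_vecI) auto
    have Jyn: "vec_norm ?Jy \<le> ?b * vec_norm y"
      using inv_G_A_norm_le[of "B *\<^sub>v y"] B y Bn[OF y] by simp
    have xn: "vec_norm x \<le> alpha / gmin * vec_norm f + ?b * vec_norm y"
    proof -
      have "vec_norm x \<le> vec_norm (?J *\<^sub>v f) + vec_norm ?Jy"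
        by (subst xe) (rule vec_norm_diff_le[OF Jf Jy])
      then show ?thesis using inv_G_norm_le[OF f] Jyn by linarith
    qed
    have yBx: "y \<bullet> (B\<^sup>T *\<^sub>v (A\<^sup>T *\<^sub>v x)) = ?By y \<bullet> x"
    proof -
      have Ax: "A\<^sup>T *\<^sub>v x \<in> carrier_vec p" and Bv: "B *\<^sub>v y \<in> carrier_vec p" using A B x y by auto
      have "y \<bullet> (B\<^sup>T *\<^sub>v (A\<^sup>T *\<^sub>v x)) = (B *\<^sub>v y) \<bullet> (A\<^sup>T *\<^sub>v x)"
        using scalar_prod_mult_adjoint[of "B\<^sup>T" q p y "A\<^sup>T *\<^sub>v x"] B y Ax by simp
      also have "\<dots> = ?By y \<bullet> x"
        using scalar_prod_mult_adjoint[of "A\<^sup>T" p m "B *\<^sub>v y" x] A Bv x by simp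
      finally show ?thesis .
    qed
    \<comment> \<open>The second block equation is tested with y. Once x is eliminated, the form of
      the Schur complement at y appears with a minus sign.\<close>
    have "y \<bullet> g = ?By y \<bullet> x - (\<Sum>i<q. d i * (y $ i)\<^sup>2)"
    proof -
      have "y \<bullet> g = y \<bullet> (B\<^sup>T *\<^sub>v (A\<^sup>T *\<^sub>v x)) - y \<bullet> ?dy y"
        unfolding g_def using A B x y by (intro scalar_prod_minus_distrib[of _ q]) auto
      also have "y \<bullet> ?dy y = (\<Sum>i<q. d i * (y $ i)\<^sup>2)"
        by (auto intro!: sum.cong simp: scalar_prod_def atLeast0LessThan power2_eq_square)
      finally show ?thesis unfolding yBx .
    qed
    also have "?By y \<bullet> x = ?By y \<bullet> (?J *\<^sub>v f) - ?By y \<bullet> ?Jy"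
      by (subst xe) (rule scalar_prod_minus_distrib[OF By[OF y] Jf Jy])
    finally have "k0 * (y \<bullet> y) \<le> ?By y \<bullet> (?J *\<^sub>v f) - y \<bullet> g" using schur[OF y] by simp
    also have "?By y \<bullet> (?J *\<^sub>v f) = ?Jy \<bullet> f"
      using scalar_prod_mult_adjoint[OF inv_G(1) By[OF y] f] pd_inv_sym[OF G_pd] by simp
    also have "?Jy \<bullet> f - y \<bullet> g \<le> vec_norm ?Jy * vec_norm f + vec_norm y * vec_norm g"
      using Cauchy_Schwarz_vec_norm[OF Jy f] Cauchy_Schwarz_vec_norm[OF y g] by linarith
    also have "\<dots> \<le> (?b * vec_norm y) * F + vec_norm y * F"
      using Jyn fF gF F0 by (intro add_mono mult_mono mult_nonneg_nonneg b0) auto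
    finally have "vec_norm y * vec_norm y \<le> vec_norm y * ((1 + ?b) * F / k0)"
      using k0 vec_norm_sq[of y] by (simp add: field_simps power2_eq_square)
    then have yn: "vec_norm y \<le> (1 + ?b) * F / k0"
      by (rule le_of_mult_self_le[rotated]) (use b0 F0 k0 in auto)
    have "vec_norm v \<le> vec_norm x + vec_norm y" unfolding v by (rule vec_norm_append_le)
    also have "\<dots> \<le> alpha / gmin * vec_norm f + (1 + ?b) * vec_norm y" using xn by (simp add: algebra_simps)
    also have "\<dots> \<le> alpha / gmin * F + (1 + ?b) * ((1 + ?b) * F / k0)"
      using fF yn b0 alpha_nonneg gmin by (intro add_mono mult_left_mono) auto
    also have "\<dots> = c * F"
      unfolding c_def power2_eq_square
      by (simp only: distrib_right times_divide_eq_left times_divide_eq_right mult.assoc)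
    finally show ?thesis unfolding F_def .
  qed
  \<comment> \<open>The a priori bound excludes a kernel, which gives \<open>inv_mat\<close> of M
    its meaning.\<close>
  have "v = 0\<^sub>v (m + q)" if "v \<in> carrier_vec (m + q)" "M *\<^sub>v v = 0\<^sub>v (m + q)" for v
  proof -
    have "vec_norm v \<le> c * 0" using low[OF that(1)] that(2) vec_norm_eq_0[of "0\<^sub>v (m + q)" "m + q"] by simp
    then show ?thesis using vec_norm_eq_0[OF that(1)] vec_norm_nonneg[of v] by simp
  qed
  note Mi = inv_mat_of_injective[OF M this]
  show "invertible_mat M" by (rule Mi(1))
  have "spectral_norm (inv_mat M) \<le> c"
  proof (rule spectral_norm_leI[OF Mi(2) c0])
    fix v :: "real vec" assume v: "v \<in> carrier_vec (m + q)"
    have "vec_norm (inv_mat M *\<^sub>v v) \<le> c * vec_norm (M *\<^sub>v (inv_mat M *\<^sub>v v))"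
      using Mi(2) v by (intro low) simp
    then show "vec_norm (inv_mat M *\<^sub>v v) \<le> c * vec_norm v"
      by (simp only: inv_mat_vec_cancel(1)[OF M Mi(2-4) v])
  qed
  then show "spectral_norm (inv_mat M) \<le> alpha / gmin + (1 + sqrt alpha / gmin)\<^sup>2 / k0" by (simp add: c_def)
qed

end

section \<open>The weighting matrix is diagonal\<close>

lemma inv_mat_diag:
  assumes "\<And>i. i < n \<Longrightarrow> f i \<noteq> 0"
  shows "inv_mat (mat_diag n f) = mat_diag n (\<lambda>i. 1 / f i)"
proof (rule inv_mat_eqI[of _ n])
  have "mat_diag n (\<lambda>i. 1 / f i) * mat_diag n f = mat_diag n (\<lambda>i. 1 / f i * f i)" by simp
  also have "\<dots> = 1\<^sub>m n" using assms by (intro eq_matI) (auto simp: mat_diag_def)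
  finally show "mat_diag n (\<lambda>i. 1 / f i) * mat_diag n f = 1\<^sub>m n" .
qed auto

lemma Psi_orthonormal: "(Psi n)\<^sup>T * Psi n = 1\<^sub>m (tri n)"
proof (rule mat_col_eqI)
  let ?N = "tri n"
  fix k assume "k < dim_col (1\<^sub>m ?N :: real mat)"
  then have k: "k < ?N" by simp
  have u: "unit_vec ?N k \<in> carrier_vec ?N" by simp
  have "col (Psi n) k = Psi n *\<^sub>v unit_vec ?N k"
    using k Psi_carrier[of n] by (intro eq_vecI) auto
  then have "col ((Psi n)\<^sup>T * Psi n) k = (Psi n)\<^sup>T *\<^sub>v (Psi n *\<^sub>v unit_vec ?N k)"
    using col_mult2[OF Psi_transpose_carrier Psi_carrier k] by simp
  then show "col ((Psi n)\<^sup>T * Psi n) k = col (1\<^sub>m ?N) k" using Psi_transpose_Psi[OF u] k by simp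
qed (use Psi_carrier[of n] in auto)

lemma kron_diag: "kron (mat_diag a f) (mat_diag b g) = mat_diag (a * b) (\<lambda>p. f (p div b) * g (p mod b))"
proof (rule eq_matI)
  fix i j assume "i < dim_row (mat_diag (a * b) (\<lambda>p. f (p div b) * g (p mod b)))"
    "j < dim_col (mat_diag (a * b) (\<lambda>p. f (p div b) * g (p mod b)))"
  then have ij: "i < a * b" "j < a * b" by (auto simp: mat_diag_def)
  then have b: "0 < b" by (cases b) auto
  have d: "i div b < a" "j div b < a" "i mod b < b" "j mod b < b"
    using ij b by (auto simp: less_mult_imp_div_less)
  have "i = j \<longleftrightarrow> i div b = j div b \<and> i mod b = j mod b" by (metis div_mult_mod_eq)
  then show "kron (mat_diag a f) (mat_diag b g) $$ (i, j) = mat_diag (a * b) (\<lambda>p. f (p div b) * g (p mod b)) $$ (i, j)"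
    using ij d by (auto simp: kron_def mat_diag_def)
qed (auto simp: kron_def mat_diag_def)

text \<open>The Kronecker square has the same diagonal entry l_i l_j at the two positions i + j * r
  and j + i * r. It therefore acts on each column of \<open>Psi\<close> as a scalar, and
  orthonormality removes \<open>Psi\<close>.\<close>

lemma kron_S_diag:
  "kron_S (mat_diag r l) (mat_diag r l) =
    mat_diag (tri r) (\<lambda>k. l (fst (lower_positions r ! k)) * l (snd (lower_positions r ! k)))"
    (is "_ = mat_diag ?N ?d")
proof -
  let ?K = "kron (mat_diag r l) (mat_diag r l)"
  have KP: "?K * Psi r = Psi r * mat_diag ?N ?d"
    unfolding kron_diag mat_diag_mult_left[OF Psi_carrier] mat_diag_mult_right[OF Psi_carrier]
  proof (rule eq_matI)
    fix p k assume "p < dim_row (mat (r * r) ?N (\<lambda>(i, j). Psi r $$ (i, j) * ?d j))"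
      "k < dim_col (mat (r * r) ?N (\<lambda>(i, j). Psi r $$ (i, j) * ?d j))"
    then have p: "p < r * r" and k: "k < ?N" by auto
    obtain i j where ij: "lower_positions r ! k = (i, j)" by (cases "lower_positions r ! k")
    note le = lower_positions_nth[OF k ij]
    have "l (p div r) * l (p mod r) * Psi r $$ (p, k) = Psi r $$ (p, k) * (l i * l j)"
      using p k ij le by (auto simp: Psi_def)
    then show "mat (r * r) ?N (\<lambda>(i, j). l (i div r) * l (i mod r) * Psi r $$ (i, j)) $$ (p, k) =
        mat (r * r) ?N (\<lambda>(i, j). Psi r $$ (i, j) * ?d j) $$ (p, k)" using p k ij by simp
  qed auto
  have Kc: "?K \<in> carrier_mat (r * r) (r * r)" by (rule kron_carrier) simp_all
  have "kron_S (mat_diag r l) (mat_diag r l) = (Psi r)\<^sup>T * (?K * Psi r)"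
    unfolding kron_S_self[OF mat_diag_dim] by (rule assoc_mult_mat[OF Psi_transpose_carrier Kc Psi_carrier])
  also have "\<dots> = (Psi r)\<^sup>T * Psi r * mat_diag ?N ?d"
    unfolding KP by (rule assoc_mult_mat[OF Psi_transpose_carrier Psi_carrier mat_diag_dim, symmetric])
  also have "\<dots> = mat_diag ?N ?d" unfolding Psi_orthonormal by (rule left_mult_one_mat[OF mat_diag_dim])
  finally show ?thesis .
qed

text \<open>The diagonal of the block matrix inverted in \<open>bold_Sigma\<close>. Beyond the first
  tri r entries the offset is b + a * m, with a a top index and b a bottom index counted from
  r.\<close>

definition sigma_denominator :: "nat \<Rightarrow> nat \<Rightarrow> real \<Rightarrow> (nat \<Rightarrow> real) \<Rightarrow> nat \<Rightarrow> real" where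
  "sigma_denominator r m \<tau> l k =
    (let N = tri r in
     if k < N then l (fst (lower_positions r ! k)) * l (snd (lower_positions r ! k)) - \<tau>\<^sup>2
     else (l ((k - N) div m) - \<tau>) * l (r + (k - N) mod m))"

lemma bold_Sigma_eq:
  assumes "\<And>k. k < tri r + r * m \<Longrightarrow> sigma_denominator r m \<tau> l k \<noteq> 0"
  shows "bold_Sigma \<tau> (mat_diag r l) (mat_diag m (\<lambda>i. l (r + i))) =
    mat_diag (tri r + r * m) (\<lambda>k. 1 / sigma_denominator r m \<tau> l k)"
proof -
  let ?N = "tri r" and ?L = "mat_diag r l" and ?Lp = "mat_diag m (\<lambda>i. l (r + i))"
  have dr: "dim_row ?L = r" by (simp add: mat_diag_def)
  have 1: "kron_S ?L ?L - \<tau>\<^sup>2 \<cdot>\<^sub>m 1\<^sub>m (dim_row ?L * (dim_row ?L + 1) div 2) =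
      mat_diag ?N (\<lambda>k. l (fst (lower_positions r ! k)) * l (snd (lower_positions r ! k)) - \<tau>\<^sup>2)"
    unfolding kron_S_diag dr by (intro eq_matI) (auto simp: mat_diag_def)
  have "?L - \<tau> \<cdot>\<^sub>m 1\<^sub>m (dim_row ?L) = mat_diag r (\<lambda>i. l i - \<tau>)"
    unfolding dr by (intro eq_matI) (auto simp: mat_diag_def)
  then have 2: "kron (?L - \<tau> \<cdot>\<^sub>m 1\<^sub>m (dim_row ?L)) ?Lp =
      mat_diag (r * m) (\<lambda>p. (l (p div m) - \<tau>) * l (r + p mod m))"
    by (simp add: kron_diag)
  have bl: "diag_block_mat [mat_diag a f, mat_diag b g] = mat_diag (a + b) (\<lambda>k. if k < a then f k else g (k - a))"
    for a b :: nat and f g :: "nat \<Rightarrow> real"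
    by (intro eq_matI) (auto simp: mat_diag_def Let_def)
  have "(\<lambda>k. if k < ?N then l (fst (lower_positions r ! k)) * l (snd (lower_positions r ! k)) - \<tau>\<^sup>2
      else (l ((k - ?N) div m) - \<tau>) * l (r + (k - ?N) mod m)) = sigma_denominator r m \<tau> l"
    by (simp add: sigma_denominator_def Let_def fun_eq_iff)
  then show ?thesis
    unfolding bold_Sigma_def 1 2 bl using assms by (simp add: inv_mat_diag)
qed

section \<open>Rank and injectivity\<close>

text \<open>The form at v is |A^T v|^2, and A^T is injective because its columns are distinct and
  independent.\<close>

lemma lin_indpt_rows_gram_pd:
  assumes A: "A \<in> carrier_mat m p" and ind: "lin_indpt_rows A"
  shows "A * A\<^sup>T \<in> pd_mats m"
proof -
  have inj: "x = 0\<^sub>v m" if x: "x \<in> carrier_vec m" "A\<^sup>T *\<^sub>v x = 0\<^sub>v p" for x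
  proof (rule ccontr)
    assume "x \<noteq> 0\<^sub>v m"
    then have "LinearCombinations.module.lin_dep class_ring (module_vec TYPE(real) p) (set (cols A\<^sup>T))"
      using vec_space.lin_depI[of "A\<^sup>T" p m x] A x ind by (simp add: lin_indpt_rows_def)
    then show False using ind A by (simp add: lin_indpt_rows_def)
  qed
  show ?thesis
    unfolding pd_mats_def sym_mats_def
  proof (safe, goal_cases)
    case (3 v)
    have "qf (A * A\<^sup>T) v = (A\<^sup>T *\<^sub>v v) \<bullet> (A\<^sup>T *\<^sub>v v)"
      using scalar_prod_mult_adjoint[OF A 3(1), of "A\<^sup>T *\<^sub>v v"] A 3 by simp
    moreover have "A\<^sup>T *\<^sub>v v \<noteq> 0\<^sub>v p" using inj[OF 3(1)] 3 by auto
    ultimately show ?case using scalar_prod_self_pos[of "A\<^sup>T *\<^sub>v v" p] A 3 by simp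
  qed (use A transpose_mult[OF A, of "A\<^sup>T" m] in auto)
qed

text \<open>Choose k independent columns of U U^T. Each is U c_j, so they form an injective matrix M
  = U C; then C is injective and, being square, invertible. If U y = 0 then M kills C^-1 y, hence y
  = 0.\<close>

lemma injective_of_gram_rank:
  assumes U: "(U::real mat) \<in> carrier_mat n k" and rk: "mat_rank (U * U\<^sup>T) = k"
    and y: "y \<in> carrier_vec k" "U *\<^sub>v y = 0\<^sub>v n"
  shows "y = 0\<^sub>v k"
proof -
  interpret V: vec_space "TYPE(real)" n .
  let ?X = "U * U\<^sup>T"
  have X: "?X \<in> carrier_mat n n" using U by simp
  obtain S where S: "maximal S (\<lambda>T. T \<subseteq> set (cols ?X) \<and> V.lin_indpt T)"
    using maximal_exists[of "(\<lambda>T. T \<subseteq> set (cols ?X) \<and> V.lin_indpt T)" "card (set (cols ?X))" "{}"]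
    by (meson List.finite_set card_mono empty_iff empty_subsetI V.finite_lin_indpt2 rev_finite_subset)
  have SX: "S \<subseteq> set (cols ?X)" and Si: "V.lin_indpt S" using S by (auto simp: maximal_def)
  have "V.rank ?X = card S" by (rule V.rank_card_indpt[OF X S])
  then have cS: "card S = k" using rk U by (simp add: mat_rank_def)
  have "finite S" using SX finite_subset by blast
  then obtain ss where ss: "set ss = S" "distinct ss" using finite_distinct_list by blast
  have len: "length ss = k" using ss cS distinct_card by fastforce
  have "\<exists>c \<in> carrier_vec k. ss ! j = U *\<^sub>v c" if "j < k" for j
  proof -
    have "ss ! j \<in> set (cols ?X)" using SX ss len that nth_mem by blast
    then obtain i where i: "i < n" "ss ! j = col ?X i" using X by (auto simp: in_set_conv_nth)
    then have "ss ! j = U *\<^sub>v col U\<^sup>T i" using col_mult2[OF U, of "U\<^sup>T" n i] U by simp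
    moreover have "col U\<^sup>T i \<in> carrier_vec k" using U i by auto
    ultimately show ?thesis by blast
  qed
  then obtain c where c: "\<And>j. j < k \<Longrightarrow> c j \<in> carrier_vec k" "\<And>j. j < k \<Longrightarrow> ss ! j = U *\<^sub>v c j"
    by metis
  define M where "M = mat_of_cols n ss"
  define C where "C = mat_of_cols k (map c [0..<k])"
  have M: "M \<in> carrier_mat n k" and C: "C \<in> carrier_mat k k" by (auto simp: M_def C_def len)
  have ssn: "set ss \<subseteq> carrier_vec n" using SX ss U X by (auto simp: in_set_conv_nth cols_def)
  have colsM: "cols M = ss" unfolding M_def by (rule cols_mat_of_cols[OF ssn])
  have MUC: "M = U * C"
  proof (rule mat_col_eqI)
    fix j assume "j < dim_col (U * C)"
    then have j: "j < k" using C by simp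
    have "col C j = c j" using j c(1) by (simp add: C_def)
    moreover have "col M j = ss ! j" using colsM M j by (metis carrier_matD(2) cols_nth)
    ultimately show "col M j = col (U * C) j" using col_mult2[OF U C j] c(2)[OF j] by simp
  qed (use M U C in auto)
  have Minj: "x = 0\<^sub>v k" if x: "x \<in> carrier_vec k" "M *\<^sub>v x = 0\<^sub>v n" for x
    using V.lin_depI[OF M x(1) _ x(2)] Si ss colsM by auto
  have "x = 0\<^sub>v k" if x: "x \<in> carrier_vec k" "C *\<^sub>v x = 0\<^sub>v k" for x
  proof (rule Minj[OF x(1)])
    have "M *\<^sub>v x = U *\<^sub>v (C *\<^sub>v x)" unfolding MUC by (rule assoc_mult_mat_vec[OF U C x(1)])
    then show "M *\<^sub>v x = 0\<^sub>v n" using x U by auto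
  qed
  note Ci = inv_mat_of_injective[OF C this]
  let ?x = "inv_mat C *\<^sub>v y"
  have x: "?x \<in> carrier_vec k" using Ci(2) y by simp
  have "C *\<^sub>v ?x = y" by (rule inv_mat_vec_cancel(1)[OF C Ci(2-4) y(1)])
  then have "M *\<^sub>v ?x = 0\<^sub>v n" unfolding MUC using assoc_mult_mat_vec[OF U C x] y(2) by simp
  then have "?x = 0\<^sub>v k" by (rule Minj[OF x])
  then show ?thesis using \<open>C *\<^sub>v ?x = y\<close> C by auto
qed

section \<open>Eigenvalues of a centered scaling point\<close>

text \<open>The centering assumption as inequalities of forms, with \<epsilon> in the role of 1 -
  \<delta> and 1 + L as a bound for S. \<open>U_range\<close> says that U U^T is at least 1 / chi1
  on the range of \<open>U\<close>.\<close>

locale centered_scaling = eigenbasis n W Z lam for n W Z lam +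
  fixes k :: nat and U X :: "real mat" and L \<epsilon> chi1 \<mu> :: real
  assumes U: "U \<in> carrier_mat n k" and k: "0 < k" "k < n"
    and U_inj: "y \<in> carrier_vec k \<Longrightarrow> U *\<^sub>v y = 0\<^sub>v n \<Longrightarrow> y = 0\<^sub>v k"
    and \<mu>: "0 < \<mu>" "\<mu> \<le> 1" and \<epsilon>: "0 < \<epsilon>" "\<epsilon> \<le> 1" and L: "0 < L" and chi1: "1 \<le> chi1"
    and W_psd: "W \<in> psd_mats n"
    and W_le: "v \<in> carrier_vec n \<Longrightarrow> \<epsilon> * sqrt \<mu> * (qf W v) \<le> qf X v"
    and W_ge: "v \<in> carrier_vec n \<Longrightarrow> qf X v \<le> 2 * sqrt \<mu> * (qf W v)"
    and X_low: "v \<in> carrier_vec n \<Longrightarrow> \<epsilon> * \<mu> * (v \<bullet> v) \<le> (1 + L) * (qf X v)"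
    and X_near: "v \<in> carrier_vec n \<Longrightarrow> \<bar>qf X v - (U\<^sup>T *\<^sub>v v) \<bullet> (U\<^sup>T *\<^sub>v v)\<bar> \<le> L * \<mu> * (v \<bullet> v)"
    and U_le: "v \<in> carrier_vec n \<Longrightarrow> (U\<^sup>T *\<^sub>v v) \<bullet> (U\<^sup>T *\<^sub>v v) \<le> v \<bullet> v"
    and U_range: "y \<in> carrier_vec k \<Longrightarrow> (U *\<^sub>v y) \<bullet> (U *\<^sub>v y) \<le>
      chi1 * ((U\<^sup>T *\<^sub>v (U *\<^sub>v y)) \<bullet> (U\<^sup>T *\<^sub>v (U *\<^sub>v y)))"
begin

definition "s = sqrt \<mu>"

lemma s: "0 < s" "s * s = \<mu>"
  using \<mu> by (auto simp: s_def)

lemma Zv: "x \<in> carrier_vec n \<Longrightarrow> Z *\<^sub>v x \<in> carrier_vec n"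
  using Z by simp

lemma ZZ: "x \<in> carrier_vec n \<Longrightarrow> (Z *\<^sub>v x) \<bullet> (Z *\<^sub>v x) = x \<bullet> x"
  by (rule Z_inner)

text \<open>\<open>X\<close> is at least of order \<mu>, and W at least X / (2 sqrt \<mu>). This
  lower bound keeps \<tau> and the bottom eigenvalues away from 0 at the scale sqrt \<mu>.\<close>

lemma lam_ge:
  assumes i: "i < n" shows "\<epsilon> * s / (2 * (1 + L)) \<le> lam i"
proof -
  let ?v = "Z *\<^sub>v unit_vec n i"
  have v: "?v \<in> carrier_vec n" by (rule Zv) simp
  have 1: "?v \<bullet> ?v = 1" using i by (subst ZZ) auto
  have "\<epsilon> * (s * s) \<le> (1 + L) * (qf X ?v)" using X_low[OF v] s by (simp add: 1)
  also have "\<dots> \<le> (1 + L) * (2 * s * lam i)"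
    using W_ge[OF v] L by (intro mult_left_mono) (auto simp: W_unit[OF i] s_def)
  finally have "s * (\<epsilon> * s) \<le> s * (2 * (1 + L) * lam i)" by (simp add: mult_ac)
  then have "\<epsilon> * s \<le> 2 * (1 + L) * lam i" using s by simp
  then show ?thesis using L by (simp add: field_simps)
qed

lemma lam_le:
  assumes i: "i < n" shows "lam i \<le> (1 + L) / (\<epsilon> * s)"
proof -
  let ?v = "Z *\<^sub>v unit_vec n i"
  have v: "?v \<in> carrier_vec n" by (rule Zv) simp
  have 1: "?v \<bullet> ?v = 1" using i by (subst ZZ) auto
  have "\<epsilon> * s * lam i \<le> qf X ?v" using W_le[OF v] by (simp add: W_unit[OF i] s_def)
  also have "\<dots> \<le> 1 + L * \<mu>" using X_near[OF v] U_le[OF v] by (simp add: 1)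
  also have "\<dots> \<le> 1 + L" using mult_left_le[of \<mu> L] \<mu> L by simp
  finally show ?thesis using \<epsilon> s by (simp add: field_simps)
qed

text \<open>On the kernel of U^T only the perturbation X - U U^T, of size L \<mu>, is left of
  \<open>X\<close>.\<close>

lemma W_le_on_kernel:
  assumes e: "e \<in> carrier_vec n" and z: "U\<^sup>T *\<^sub>v e = 0\<^sub>v k"
  shows "qf W e \<le> L * s / \<epsilon> * (e \<bullet> e)"
proof -
  have "\<epsilon> * s * (qf W e) \<le> qf X e" using W_le[OF e] by (simp add: s_def)
  also have "\<dots> \<le> L * (s * s) * (e \<bullet> e)" using X_near[OF e] s by (simp add: z)
  finally have "s * (\<epsilon> * (qf W e)) \<le> s * (L * s * (e \<bullet> e))" by (simp add: mult_ac)
  then have "\<epsilon> * (qf W e) \<le> L * s * (e \<bullet> e)" using s by simp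
  then show ?thesis using \<epsilon> by (simp add: field_simps)
qed

text \<open>Courant--Fischer: the \<open>k\<close> equations \<open>U\<^sup>T v = 0\<close> have a nonzero solution in the span of the
  top \<open>k + 1\<close> eigenvectors.\<close>

lemma lam_k_le: "lam k \<le> L * s / \<epsilon>"
proof -
  define T where "T = U\<^sup>T * Z"
  let ?P = "mat k (Suc k) (\<lambda>(i, j). T $$ (i, j))"
  obtain y where y: "y \<in> carrier_vec (Suc k)" "y \<noteq> 0\<^sub>v (Suc k)" "?P *\<^sub>v y = 0\<^sub>v k"
    using wide_kernel[of ?P k "Suc k"] by auto
  define x where "x = vec n (\<lambda>i. if i < Suc k then y $ i else 0)"
  have x: "x \<in> carrier_vec n" by (simp add: x_def)
  have UZ: "T \<in> carrier_mat k n" using U Z by (simp add: T_def)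
  have "T *\<^sub>v x = ?P *\<^sub>v y"
  proof (rule eq_vecI)
    fix i assume "i < dim_vec (?P *\<^sub>v y)"
    then have i: "i < k" by simp
    have "(T *\<^sub>v x) $ i = (\<Sum>j<n. T $$ (i, j) * x $ j)"
      using i x UZ by (simp add: scalar_prod_def atLeast0LessThan)
    also have "\<dots> = (\<Sum>j<Suc k. T $$ (i, j) * x $ j)"
      using k by (intro sum.mono_neutral_right) (auto simp: x_def)
    also have "\<dots> = (\<Sum>j<Suc k. ?P $$ (i, j) * y $ j)"
      using i k by (intro sum.cong) (auto simp: x_def)
    also have "\<dots> = (?P *\<^sub>v y) $ i" using i y(1) by (simp add: scalar_prod_def atLeast0LessThan del: sum.lessThan_Suc)
    finally show "(T *\<^sub>v x) $ i = (?P *\<^sub>v y) $ i" .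
  qed (use UZ in simp)
  then have z: "U\<^sup>T *\<^sub>v (Z *\<^sub>v x) = 0\<^sub>v k" using y(3) U Z x by (simp add: T_def)
  have "x \<noteq> 0\<^sub>v n"
  proof
    assume x0: "x = 0\<^sub>v n"
    have "y = 0\<^sub>v (Suc k)"
    proof (rule eq_vecI)
      fix i assume "i < dim_vec (0\<^sub>v (Suc k) :: real vec)"
      then have "i < Suc k" by simp
      then show "y $ i = 0\<^sub>v (Suc k) $ i" using x0[THEN arg_cong[of _ _ "\<lambda>v. v $ i"]] k by (simp add: x_def)
    qed (use y in simp)
    then show False using y(2) by simp
  qed
  then have pos: "0 < x \<bullet> x" using scalar_prod_self_pos[OF x] by simp
  have "lam k * (x \<bullet> x) \<le> (Z *\<^sub>v x) \<bullet> (W *\<^sub>v (Z *\<^sub>v x))"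
    by (rule W_quad_ge[OF x k(2)]) (auto simp: x_def)
  also have "\<dots> \<le> L * s / \<epsilon> * (x \<bullet> x)" using W_le_on_kernel[OF Zv[OF x] z] by (simp add: ZZ[OF x])
  finally show ?thesis using pos by (simp only: mult_le_cancel_right_pos)
qed

text \<open>The dual choice to the previous lemma: a vector v in the range of \<open>U\<close> and
  orthogonal to the top k - 1 eigenvectors. There W is at most \<open>lam (k - 1)\<close>, while X
  is at least 1 / chi1 - L \<mu> \<ge> 1 / (2 chi1) by smallness.\<close>

lemma lam_pred_k_ge:
  assumes small: "2 * (L * \<mu> * chi1) \<le> 1"
  shows "1 / (4 * chi1 * s) \<le> lam (k - 1)"
proof -
  define T where "T = Z\<^sup>T * U"
  \<comment> \<open>Orthogonality to the eigenvectors 0 to k - 2 is k - 1 equations in the k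
    unknowns y.\<close>
  let ?P = "mat (k - 1) k (\<lambda>(i, j). T $$ (i, j))"
  obtain y where y: "y \<in> carrier_vec k" "y \<noteq> 0\<^sub>v k" "?P *\<^sub>v y = 0\<^sub>v (k - 1)"
    using wide_kernel[of ?P "k - 1" k] k by auto
  have T: "T \<in> carrier_mat n k" using Z U by (simp add: T_def)
  define x where "x = T *\<^sub>v y"
  have x: "x \<in> carrier_vec n" using T y by (simp add: x_def)
  let ?v = "U *\<^sub>v y"
  have v: "?v \<in> carrier_vec n" using U y by simp
  have Zx: "Z *\<^sub>v x = ?v"
  proof -
    have "x = Z\<^sup>T *\<^sub>v ?v" unfolding x_def T_def using Z U y by simp
    then have "Z *\<^sub>v x = (Z * Z\<^sup>T) *\<^sub>v ?v" using Z v assoc_mult_mat_vec[OF Z _ v, of "Z\<^sup>T"] by simp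
    then show ?thesis using v by (simp add: ZZt)
  qed
  have x0: "x $ i = 0" if i: "i < k - 1" for i
  proof -
    have "row ?P i = row T i" using i k T by (intro eq_vecI) auto
    then have "x $ i = (?P *\<^sub>v y) $ i" using i k T by (simp add: x_def)
    also have "\<dots> = 0" unfolding y(3) using i by simp
    finally show ?thesis .
  qed
  have "?v \<noteq> 0\<^sub>v n" using U_inj[OF y(1)] y(2) by auto
  then have pos: "0 < ?v \<bullet> ?v" using scalar_prod_self_pos[OF v] by simp
  have xv: "x \<bullet> x = ?v \<bullet> ?v" using ZZ[OF x] Zx by simp
  have "qf W ?v \<le> lam (k - 1) * (?v \<bullet> ?v)"
    using W_quad_le[OF x, of "k - 1"] k x0 unfolding Zx xv by simp
  then have "2 * s * (qf W ?v) \<le> 2 * s * (lam (k - 1) * (?v \<bullet> ?v))" using s by simp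
  then have 1: "qf X ?v \<le> 2 * s * lam (k - 1) * (?v \<bullet> ?v)" using W_ge[OF v] by (simp add: s_def)
  have 2: "(?v \<bullet> ?v) / chi1 \<le> (U\<^sup>T *\<^sub>v ?v) \<bullet> (U\<^sup>T *\<^sub>v ?v)"
    using U_range[OF y(1)] chi1 by (simp add: field_simps)
  have 3: "L * \<mu> * (?v \<bullet> ?v) \<le> (1 / (2 * chi1)) * (?v \<bullet> ?v)"
    using small chi1 scalar_prod_self_nonneg[of ?v] by (intro mult_right_mono) (auto simp: field_simps)
  have "(1 / (2 * chi1)) * (?v \<bullet> ?v) = (?v \<bullet> ?v) / chi1 - (1 / (2 * chi1)) * (?v \<bullet> ?v)"
    using chi1 by (simp add: field_simps)
  also have "\<dots> \<le> qf X ?v" using 2 3 X_near[OF v] by linarith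
  also note 1
  finally have "1 / (2 * chi1) \<le> 2 * s * lam (k - 1)" using pos by (simp only: mult_le_cancel_right_pos)
  then show ?thesis using s chi1 by (simp add: field_simps)
qed

text \<open>The condition on \<eta> says that the bound L sqrt \<mu> / \<epsilon> for W on the
  kernel of U^T is at most \<eta>^2 times the bound 1 / (4 chi1 sqrt \<mu>) for the top k
  eigenvalues.\<close>

lemma near_tangent_coords:
  assumes F: "F \<in> carrier_mat n n" "F\<^sup>T = F"
    and supp: "\<And>i j. k \<le> i \<Longrightarrow> i < n \<Longrightarrow> k \<le> j \<Longrightarrow> j < n \<Longrightarrow> F $$ (i, j) = 0"
    and \<eta>: "0 \<le> \<eta>" "4 * (L * \<mu> * chi1) \<le> \<epsilon> * \<eta>\<^sup>2" and small: "2 * (L * \<mu> * chi1) \<le> 1"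
  shows "\<exists>V E'. V \<in> carrier_mat n k \<and> E' \<in> carrier_mat n n \<and> E'\<^sup>T = E' \<and>
    Z * F * Z\<^sup>T = (U * V\<^sup>T + V * U\<^sup>T) + E' \<and> frobenius_norm E' \<le> 2 * \<eta> * frobenius_norm F"
proof -
  have l: "0 < 1 / (4 * chi1 * s)" using s chi1 by simp
  have "4 * (L * (s * s) * chi1) \<le> \<epsilon> * \<eta>\<^sup>2" using \<eta>(2) by (simp only: s(2))
  then have "L * s / \<epsilon> \<le> 1 / (4 * chi1 * s) * \<eta>\<^sup>2"
    using s(1) chi1 \<epsilon> by (simp add: field_simps)
  from top_eigenspace_near_range[OF W_psd U k(1) less_imp_le[OF k(2)] U_inj l lam_pred_k_ge[OF small]
      W_le_on_kernel \<eta>(1) this]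
  obtain C E where CE: "C \<in> carrier_mat k k" "E \<in> carrier_mat n k"
    "Z * mat n k (\<lambda>(i, j). if i = j then 1 else 0) = U * C + E"
    "\<And>y. y \<in> carrier_vec k \<Longrightarrow> vec_norm (E *\<^sub>v y) \<le> \<eta> * vec_norm y" by blast
  show ?thesis by (rule near_tangent[OF U less_imp_le[OF k(2)] F supp CE \<eta>(1)])
qed

end

section \<open>The Schur complement is bounded below\<close>

text \<open>The two eigenvectors coupled by coordinate i of \<open>bold_Q\<close>, as indices into
  the full list of eigenvalues; adding r moves a bottom index behind the top ones.\<close>

definition eig_pair :: "nat \<Rightarrow> nat \<Rightarrow> nat \<Rightarrow> nat \<times> nat" where
  "eig_pair r m i = (let N = tri r in
     if i < N then lower_positions r ! i else ((i - N) div m, r + (i - N) mod m))"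

text \<open>For a lower bound t of \<tau> and an upper bound B of two eigenvalues a and b. The
  denominators of Sigma lie below the product of the eigenvalues, so this bounds the entries of D
  from below.\<close>

lemma square_ratio_le:
  fixes t :: real
  assumes "0 \<le> t" "t \<le> \<tau>" "0 < a" "a \<le> B" "0 < b" "b \<le> B"
  shows "(t / B)\<^sup>2 \<le> \<tau>\<^sup>2 / (a * b)"
proof -
  have "t\<^sup>2 \<le> \<tau>\<^sup>2" using assms by (intro power_mono) auto
  moreover have "a * b \<le> B * B" using assms by (intro mult_mono) auto
  ultimately show ?thesis
    using assms unfolding power_divide power2_eq_square[of B] by (intro frac_le) auto
qed

section \<open>Size of the entries of D = tau^2 Sigma\<close>

context centered_scaling
begin

context
  fixes r m :: nat and \<tau> :: real
  assumes kr: "k \<le> r" and rn: "r < n" and m: "m = n - r" and \<tau>: "\<tau> = lam r / 2"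
begin

lemma lam_pos: assumes "i < n" shows "0 < lam i"
proof -
  have "0 < \<epsilon> * s / (2 * (1 + L))" using s(1) \<epsilon> L by simp
  then show ?thesis using lam_ge[OF assms] by (rule less_le_trans)
qed

text \<open>Since k \<le> r < n, twice \<tau> is an eigenvalue past the first k, and those are of
  order sqrt \<mu> from both sides.\<close>

lemma \<tau>_bounds: "\<epsilon> * s / (4 * (1 + L)) \<le> \<tau>" "\<tau> \<le> L * s / (2 * \<epsilon>)" "0 < \<tau>"
proof -
  have "\<epsilon> * s / (4 * (1 + L)) = (\<epsilon> * s / (2 * (1 + L))) / 2" by simp
  also have "\<dots> \<le> lam r / 2" by (intro divide_right_mono lam_ge rn) simp
  finally show "\<epsilon> * s / (4 * (1 + L)) \<le> \<tau>" unfolding \<tau> .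
  have "lam r \<le> L * s / \<epsilon>" using lam_mono[OF kr rn] lam_k_le by simp
  then have "lam r / 2 \<le> (L * s / \<epsilon>) / 2" by simp
  then show "\<tau> \<le> L * s / (2 * \<epsilon>)" using \<tau> \<epsilon> by (simp add: field_simps)
  show "0 < \<tau>" using lam_pos[OF rn] \<tau> by simp
qed

text \<open>The choice 2 \<tau> = \<open>lam r\<close> keeps both denominators positive. In the
  first block both eigenvalues are at least 2 \<tau>, so the denominator is at least 3 \<tau>^2. In
  the second, lam a - \<tau> \<ge> \<tau> leaves the entry at most \<tau> / lam b, a quotient of two
  quantities of order sqrt \<mu>.\<close>

lemma sigma_entry:
  assumes i: "i < tri r + r * m" and ab: "eig_pair r m i = (a, b)"
  shows "a < n" "b < n" "0 < sigma_denominator r m \<tau> lam i"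
    "\<tau>\<^sup>2 / sigma_denominator r m \<tau> lam i \<le> 1 + L * (1 + L) / \<epsilon>\<^sup>2"
    "\<tau>\<^sup>2 / (lam a * lam b) \<le> \<tau>\<^sup>2 / sigma_denominator r m \<tau> lam i"
proof -
  let ?N = "tri r" and ?d = "sigma_denominator r m \<tau> lam i"
  have bound: "0 \<le> L * (1 + L) / \<epsilon>\<^sup>2" using L by simp
  have t2: "2 * \<tau> \<le> lam j" if "j \<le> r" for j using lam_mono[OF that rn] \<tau> by simp
  have "a < n \<and> b < n \<and> 0 < ?d \<and> \<tau>\<^sup>2 / ?d \<le> 1 + L * (1 + L) / \<epsilon>\<^sup>2 \<and> \<tau>\<^sup>2 / (lam a * lam b) \<le> \<tau>\<^sup>2 / ?d"
  proof (cases "i < ?N")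
    case True
    then have l: "lower_positions r ! i = (a, b)" using ab by (simp add: eig_pair_def)
    note le = lower_positions_nth[OF True l]
    have d: "?d = lam a * lam b - \<tau>\<^sup>2" using True l by (simp add: sigma_denominator_def)
    have "(2 * \<tau>) * (2 * \<tau>) \<le> lam a * lam b"
      using le t2[of a] t2[of b] \<tau>_bounds(3) by (intro mult_mono) auto
    then have d3: "3 * \<tau>\<^sup>2 \<le> ?d" unfolding d by (simp add: power2_eq_square)
    have tt: "0 < \<tau>\<^sup>2" using \<tau>_bounds(3) by simp
    have "0 < ?d" using d3 tt by linarith
    moreover have "\<tau>\<^sup>2 / ?d \<le> 1" using d3 tt by (subst divide_le_eq_1_pos) linarith+
    then have "\<tau>\<^sup>2 / ?d \<le> 1 + L * (1 + L) / \<epsilon>\<^sup>2" using bound by linarith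
    moreover have "\<tau>\<^sup>2 / (lam a * lam b) \<le> \<tau>\<^sup>2 / ?d"
    proof (rule divide_left_mono)
      show "0 < lam a * lam b * ?d"
        using lam_pos[of a] lam_pos[of b] le rn calculation(1) by (intro mult_pos_pos) auto
    qed (use d in auto)
    ultimately show ?thesis using le rn by auto
  next
    case False
    then have ab': "a = (i - ?N) div m" "b = r + (i - ?N) mod m" using ab by (auto simp: eig_pair_def Let_def)
    have im: "i - ?N < r * m" using i False by linarith
    have m0: "0 < m" using m rn by simp
    have a: "a < r" unfolding ab'(1) using im by (rule less_mult_imp_div_less)
    have "(i - ?N) mod m < m" using m0 by simp
    then have b: "b < n" unfolding ab'(2) using m rn by linarith
    have d: "?d = (lam a - \<tau>) * lam b" using False ab' by (simp add: sigma_denominator_def Let_def)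
    have la: "\<tau> \<le> lam a - \<tau>" using t2[of a] a by simp
    have lb: "0 < lam b" by (rule lam_pos[OF b])
    have "\<tau> * lam b \<le> ?d" unfolding d using la lb by (intro mult_right_mono) auto
    then have d0: "0 < ?d" using \<tau>_bounds(3) lb by (meson less_le_trans mult_pos_pos)
    have "\<tau>\<^sup>2 / ?d \<le> \<tau>\<^sup>2 / (\<tau> * lam b)"
      using \<open>\<tau> * lam b \<le> ?d\<close> d0 \<tau>_bounds(3) lb by (intro divide_left_mono) auto
    also have "\<dots> = \<tau> / lam b" using \<tau>_bounds(3) by (simp add: power2_eq_square)
    also have "\<dots> \<le> (L * s / (2 * \<epsilon>)) / (\<epsilon> * s / (2 * (1 + L)))"
      using \<tau>_bounds(2,3) lam_ge[OF b] L s \<epsilon> by (intro frac_le) auto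
    also have "\<dots> = L * (1 + L) / \<epsilon>\<^sup>2" using s \<epsilon> L by (simp add: field_simps power2_eq_square)
    finally have "\<tau>\<^sup>2 / ?d \<le> 1 + L * (1 + L) / \<epsilon>\<^sup>2" by simp
    moreover have "?d \<le> lam a * lam b" unfolding d using \<tau>_bounds(3) lb by (intro mult_right_mono) auto
    then have "\<tau>\<^sup>2 / (lam a * lam b) \<le> \<tau>\<^sup>2 / ?d" using d0 by (intro divide_left_mono) auto
    ultimately show ?thesis using a b d0 rn by auto
  qed
  then show "a < n" "b < n" "0 < ?d" "\<tau>\<^sup>2 / ?d \<le> 1 + L * (1 + L) / \<epsilon>\<^sup>2" "\<tau>\<^sup>2 / (lam a * lam b) \<le> \<tau>\<^sup>2 / ?d"
    by auto
qed

text \<open>Valid for every coordinate but of order \<mu>^2, since both eigenvalues may be of order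
  1 / sqrt \<mu>; it serves for \<mu> bounded away from 0.\<close>

lemma sigma_entry_ge:
  assumes i: "i < tri r + r * m"
  shows "(\<epsilon>\<^sup>2 * \<mu> / (4 * (1 + L)\<^sup>2))\<^sup>2 \<le> \<tau>\<^sup>2 / sigma_denominator r m \<tau> lam i"
proof -
  obtain a b where ab: "eig_pair r m i = (a, b)" by (cases "eig_pair r m i")
  note e = sigma_entry[OF i ab]
  let ?t = "\<epsilon> * s / (4 * (1 + L))" and ?B = "(1 + L) / (\<epsilon> * s)"
  have "?t / ?B = \<epsilon>\<^sup>2 * (s * s) / (4 * (1 + L)\<^sup>2)" using L s(1) \<epsilon> by (simp add: field_simps power2_eq_square)
  then have "(\<epsilon>\<^sup>2 * \<mu> / (4 * (1 + L)\<^sup>2))\<^sup>2 = (?t / ?B)\<^sup>2" by (simp only: s(2))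
  also have "\<dots> \<le> \<tau>\<^sup>2 / (lam a * lam b)"
    using \<tau>_bounds(1) lam_le e(1,2) lam_pos L s(1) \<epsilon> by (intro square_ratio_le) auto
  also note e(5)
  finally show ?thesis .
qed

text \<open>Both eigenvalues are at most L sqrt \<mu> / \<epsilon> here, and sqrt \<mu> cancels
  against the lower bound for \<tau>.\<close>

lemma sigma_entry_ge_off_tangent:
  assumes i: "i < tri r + r * m" and ab: "eig_pair r m i = (a, b)" and ka: "k \<le> a" "k \<le> b"
  shows "(\<epsilon>\<^sup>2 / (4 * (1 + L) * L))\<^sup>2 \<le> \<tau>\<^sup>2 / sigma_denominator r m \<tau> lam i"
proof -
  note e = sigma_entry[OF i ab]
  let ?t = "\<epsilon> * s / (4 * (1 + L))" and ?B = "L * s / \<epsilon>"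
  have "\<epsilon> * s / (4 * u) / ?B = \<epsilon>\<^sup>2 / (4 * u * L)" if "0 < u" for u
    using that L s(1) \<epsilon> by (simp add: field_simps power2_eq_square)
  from this[of "1 + L"] have "?t / ?B = \<epsilon>\<^sup>2 / (4 * (1 + L) * L)" using L by simp
  then have "(\<epsilon>\<^sup>2 / (4 * (1 + L) * L))\<^sup>2 = (?t / ?B)\<^sup>2" by simp
  also have "\<dots> \<le> \<tau>\<^sup>2 / (lam a * lam b)"
    using \<tau>_bounds(1) lam_mono[OF ka(1) e(1)] lam_mono[OF ka(2) e(2)] lam_k_le e(1,2) lam_pos L s(1) \<epsilon>
    by (intro square_ratio_le) auto
  also note e(5)
  finally show ?thesis .
qed

end

end

section \<open>Tangential coordinates and the lower bound for the Schur complement\<close>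

locale kkt_system =
  centered_scaling n W Z lam k U X L \<epsilon> chi1 \<mu> +
  gram_comparison m "tri n" A G gmin gmax
  for n W Z lam k U X L \<epsilon> chi1 \<mu> m A G gmin gmax +
  fixes r :: nat and Q Qp :: "real mat" and \<tau> chi2 :: real
  assumes Q: "Q \<in> carrier_mat n r" and Qp: "Qp \<in> carrier_mat n (n - r)" and Z_eq: "Z = hcat Q Qp"
    and kr: "k \<le> r" and rn: "r < n" and \<tau>: "\<tau> = lam r / 2" and chi2: "1 \<le> chi2"
    and tangent: "V \<in> carrier_mat n k \<Longrightarrow> inverse chi2 * frobenius_norm (U * V\<^sup>T + V * U\<^sup>T) \<le>
      vec_norm (inv_mat (sqrt_mat (A * A\<^sup>T)) *\<^sub>v (A *\<^sub>v vec_S (U * V\<^sup>T + V * U\<^sup>T)))"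
begin

definition "q = tri r + r * (n - r)"
definition "d i = \<tau>\<^sup>2 / sigma_denominator r (n - r) \<tau> lam i"
abbreviation "BQ \<equiv> bold_Q Q Qp"
definition "R = inv_mat (sqrt_mat (A * A\<^sup>T))"
text \<open>For r > k also the first block of \<open>bold_Q\<close> has coordinates that are not
  tangential; they couple two eigenvalues of order sqrt \<mu>.\<close>

definition "tangential i = (fst (eig_pair r (n - r) i) < k \<or> snd (eig_pair r (n - r) i) < k)"

lemma BQc: "BQ \<in> carrier_mat (tri n) q"
  unfolding q_def by (rule bold_Q_carrier[OF Q Qp])

text \<open>The last clause is for a purely tangential y: F then has the block shape that
  \<open>near_tangent_coords\<close> requires.\<close>

lemma split_coords:
  assumes y: "y \<in> carrier_vec q"
  obtains F where "F \<in> carrier_mat n n" "F\<^sup>T = F" "BQ *\<^sub>v y = vec_S (Z * F * Z\<^sup>T)"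
    "frobenius_norm F = vec_norm y"
    "(\<And>i. i < q \<Longrightarrow> \<not> tangential i \<Longrightarrow> y $ i = 0) \<Longrightarrow>
      (\<And>i j. k \<le> i \<Longrightarrow> i < n \<Longrightarrow> k \<le> j \<Longrightarrow> j < n \<Longrightarrow> F $$ (i, j) = 0)"
proof -
  let ?N = "tri r" and ?m = "n - r"
  define h1 where "h1 = vec_first y ?N"
  define h2 where "h2 = vec_last y (r * ?m)"
  have h1: "h1 \<in> carrier_vec ?N" and h2: "h2 \<in> carrier_vec (r * ?m)" by (simp_all add: h1_def h2_def)
  have yh: "y = h1 @\<^sub>v h2" using y unfolding h1_def h2_def q_def by (simp only: vec_first_last_append)
  have nrm: "n = r + ?m" using rn by simp
  let ?F = "coord_mat r ?m h1 h2"
  have Fc: "?F \<in> carrier_mat n n" using coord_mat_carrier[of r ?m h1 h2] rn by simp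
  have B: "BQ *\<^sub>v y = vec_S (Z * ?F * Z\<^sup>T)" unfolding yh Z_eq by (rule bold_Q_mult[OF Q Qp nrm h1 h2])
  have nm: "frobenius_norm ?F = vec_norm y" unfolding yh by (rule coord_mat_norm[OF h1 h2])
  show thesis
  proof (rule that[OF Fc coord_mat_sym[OF h1] B nm])
    fix i j assume z: "\<And>i. i < q \<Longrightarrow> \<not> tangential i \<Longrightarrow> y $ i = 0"
      and ij: "k \<le> i" "i < n" "k \<le> j" "j < n"
    show "?F $$ (i, j) = 0"
    proof (rule coord_mat_support[OF h1 kr])
      fix l a b assume l: "l < ?N" and ab: "lower_positions r ! l = (a, b)" and kb: "k \<le> b"
      have "\<not> tangential l" using l ab kb lower_positions_nth[OF l ab] by (simp add: tangential_def eig_pair_def)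
      then have "y $ l = 0" using z[of l] l by (simp add: q_def)
      then show "h1 $ l = 0" using l h1 h2 by (simp add: yh)
    next
      fix a b assume a: "k \<le> a" "a < r" and b: "b < ?m"
      let ?l = "?N + (b + a * ?m)"
      have lt: "b + a * ?m < r * ?m" using pos_less[OF b a(2)] by (simp add: mult.commute)
      have "eig_pair r ?m ?l = (a, r + b)" using b by (simp add: eig_pair_def Let_def)
      then have "\<not> tangential ?l" using a kr by (simp add: tangential_def)
      then have "y $ ?l = 0" using z[of ?l] lt by (simp add: q_def)
      then show "h2 $ (b + a * ?m) = 0" using h1 h2 lt by (simp add: yh)
    qed (use ij nrm in auto)
  qed
qed

lemma BQ_norm:
  assumes y: "y \<in> carrier_vec q" shows "vec_norm (BQ *\<^sub>v y) = vec_norm y"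
proof -
  obtain F where F: "F \<in> carrier_mat n n" "F\<^sup>T = F" "BQ *\<^sub>v y = vec_S (Z * F * Z\<^sup>T)"
    "frobenius_norm F = vec_norm y" using split_coords[OF y] by metis
  have "vec_norm (BQ *\<^sub>v y) = frobenius_norm (Z * F * Z\<^sup>T)"
    unfolding F(3) using Z F by (intro vec_S_norm[of _ n] conj_sym) auto
  then show ?thesis using conj_frobenius_norm[OF F(1)] F(4) by simp
qed

lemma R_props:
  "R \<in> carrier_mat m m"
  "t \<in> carrier_vec (tri n) \<Longrightarrow> vec_norm (R *\<^sub>v (A *\<^sub>v t)) \<le> vec_norm t"
  "t \<in> carrier_vec (tri n) \<Longrightarrow>
    (vec_norm (R *\<^sub>v (A *\<^sub>v t)))\<^sup>2 \<le> gmax * ((A *\<^sub>v t) \<bullet> (inv_mat G *\<^sub>v (A *\<^sub>v t)))"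
  unfolding R_def using whitened_le_inv_G zero_carrier_vec by blast+

text \<open>The image of y is a tangent matrix T plus an error E with |E| \<le> |y| / (4 chi2).
  Injectivity gives at least |T| / chi2 on T, and the whitened operator has norm at most 1 on E,
  which leaves (1 - 1 / (4 chi2)) / chi2 - 1 / (4 chi2) \<ge> 1 / (2 chi2) times |y|, because chi2
  \<ge> 1.\<close>

lemma tangential_lower:
  assumes y: "y \<in> carrier_vec q" and supp: "\<And>i. i < q \<Longrightarrow> \<not> tangential i \<Longrightarrow> y $ i = 0"
    and small: "\<mu> \<le> \<epsilon> / (256 * L * chi1 * chi2\<^sup>2)"
  shows "vec_norm y / (2 * chi2) \<le> vec_norm (R *\<^sub>v (A *\<^sub>v (BQ *\<^sub>v y)))"
proof -
  obtain F where F: "F \<in> carrier_mat n n" "F\<^sup>T = F" "BQ *\<^sub>v y = vec_S (Z * F * Z\<^sup>T)"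
    "frobenius_norm F = vec_norm y"
    "\<And>i j. k \<le> i \<Longrightarrow> i < n \<Longrightarrow> k \<le> j \<Longrightarrow> j < n \<Longrightarrow> F $$ (i, j) = 0"
    using split_coords[OF y] supp by metis
  \<comment> \<open>The error 2 \<eta> |y| becomes |y| / (4 chi2), and 4 / \<eta>^2 = 256 chi2^2 is
    the origin of the threshold on \<mu>.\<close>
  define \<eta> where "\<eta> = 1 / (8 * chi2)"
  have sm: "256 * (L * \<mu> * chi1) * chi2\<^sup>2 \<le> \<epsilon>"
    using small L chi1 chi2 by (simp add: field_simps)
  have \<eta>: "0 \<le> \<eta>" "4 * (L * \<mu> * chi1) \<le> \<epsilon> * \<eta>\<^sup>2"
    using chi2 sm by (simp_all add: \<eta>_def power_divide field_simps)
  have "L * \<mu> * chi1 * 1 \<le> L * \<mu> * chi1 * chi2\<^sup>2"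
    using L \<mu> chi1 chi2 by (intro mult_left_mono one_le_power) auto
  then have sm2: "2 * (L * \<mu> * chi1) \<le> 1" using sm \<epsilon> by linarith
  from near_tangent_coords[OF F(1,2,5) \<eta> sm2]
  obtain V E where V: "V \<in> carrier_mat n k" and E: "E \<in> carrier_mat n n" "E\<^sup>T = E"
    and eq: "Z * F * Z\<^sup>T = (U * V\<^sup>T + V * U\<^sup>T) + E" and Eb: "frobenius_norm E \<le> 2 * \<eta> * frobenius_norm F"
    by blast
  let ?T = "U * V\<^sup>T + V * U\<^sup>T" and ?y = "vec_norm y"
  have T: "?T \<in> carrier_mat n n" using U V by simp
  have Eb': "frobenius_norm E \<le> ?y / (4 * chi2)" using Eb chi2 by (simp add: F(4) \<eta>_def)
  have T_ge: "?y - ?y / (4 * chi2) \<le> frobenius_norm ?T"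
    using frobenius_norm_diff_ge[of "?T + E" n n "- E"] frobenius_norm_triangle[OF T E(1)]
      conj_frobenius_norm[OF F(1)] Eb' F(4) unfolding eq by linarith
  have vT: "vec_S ?T \<in> carrier_vec (tri n)" and vE: "vec_S E \<in> carrier_vec (tri n)"
    by (rule vec_S_carrier[OF T], rule vec_S_carrier[OF E(1)])
  have RT: "R *\<^sub>v (A *\<^sub>v vec_S ?T) \<in> carrier_vec m" and RE: "R *\<^sub>v (A *\<^sub>v vec_S E) \<in> carrier_vec m"
    using R_props(1) A vT vE by auto
  have split: "R *\<^sub>v (A *\<^sub>v (BQ *\<^sub>v y)) = R *\<^sub>v (A *\<^sub>v vec_S ?T) + R *\<^sub>v (A *\<^sub>v vec_S E)"
    unfolding F(3) eq vec_S_add[OF T E(1)] mult_add_distrib_mat_vec[OF A vT vE]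
    using R_props(1) A vT vE by (intro mult_add_distrib_mat_vec) auto
  have "?y / (2 * chi2) \<le> (?y - ?y / (4 * chi2)) / chi2 - ?y / (4 * chi2)"
  proof -
    have "?y / (4 * chi2) / chi2 \<le> ?y / (4 * chi2) / 1" using chi2 by (intro divide_left_mono) auto
    moreover have "?y / (2 * chi2) = ?y / chi2 - ?y / (4 * chi2) - ?y / (4 * chi2)"
      using chi2 by (simp add: field_simps)
    ultimately show ?thesis by (simp add: diff_divide_distrib)
  qed
  also have "\<dots> \<le> inverse chi2 * frobenius_norm ?T - frobenius_norm E"
  proof (rule diff_mono[OF _ Eb'])
    have "(?y - ?y / (4 * chi2)) / chi2 \<le> frobenius_norm ?T / chi2"
      using T_ge chi2 by (intro divide_right_mono) auto
    then show "(?y - ?y / (4 * chi2)) / chi2 \<le> inverse chi2 * frobenius_norm ?T"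
      by (simp only: divide_inverse mult.commute)
  qed
  also have "\<dots> \<le> vec_norm (R *\<^sub>v (A *\<^sub>v vec_S ?T)) - vec_norm (R *\<^sub>v (A *\<^sub>v vec_S E))"
    using tangent[OF V] R_props(2)[OF vE] vec_S_norm[OF E] unfolding R_def by linarith
  also have "\<dots> \<le> vec_norm (R *\<^sub>v (A *\<^sub>v (BQ *\<^sub>v y)))"
    unfolding split by (rule vec_norm_diff_ge[OF RT RE])
  finally show ?thesis .
qed

lemma d_bounds:
  assumes "i < q" shows "0 \<le> d i" "d i \<le> 1 + L * (1 + L) / \<epsilon>\<^sup>2" "sigma_denominator r (n - r) \<tau> lam i \<noteq> 0"
    "(\<epsilon>\<^sup>2 * \<mu> / (4 * (1 + L)\<^sup>2))\<^sup>2 \<le> d i"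
    "\<not> tangential i \<Longrightarrow> (\<epsilon>\<^sup>2 / (4 * (1 + L) * L))\<^sup>2 \<le> d i"
proof -
  obtain a b where ab: "eig_pair r (n - r) i = (a, b)" by (cases "eig_pair r (n - r) i")
  note i = assms[unfolded q_def]
  note e = sigma_entry[OF kr rn refl \<tau> i ab]
  show "0 \<le> d i" "d i \<le> 1 + L * (1 + L) / \<epsilon>\<^sup>2" "sigma_denominator r (n - r) \<tau> lam i \<noteq> 0"
    using e(3,4) by (auto simp: d_def)
  show "(\<epsilon>\<^sup>2 * \<mu> / (4 * (1 + L)\<^sup>2))\<^sup>2 \<le> d i" unfolding d_def by (rule sigma_entry_ge[OF kr rn refl \<tau> i])
  show "(\<epsilon>\<^sup>2 / (4 * (1 + L) * L))\<^sup>2 \<le> d i" if "\<not> tangential i"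
    unfolding d_def using that by (intro sigma_entry_ge_off_tangent[OF kr rn refl \<tau> i ab]) (auto simp: tangential_def ab)
qed

text \<open>For \<open>\<mu>\<close> bounded away from \<open>0\<close> all entries of \<open>D\<close> are large enough. For small \<open>\<mu>\<close> only the
  entries off the tangent coordinates are, and the tangent coordinates are controlled by the
  injectivity assumption.\<close>

lemma schur_lower:
  "\<exists>k0 > 0. (1 / k0 \<le> 2 ^ 20 * L\<^sup>2 * chi1\<^sup>2 * chi2 ^ 4 * (1 + L) ^ 4 / \<epsilon> ^ 6 \<or>
      1 / k0 \<le> 9 * chi2\<^sup>2 * (gmax + 16 * (1 + L)\<^sup>2 * L\<^sup>2 / \<epsilon> ^ 4)) \<and>
    (\<forall>y \<in> carrier_vec q. k0 * (y \<bullet> y) \<le>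
      (\<Sum>i<q. d i * (y $ i)\<^sup>2) + (A *\<^sub>v (BQ *\<^sub>v y)) \<bullet> (inv_mat G *\<^sub>v (A *\<^sub>v (BQ *\<^sub>v y))))"
proof (cases "\<mu> \<le> \<epsilon> / (256 * L * chi1 * chi2\<^sup>2)")
  case False
  \<comment> \<open>The bound of \<open>sigma_entry_ge\<close> at the threshold value of \<mu>. As
    256 * 4 = 2^10, its reciprocal carries 2^20 and \<epsilon>^-6.\<close>
  define k0 where "k0 = (\<epsilon>\<^sup>2 * (\<epsilon> / (256 * L * chi1 * chi2\<^sup>2)) / (4 * (1 + L)\<^sup>2))\<^sup>2"
  have k0: "0 < k0" using \<epsilon> L chi1 chi2 by (simp add: k0_def)
  have k0_eq: "1 / k0 = 2 ^ 20 * L\<^sup>2 * chi1\<^sup>2 * chi2 ^ 4 * (1 + L) ^ 4 / \<epsilon> ^ 6"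
    by (simp add: k0_def power_divide power_mult_distrib flip: power_mult)
  have kd: "k0 \<le> d i" if "i < q" for i
  proof -
    have "k0 \<le> (\<epsilon>\<^sup>2 * \<mu> / (4 * (1 + L)\<^sup>2))\<^sup>2"
      unfolding k0_def using False \<epsilon> L chi1 chi2 by (intro power_mono divide_right_mono mult_left_mono) auto
    then show ?thesis using d_bounds(4)[OF that] by simp
  qed
  have "k0 * (y \<bullet> y) \<le> (\<Sum>i<q. d i * (y $ i)\<^sup>2) + (A *\<^sub>v (BQ *\<^sub>v y)) \<bullet> (inv_mat G *\<^sub>v (A *\<^sub>v (BQ *\<^sub>v y)))"
    if y: "y \<in> carrier_vec q" for y
  proof -
    have "k0 * (y \<bullet> y) = (\<Sum>i<q. k0 * (y $ i)\<^sup>2)" using y by (simp add: scalar_prod_self sum_distrib_left)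
    also have "\<dots> \<le> (\<Sum>i<q. d i * (y $ i)\<^sup>2)" using kd by (intro sum_mono mult_right_mono) auto
    moreover have "0 \<le> (A *\<^sub>v (BQ *\<^sub>v y)) \<bullet> (inv_mat G *\<^sub>v (A *\<^sub>v (BQ *\<^sub>v y)))"
      using psd_matsD(3)[OF pd_imp_psd[OF pd_inv_pd[OF G_pd]]] A BQc y by simp
    ultimately show ?thesis by simp
  qed
  then show ?thesis using k0 k0_eq by (intro exI[of _ k0]) auto
next
  case True
  define c1 where "c1 = (\<epsilon>\<^sup>2 / (4 * (1 + L) * L))\<^sup>2"
  \<comment> \<open>The 9 is 8 + 1: the tangential part of y contributes 2 (2 chi2)^2 = 8 chi2^2,
    the rest at most chi2^2. The Schur term is weighted by gmax, the diagonal term by 1 /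
    c1.\<close>
  define J where "J = 9 * chi2\<^sup>2 * (gmax + 1 / c1)"
  have c1: "0 < c1" using \<epsilon> L by (simp add: c1_def)
  have J: "0 < J" using gmax c1 chi2 by (simp add: J_def add_pos_pos)
  have "1 / c1 = 16 * (1 + L)\<^sup>2 * L\<^sup>2 / \<epsilon> ^ 4"
    unfolding c1_def power_divide power_mult_distrib by (simp flip: power_mult)
  then have J_eq: "J = 9 * chi2\<^sup>2 * (gmax + 16 * (1 + L)\<^sup>2 * L\<^sup>2 / \<epsilon> ^ 4)" by (simp add: J_def)
  have "y \<bullet> y \<le> J * ((\<Sum>i<q. d i * (y $ i)\<^sup>2) + (A *\<^sub>v (BQ *\<^sub>v y)) \<bullet> (inv_mat G *\<^sub>v (A *\<^sub>v (BQ *\<^sub>v y))))"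
    if y: "y \<in> carrier_vec q" for y
  proof -
    define yt where "yt = vec q (\<lambda>i. if tangential i then y $ i else 0)"
    define yo where "yo = vec q (\<lambda>i. if tangential i then 0 else y $ i)"
    have yt: "yt \<in> carrier_vec q" and yo: "yo \<in> carrier_vec q" by (simp_all add: yt_def yo_def)
    have ysum: "y = yt + yo" using y by (intro eq_vecI) (auto simp: yt_def yo_def)
    have "y \<bullet> y = (\<Sum>i<q. (yt $ i)\<^sup>2 + (yo $ i)\<^sup>2)"
      unfolding scalar_prod_self using y by (intro sum.cong) (auto simp: yt_def yo_def)
    then have yy: "y \<bullet> y = (vec_norm yt)\<^sup>2 + (vec_norm yo)\<^sup>2"
      unfolding vec_norm_sq scalar_prod_self using yt yo by (simp add: sum.distrib)
    define D where "D = (\<Sum>i<q. d i * (y $ i)\<^sup>2)"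
    define P where "P = (A *\<^sub>v (BQ *\<^sub>v y)) \<bullet> (inv_mat G *\<^sub>v (A *\<^sub>v (BQ *\<^sub>v y)))"
    have P0: "0 \<le> P"
      unfolding P_def using psd_matsD(3)[OF pd_imp_psd[OF pd_inv_pd[OF G_pd]]] A BQc y by simp
    have "c1 * (vec_norm yo)\<^sup>2 = (\<Sum>i<q. c1 * (if tangential i then 0 else y $ i)\<^sup>2)"
      by (simp add: vec_norm_sq scalar_prod_self yo_def sum_distrib_left)
    also have "\<dots> \<le> D"
      unfolding D_def
    proof (rule sum_mono)
      fix i assume "i \<in> {..<q}"
      then show "c1 * (if tangential i then 0 else y $ i)\<^sup>2 \<le> d i * (y $ i)\<^sup>2"
        using d_bounds(1,5)[of i] by (auto simp: c1_def intro: mult_right_mono)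
    qed
    finally have oD: "(vec_norm yo)\<^sup>2 \<le> D / c1" using c1 by (simp add: field_simps)
    have D0: "0 \<le> D" unfolding D_def using d_bounds(1) by (intro sum_nonneg) auto
    let ?R = "\<lambda>y. R *\<^sub>v (A *\<^sub>v (BQ *\<^sub>v y))"
    have By: "BQ *\<^sub>v y \<in> carrier_vec (tri n)" "BQ *\<^sub>v yo \<in> carrier_vec (tri n)"
      "BQ *\<^sub>v yt \<in> carrier_vec (tri n)"
      using mult_mat_vec_carrier[OF BQc] y yo yt by auto
    have Ry: "?R y = ?R yt + ?R yo"
      unfolding ysum mult_add_distrib_mat_vec[OF BQc yt yo] mult_add_distrib_mat_vec[OF A By(3,2)]
      using R_props(1) A By by (intro mult_add_distrib_mat_vec) auto
    \<comment> \<open>The image of yt is that of y minus that of yo: the first is controlled by the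
      form of G^-1, the second by D through the norm of yo.\<close>
    have "vec_norm yt / (2 * chi2) \<le> vec_norm (?R yt)"
      by (rule tangential_lower[OF yt _ True]) (auto simp: yt_def)
    also have "\<dots> \<le> vec_norm (?R y) + vec_norm (?R yo)"
      unfolding Ry using vec_norm_diff_ge[of "?R yt" m "?R yo"] R_props(1) A By by auto
    also have "\<dots> \<le> vec_norm (?R y) + vec_norm yo"
      using R_props(2)[OF By(2)] BQ_norm[OF yo] by simp
    finally have "(vec_norm yt / (2 * chi2))\<^sup>2 \<le> (vec_norm (?R y) + vec_norm yo)\<^sup>2"
      using chi2 by (intro power_mono) auto
    also have "\<dots> \<le> 2 * (vec_norm (?R y))\<^sup>2 + 2 * (vec_norm yo)\<^sup>2"
      using sum_squares_bound[of "vec_norm (?R y)" "vec_norm yo"] by (simp add: power2_sum)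
    also have "\<dots> \<le> 2 * (gmax * P) + 2 * (D / c1)"
      using R_props(3)[OF By(1)] oD by (simp add: P_def)
    finally have t: "(vec_norm yt)\<^sup>2 \<le> 8 * chi2\<^sup>2 * (gmax * P + D / c1)"
      using chi2 by (simp add: power_divide field_simps)
    have o: "(vec_norm yo)\<^sup>2 \<le> chi2\<^sup>2 * (gmax * P + D / c1)"
    proof -
      have "D / c1 \<le> 1 * (gmax * P + D / c1)" using gmax P0 by simp
      also have "\<dots> \<le> chi2\<^sup>2 * (gmax * P + D / c1)"
        using chi2 gmax P0 D0 c1 by (intro mult_right_mono one_le_power) auto
      finally show ?thesis using oD by simp
    qed
    have "y \<bullet> y \<le> 9 * chi2\<^sup>2 * (gmax * P + D / c1)"     proof -
      define w where "w = chi2\<^sup>2 * (gmax * P + D / c1)"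
      have "(vec_norm yt)\<^sup>2 \<le> 8 * w" "(vec_norm yo)\<^sup>2 \<le> w" using t o by (simp_all only: w_def mult.assoc)
      then have "y \<bullet> y \<le> 9 * w" using yy by linarith
      then show ?thesis by (simp only: w_def mult.assoc)
    qed
    also have "\<dots> \<le> 9 * chi2\<^sup>2 * ((gmax + 1 / c1) * (D + P))"
    proof (rule mult_left_mono)
      have "0 \<le> gmax * D" "0 \<le> P / c1" using gmax D0 P0 c1 by auto
      then show "gmax * P + D / c1 \<le> (gmax + 1 / c1) * (D + P)" by (simp add: distrib_left distrib_right)
    qed simp
    finally show ?thesis unfolding J_def D_def P_def by (simp add: mult.assoc)
  qed
  then show ?thesis
    using J J_eq by (intro exI[of _ "1 / J"]) (auto simp: field_simps)
qed

lemma kkt_bounds: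
  fixes M
  defines "M \<equiv> augmented_mat G A BQ \<tau> (bold_Sigma \<tau> (mat_diag r lam) (mat_diag (n - r) (\<lambda>i. lam (r + i))))"
  shows "invertible_mat M"
    "spectral_norm M \<le> gmax * beta + 2 * sqrt beta + (1 + L * (1 + L) / \<epsilon>\<^sup>2)"
    "\<exists>k0 > 0. (1 / k0 \<le> 2 ^ 20 * L\<^sup>2 * chi1\<^sup>2 * chi2 ^ 4 * (1 + L) ^ 4 / \<epsilon> ^ 6 \<or>
      1 / k0 \<le> 9 * chi2\<^sup>2 * (gmax + 16 * (1 + L)\<^sup>2 * L\<^sup>2 / \<epsilon> ^ 4)) \<and>
      spectral_norm (inv_mat M) \<le> alpha / gmin + (1 + sqrt alpha / gmin)\<^sup>2 / k0"
proof -
  have "bold_Sigma \<tau> (mat_diag r lam) (mat_diag (n - r) (\<lambda>i. lam (r + i))) =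
      mat_diag q (\<lambda>i. 1 / sigma_denominator r (n - r) \<tau> lam i)"
    unfolding q_def using d_bounds(3) by (intro bold_Sigma_eq) (simp add: q_def)
  moreover have "\<tau>\<^sup>2 \<cdot>\<^sub>m mat_diag q (\<lambda>i. 1 / sigma_denominator r (n - r) \<tau> lam i) = mat_diag q d"
    by (intro eq_matI) (auto simp: mat_diag_def d_def)
  ultimately have M: "M = four_block_mat G (A * BQ) (BQ\<^sup>T * A\<^sup>T) (- mat_diag q d)"
    by (simp add: M_def augmented_mat_def)
  obtain k0 where k0: "0 < k0" "1 / k0 \<le> 2 ^ 20 * L\<^sup>2 * chi1\<^sup>2 * chi2 ^ 4 * (1 + L) ^ 4 / \<epsilon> ^ 6 \<or>
      1 / k0 \<le> 9 * chi2\<^sup>2 * (gmax + 16 * (1 + L)\<^sup>2 * L\<^sup>2 / \<epsilon> ^ 4)"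
    "\<And>y. y \<in> carrier_vec q \<Longrightarrow> k0 * (y \<bullet> y) \<le>
      (\<Sum>i<q. d i * (y $ i)\<^sup>2) + (A *\<^sub>v (BQ *\<^sub>v y)) \<bullet> (inv_mat G *\<^sub>v (A *\<^sub>v (BQ *\<^sub>v y)))"
    using schur_lower by blast
  have dmax: "0 \<le> 1 + L * (1 + L) / \<epsilon>\<^sup>2" using L by simp
  have dd: "0 \<le> d i \<and> d i \<le> 1 + L * (1 + L) / \<epsilon>\<^sup>2" if "i < q" for i using d_bounds(1,2)[OF that] by simp
  note main = quasidefinite_cond[OF BQc BQ_norm dd dmax k0(1,3), folded M]
  show "invertible_mat M" "spectral_norm M \<le> gmax * beta + 2 * sqrt beta + (1 + L * (1 + L) / \<epsilon>\<^sup>2)"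
    using main(1,2) by auto
  show "\<exists>k0 > 0. (1 / k0 \<le> 2 ^ 20 * L\<^sup>2 * chi1\<^sup>2 * chi2 ^ 4 * (1 + L) ^ 4 / \<epsilon> ^ 6 \<or>
      1 / k0 \<le> 9 * chi2\<^sup>2 * (gmax + 16 * (1 + L)\<^sup>2 * L\<^sup>2 / \<epsilon> ^ 4)) \<and>
      spectral_norm (inv_mat M) \<le> alpha / gmin + (1 + sqrt alpha / gmin)\<^sup>2 / k0"
    using main(3) k0(1,2) by blast
qed

end

section \<open>The condition number\<close>

text \<open>K = 1 + 1 / \<kappa> bounds 1 + t by K t for each of the four quantities t \<ge>
  \<kappa>, so all sums collapse to monomials. Taking the factors K out again gives the exponent 22
  = 12 + 8 + 1 + 1, from L, 1 / gmin, a and b.\<close>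

lemma condition_arithmetic:
  fixes \<kappa> b a gmin gmax L \<epsilon> x y nM nI J :: real
  assumes \<kappa>: "0 < \<kappa>" "\<kappa> \<le> b" "\<kappa> \<le> a" "\<kappa> \<le> L" "\<kappa> \<le> 1 / gmin"
    and g: "0 < gmin" "gmin \<le> gmax" and \<epsilon>: "0 < \<epsilon>" "\<epsilon> \<le> 1" and x: "1 \<le> x" and y: "1 \<le> y"
    and nM: "0 \<le> nM" "nM \<le> gmax * b + 2 * sqrt b + (1 + L * (1 + L) / \<epsilon>\<^sup>2)"
    and nI: "0 \<le> nI" "nI \<le> a / gmin + (1 + sqrt a / gmin)\<^sup>2 * J"
    and J: "J \<le> 2 ^ 20 * L\<^sup>2 * x\<^sup>2 * y ^ 4 * (1 + L) ^ 4 / \<epsilon> ^ 6 \<or>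
      J \<le> 9 * y\<^sup>2 * (gmax + 16 * (1 + L)\<^sup>2 * L\<^sup>2 / \<epsilon> ^ 4)"
  shows "nM * nI \<le> 25 * 2 ^ 20 * (1 + 1 / \<kappa>) ^ 22 *
    (b * a * gmax ^ 4 * gmin powi (-8) * L ^ 12 * \<epsilon> powi (-11) * x\<^sup>2 * y ^ 6)"
proof -
  define K where "K = 1 + 1 / \<kappa>"
  have K: "1 \<le> K" using \<kappa>(1) by (simp add: K_def)
  have K1: "1 + t \<le> K * t" if "\<kappa> \<le> t" for t
    using that \<kappa>(1) by (simp add: K_def field_simps)
  define l where "l = K * L"
  define A where "A = K * a"
  define B where "B = K * b"
  define h where "h = K * (1 / gmin)"
  define e where "e = 1 / \<epsilon>"
  have l: "1 + L \<le> l" and A: "1 + a \<le> A" and B: "1 + b \<le> B" and h: "1 + 1 / gmin \<le> h"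
    unfolding l_def A_def B_def h_def using K1 \<kappa> by blast+
  have L: "0 < L" and a: "0 < a" and b: "0 < b" using \<kappa> by linarith+
  have l1: "1 \<le> l" and A1: "1 \<le> A" and B1: "1 \<le> B" using l A B L a b by linarith+
  have h1: "1 \<le> h" using h g(1) by (smt (verit) zero_less_divide_1_iff)
  have e: "1 \<le> e" using \<epsilon> by (simp add: e_def)
  \<comment> \<open>gmax itself may be less than 1; multiplied by h it is a factor of at least 1, by
    gmax \<ge> gmin.\<close>
  have gh: "1 \<le> gmax * h"
  proof -
    have "1 * 1 \<le> (gmax / gmin) * K" using g K by (intro mult_mono) auto
    then show ?thesis by (simp add: h_def mult_ac)
  qed
  have gx: "0 < gmax" using g by linarith
  have inv_pow: "x / \<epsilon> ^ k = x * e ^ k" for x k by (simp add: e_def power_one_over)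
  have gg: "gmax \<le> gmax * h" using gx h1 by simp
  have LL: "L * (1 + L) \<le> l\<^sup>2" unfolding power2_eq_square using l L by (intro mult_mono) auto
  have le2: "1 \<le> l\<^sup>2 * e\<^sup>2" using l1 e by (simp add: one_le_power mult_ge1_I)
  have le2': "L * (1 + L) / \<epsilon>\<^sup>2 \<le> l\<^sup>2 * e\<^sup>2" unfolding inv_pow using LL e by (intro mult_right_mono) auto
  have sb: "sqrt b \<le> B"
  proof -
    have "b \<le> B\<^sup>2" using B B1 by (smt (verit) one_le_power power2_eq_square mult_le_cancel_left1)
    then show ?thesis using B1 by (intro real_le_lsqrt) auto
  qed
  define P where "P = l\<^sup>2 * e\<^sup>2 * (gmax * h)"
  have P: "1 \<le> P" unfolding P_def using mult_mono[OF le2 gh] by simp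
  have Pl: "l\<^sup>2 * e\<^sup>2 \<le> P" unfolding P_def using gh mult_left_mono[OF gh, of "l\<^sup>2 * e\<^sup>2"] by simp
  have Pg: "gmax \<le> P"
  proof -
    have "1 * gmax \<le> l\<^sup>2 * e\<^sup>2 * (gmax * h)" using le2 gg gx by (intro mult_mono) auto
    then show ?thesis by (simp add: P_def)
  qed
  \<comment> \<open>Five copies: one each for gmax b, 1 and L (1 + L) / \<epsilon>^2, two for 2 sqrt
    b.\<close>
  have M: "nM \<le> 5 * (B * P)"
  proof -
    have 1: "gmax * b \<le> B * P" using mult_mono[OF Pg, of b B] B P gx b by (simp add: mult.commute)
    have 2: "sqrt b \<le> B * P" using mult_mono[OF sb P] B1 by simp
    have 3: "P \<le> B * P" using mult_right_mono[OF B1, of P] P by simp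
    show ?thesis using nM(2) 1 2 3 le2' Pl P by linarith
  qed
  \<comment> \<open>A common bound for both alternatives for J: the first gains the factor gmax h
    \<ge> 1, and in the second 9 * 17 = 153 is below 2^20.\<close>
  define H where "H = 2 ^ 20 * (l ^ 6 * x\<^sup>2 * y ^ 4 * e ^ 6 * (gmax * h))"
  have ge1: "1 \<le> l ^ 6 * x\<^sup>2 * y ^ 4 * e ^ 6 * (gmax * h)"
  proof -
    have "1 \<le> l ^ 6 * x\<^sup>2 * y ^ 4 * e ^ 6" using l1 x y e by (intro mult_ge1_I one_le_power)
    then show ?thesis using gh by (rule mult_ge1_I)
  qed
  have H: "1 \<le> H" unfolding H_def using ge1 by simp
  have JH: "J \<le> H"
    using J
  proof
    assume "J \<le> 2 ^ 20 * L\<^sup>2 * x\<^sup>2 * y ^ 4 * (1 + L) ^ 4 / \<epsilon> ^ 6"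
    also have "\<dots> = 2 ^ 20 * ((L\<^sup>2 * (1 + L) ^ 4) * (x\<^sup>2 * y ^ 4 * e ^ 6))" unfolding inv_pow by (simp only: mult_ac)
    also have "\<dots> \<le> 2 ^ 20 * ((l\<^sup>2 * l ^ 4) * (x\<^sup>2 * y ^ 4 * e ^ 6))"
      using l L x y e by (intro mult_left_mono mult_right_mono mult_mono power_mono) auto
    also have "\<dots> = 2 ^ 20 * (l ^ 6 * x\<^sup>2 * y ^ 4 * e ^ 6 * 1)" by (simp add: mult_ac flip: power_add)
    also have "\<dots> \<le> H" unfolding H_def using gh l1 x y e by (intro mult_left_mono) auto
    finally show ?thesis .
  next
    assume "J \<le> 9 * y\<^sup>2 * (gmax + 16 * (1 + L)\<^sup>2 * L\<^sup>2 / \<epsilon> ^ 4)"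
    also have "\<dots> = 9 * y\<^sup>2 * (gmax + 16 * ((1 + L)\<^sup>2 * L\<^sup>2 * e ^ 4))" unfolding inv_pow by (simp only: mult_ac)
    also have "\<dots> \<le> 9 * y\<^sup>2 * (17 * (l ^ 4 * e ^ 4 * (gmax * h)))"
    proof (rule mult_left_mono)
      have "(1 + L)\<^sup>2 * L\<^sup>2 \<le> l\<^sup>2 * l\<^sup>2" using l L by (intro mult_mono power_mono) auto
      then have "(1 + L)\<^sup>2 * L\<^sup>2 * e ^ 4 * 1 \<le> l ^ 4 * e ^ 4 * (gmax * h)"
        using gh e by (intro mult_mono) (auto simp flip: power_add)
      moreover have "1 * gmax \<le> l ^ 4 * e ^ 4 * (gmax * h)"
        using gg gx l1 e by (intro mult_mono) (auto intro!: mult_ge1_I one_le_power)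
      ultimately show "gmax + 16 * ((1 + L)\<^sup>2 * L\<^sup>2 * e ^ 4) \<le> 17 * (l ^ 4 * e ^ 4 * (gmax * h))" by simp
    qed simp
    also have "\<dots> = 153 * (l ^ 4 * 1 * y\<^sup>2 * e ^ 4 * (gmax * h))" by simp
    also have "\<dots> \<le> 153 * (l ^ 6 * x\<^sup>2 * y ^ 4 * e ^ 6 * (gmax * h))"
      using l1 x y e gh
      by (intro mult_left_mono mult_right_mono mult_mono power_increasing one_le_power) auto
    also have "\<dots> \<le> H" unfolding H_def using ge1 by (intro mult_right_mono) auto
    finally show ?thesis .
  qed
  \<comment> \<open>One copy for a / gmin, four from (1 + sqrt a / gmin)^2 \<le> 4 A h^2.\<close>
  have I: "nI \<le> 5 * (A * h\<^sup>2 * H)"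
  proof -
    have g1: "1 / gmin \<le> h" using h by simp
    have "a * (1 / gmin) \<le> A * h\<^sup>2"
    proof -
      have "h * 1 \<le> h * h" using h1 by (intro mult_left_mono) auto
      then show ?thesis unfolding power2_eq_square using A g1 a g(1) by (intro mult_mono) auto
    qed
    also have "\<dots> \<le> A * h\<^sup>2 * H" using mult_left_mono[OF H, of "A * h\<^sup>2"] A1 by simp
    finally have 1: "a / gmin \<le> A * h\<^sup>2 * H" by simp
    have sA: "1 \<le> sqrt A" "sqrt a \<le> sqrt A" using A A1 by auto
    have "sqrt a * (1 / gmin) \<le> sqrt A * h" using sA g1 a g(1) h1 by (intro mult_mono) auto
    moreover have "1 * 1 \<le> sqrt A * h" using sA h1 by (intro mult_mono) auto
    ultimately have "(1 + sqrt a / gmin)\<^sup>2 \<le> (2 * (sqrt A * h))\<^sup>2" using a g(1) by (intro power_mono) auto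
    also have "\<dots> = 4 * (A * h\<^sup>2)" using A1 by (simp add: power_mult_distrib)
    finally have 2: "(1 + sqrt a / gmin)\<^sup>2 \<le> 4 * (A * h\<^sup>2)" .
    have "(1 + sqrt a / gmin)\<^sup>2 * J \<le> (1 + sqrt a / gmin)\<^sup>2 * H" using JH by (intro mult_left_mono) auto
    also have "\<dots> \<le> 4 * (A * h\<^sup>2) * H" using 2 H by (intro mult_right_mono) auto
    finally show ?thesis using nI(2) 1 by linarith
  qed
  have "nM * nI \<le> (5 * (B * P)) * (5 * (A * h\<^sup>2 * H))" using M I nM(1) nI(1) by (intro mult_mono) auto
  also have "\<dots> = 25 * 2 ^ 20 * (B * A * (gmax ^ 2 * h ^ 4) * l ^ 8 * e ^ 8 * x\<^sup>2 * y ^ 4)"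
    unfolding P_def H_def by (simp add: eval_nat_numeral mult_ac)
  \<comment> \<open>The exponents are raised to the stated ones. For gmax this has a price: (gmax
    h)^2 h^2 \<ge> 1 supplies gmax^2 together with h^4.\<close>
  also have "\<dots> \<le> 25 * 2 ^ 20 * (B * A * (gmax ^ 4 * h ^ 8) * l ^ 12 * e ^ 11 * x\<^sup>2 * y ^ 6)"
  proof -
    have "gmax ^ 2 * h ^ 4 * 1 \<le> gmax ^ 2 * h ^ 4 * ((gmax * h) ^ 2 * h ^ 2)"
      using gh h1 gx by (intro mult_left_mono mult_ge1_I[OF one_le_power[OF gh] one_le_power[OF h1]]) auto
    also have "\<dots> = gmax ^ 4 * h ^ 8" by (simp add: eval_nat_numeral mult_ac)
    finally have "gmax ^ 2 * h ^ 4 \<le> gmax ^ 4 * h ^ 8" by simp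
    moreover have "B * A * t1 * l ^ 8 * e ^ 8 * x\<^sup>2 * y ^ 4 \<le> B * A * t2 * l ^ 12 * e ^ 11 * x\<^sup>2 * y ^ 6"
      if "t1 \<le> t2" "0 \<le> t1" for t1 t2
      using that B1 A1 l1 e x y by (intro mult_left_mono mult_right_mono mult_mono power_increasing) auto
    ultimately show ?thesis using gx h1 by (intro mult_left_mono) auto
  qed
  also have "\<dots> = 25 * 2 ^ 20 * K ^ 22 * (b * a * gmax ^ 4 * (1 / gmin) ^ 8 * L ^ 12 * e ^ 11 * x\<^sup>2 * y ^ 6)"
    unfolding A_def B_def h_def l_def by (simp add: eval_nat_numeral mult_ac)
  also have "(1 / gmin) ^ 8 = gmin powi (-8)" by (simp add: power_int_minus power_one_over power_inverse divide_inverse)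
  also have "e ^ 11 = \<epsilon> powi (-11)" by (simp add: e_def power_int_minus power_one_over power_inverse divide_inverse)
  finally show ?thesis unfolding K_def .
qed

section \<open>From the assumptions to inequalities of quadratic forms\<close>

lemma transpose_surj_of_injective:
  assumes U: "(U::real mat) \<in> carrier_mat n k"
    and inj: "\<And>y. y \<in> carrier_vec k \<Longrightarrow> U *\<^sub>v y = 0\<^sub>v n \<Longrightarrow> y = 0\<^sub>v k" and y: "y \<in> carrier_vec k"
  shows "\<exists>z \<in> carrier_vec n. U\<^sup>T *\<^sub>v z = y"
proof -
  have N: "U\<^sup>T * U \<in> carrier_mat k k" using U by simp
  have "x = 0\<^sub>v k" if x: "x \<in> carrier_vec k" "(U\<^sup>T * U) *\<^sub>v x = 0\<^sub>v k" for x
  proof -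
    have "U\<^sup>T *\<^sub>v (U *\<^sub>v x) = 0\<^sub>v k" using x U by simp
    then have "(U *\<^sub>v x) \<bullet> (U *\<^sub>v x) = 0"
      using scalar_prod_mult_adjoint[OF U _ x(1), of "U *\<^sub>v x"] U x by (simp add: scalar_prod_left_zero[OF x(1)])
    then show ?thesis using inj[OF x(1)] scalar_prod_self_eq_0[of "U *\<^sub>v x" n] U x by simp
  qed
  note Ni = inv_mat_of_injective[OF N this]
  \<comment> \<open>The preimage is \<open>U\<close> applied to the solution of the normal
    equations.\<close>
  let ?x = "inv_mat (U\<^sup>T * U) *\<^sub>v y"
  have x: "?x \<in> carrier_vec k" using Ni(2) y by simp
  have "U\<^sup>T *\<^sub>v (U *\<^sub>v ?x) = (U\<^sup>T * U) *\<^sub>v ?x"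
    using assoc_mult_mat_vec[of "U\<^sup>T" k n U k ?x] U x by simp
  also have "\<dots> = y" by (rule inv_mat_vec_cancel(1)[OF N Ni(2-4) y])
  finally show ?thesis using U x by (intro bexI[of _ "U *\<^sub>v ?x"]) auto
qed

lemma loewner_ge_quad:
  assumes "loewner_ge B C" "B \<in> carrier_mat n n" "C \<in> carrier_mat n n" "v \<in> carrier_vec n"
  shows "qf C v \<le> qf B v"
proof -
  have "0 \<le> v \<bullet> ((B - C) *\<^sub>v v)" using assms psd_matsD(3)[of "B - C" n v] by (simp add: loewner_ge_def)
  then show ?thesis
    using assms by (simp add: minus_mult_distrib_mat_vec[of _ n n] scalar_prod_minus_distrib[of _ n])
qed

lemma spectral_diff_quad:
  assumes "spectral_norm (B - C) \<le> c" "B \<in> carrier_mat n n" "C \<in> carrier_mat n n" "v \<in> carrier_vec n"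
  shows "\<bar>qf B v - qf C v\<bar> \<le> c * (v \<bullet> v)"
proof -
  have "B - C \<in> carrier_mat n n" using assms by (simp add: minus_carrier_mat)
  then have "\<bar>v \<bullet> ((B - C) *\<^sub>v v)\<bar> \<le> c * (v \<bullet> v)"
    using quad_form_le_spectral[of "B - C" n v] assms(1,4) scalar_prod_self_nonneg[of v]
    by (meson mult_right_mono order_trans)
  then show ?thesis
    using assms by (simp add: minus_mult_distrib_mat_vec[of _ n n] scalar_prod_minus_distrib[of _ n])
qed

text \<open>The lower bound 1 / chi1 holds for Xs + Ss. Complementarity makes Ss vanish on the range
  of \<open>U\<close>, so there the whole bound falls to Xs = U U^T, which is
  \<open>U_range\<close>. Also Ss \<le> 1, so S is at most 1 + L.\<close>

lemma centering_imp_centered_scaling: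
  assumes cent: "centering_assumption n L \<delta> chi1 \<mu> X S Xs Ss" and \<mu>: "\<mu> \<le> 1" and L: "0 < L"
    and U: "U \<in> carrier_mat n (mat_rank Xs)" and Xs: "Xs = U * U\<^sup>T"
    and eb: "eigenbasis n (scaling_point X S) Z lam"
  shows "centered_scaling n (scaling_point X S) Z lam (mat_rank Xs) U X L (1 - \<delta>) chi1 \<mu>"
proof -
  let ?k = "mat_rank Xs" and ?W = "scaling_point X S"
  have h: "0 \<le> \<delta>" "\<delta> < 1" "0 < chi1" "0 < \<mu>" and X: "X \<in> pd_mats n" and S: "S \<in> pd_mats n"
    and Xsp: "Xs \<in> psd_mats n" and Ssp: "Ss \<in> psd_mats n"
    and c: "spectral_norm ((1/\<mu>) \<cdot>\<^sub>m (sqrt_mat X * S * sqrt_mat X) - 1\<^sub>m n) \<le> \<delta>"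
    and cX: "spectral_norm (X - Xs) \<le> L * \<mu>" and cS: "spectral_norm (S - Ss) \<le> L"
    and z: "Xs * Ss = 0\<^sub>m n n" and lo: "loewner_ge (Xs + Ss) (inverse chi1 \<cdot>\<^sub>m 1\<^sub>m n)"
    and up: "loewner_ge (1\<^sub>m n) (Xs + Ss)" and rk: "1 \<le> ?k" "?k < n"
    using cent by (auto simp: centering_assumption_def)
  note Xc = pd_matsD(1)[OF X] and Sc = pd_matsD(1)[OF S] and Xsc = psd_matsD(1)[OF Xsp] and Ssc = psd_matsD(1)[OF Ssp]
  have inj: "y = 0\<^sub>v ?k" if "y \<in> carrier_vec ?k" "U *\<^sub>v y = 0\<^sub>v n" for y
    using injective_of_gram_rank[OF U _ that] Xs by simp
  have Xq: "qf Xs v = (U\<^sup>T *\<^sub>v v) \<bullet> (U\<^sup>T *\<^sub>v v)" if v: "v \<in> carrier_vec n" for v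
  proof -
    have "Xs *\<^sub>v v = U *\<^sub>v (U\<^sup>T *\<^sub>v v)" unfolding Xs using U v assoc_mult_mat_vec[OF U _ v, of "U\<^sup>T"] by simp
    then show ?thesis using scalar_prod_mult_adjoint[OF U v, of "U\<^sup>T *\<^sub>v v"] U v by simp
  qed
  have sum: "qf (Xs + Ss) v = qf Xs v + qf Ss v" if v: "v \<in> carrier_vec n" for v
    using v Xsc Ssc by (simp add: add_mult_distrib_mat_vec[of _ n n] scalar_prod_add_distrib[of _ n])
  have sum_le: "qf Xs v + qf Ss v \<le> v \<bullet> v" if v: "v \<in> carrier_vec n" for v
    using loewner_ge_quad[OF up _ _ v] sum[OF v] Xsc Ssc v by simp
  have sum_ge: "(v \<bullet> v) / chi1 \<le> qf Xs v + qf Ss v" if v: "v \<in> carrier_vec n" for v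
  proof -
    have "(inverse chi1 \<cdot>\<^sub>m 1\<^sub>m n) *\<^sub>v v = inverse chi1 \<cdot>\<^sub>v v"
      using smult_mat_mult_vec[OF one_carrier_mat v] v by simp
    then show ?thesis
      using loewner_ge_quad[OF lo _ _ v] sum[OF v] Xsc Ssc v by (simp add: divide_inverse mult.commute)
  qed
  have S_le: "qf S u \<le> (1 + L) * (u \<bullet> u)" if u: "u \<in> carrier_vec n" for u
    using spectral_diff_quad[OF cS Sc Ssc u] sum_le[OF u] psd_matsD(3)[OF Xsp u] by (simp add: distrib_right)
  note sp = scaling_point_bounds[OF X S h(4,1,2) c]
  \<comment> \<open>Every U y is Xs w for some w with U^T w = y, and Ss Xs is the transpose of Xs Ss
    = 0.\<close>
  have SsU: "Ss *\<^sub>v (U *\<^sub>v y) = 0\<^sub>v n" if y: "y \<in> carrier_vec ?k" for y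
  proof -
    obtain w where w: "w \<in> carrier_vec n" "U\<^sup>T *\<^sub>v w = y" using transpose_surj_of_injective[OF U inj y] by blast
    have "Ss * Xs = (Xs * Ss)\<^sup>T"
      using transpose_mult[OF Xsc Ssc] psd_matsD(2)[OF Xsp] psd_matsD(2)[OF Ssp] by simp
    then have SX: "Ss * Xs = 0\<^sub>m n n" using z by simp
    have "U *\<^sub>v y = Xs *\<^sub>v w" unfolding Xs w(2)[symmetric] using U w(1) assoc_mult_mat_vec[OF U _ w(1), of "U\<^sup>T"] by simp
    then have "Ss *\<^sub>v (U *\<^sub>v y) = (Ss * Xs) *\<^sub>v w" using assoc_mult_mat_vec[OF Ssc Xsc w(1)] by simp
    also have "\<dots> = 0\<^sub>v n" unfolding SX using w(1) by (intro eq_vecI) auto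
    finally show ?thesis .
  qed
  interpret eigenbasis n ?W Z lam by (rule eb)
  show ?thesis
  proof unfold_locales
    \<comment> \<open>As n > 0 there is a unit vector, and at it the two bounds on Xs + Ss force 1 /
      chi1 \<le> 1.\<close>
    let ?e = "unit_vec n 0 :: real vec"
    have e: "?e \<in> carrier_vec n" "?e \<bullet> ?e = 1" using rk by auto
    have "1 / chi1 \<le> 1" using sum_le[OF e(1)] sum_ge[OF e(1)] e(2) by simp
    then show "1 \<le> chi1" using h by simp
    show "(1 - \<delta>) * \<mu> * (v \<bullet> v) \<le> (1 + L) * (qf X v)" if "v \<in> carrier_vec n" for v
      by (rule sp(4)[OF S_le that])
    show "\<bar>qf X v - (U\<^sup>T *\<^sub>v v) \<bullet> (U\<^sup>T *\<^sub>v v)\<bar> \<le> L * \<mu> * (v \<bullet> v)" if "v \<in> carrier_vec n" for v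
      using spectral_diff_quad[OF cX Xc Xsc that] Xq[OF that] by simp
    show "(U\<^sup>T *\<^sub>v v) \<bullet> (U\<^sup>T *\<^sub>v v) \<le> v \<bullet> v" if "v \<in> carrier_vec n" for v
      using sum_le[OF that] psd_matsD(3)[OF Ssp that] Xq[OF that] by linarith
    show "(U *\<^sub>v y) \<bullet> (U *\<^sub>v y) \<le> chi1 * ((U\<^sup>T *\<^sub>v (U *\<^sub>v y)) \<bullet> (U\<^sup>T *\<^sub>v (U *\<^sub>v y)))"
      if y: "y \<in> carrier_vec ?k" for y
    proof -
      have v: "U *\<^sub>v y \<in> carrier_vec n" using U y by simp
      have "(U *\<^sub>v y) \<bullet> (Ss *\<^sub>v (U *\<^sub>v y)) = 0" unfolding SsU[OF y] using v by simp
      then have "((U *\<^sub>v y) \<bullet> (U *\<^sub>v y)) / chi1 \<le> (U\<^sup>T *\<^sub>v (U *\<^sub>v y)) \<bullet> (U\<^sup>T *\<^sub>v (U *\<^sub>v y))"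
        using sum_ge[OF v] Xq[OF v] by simp
      then show ?thesis using h by (simp add: field_simps)
    qed
  qed (use U rk inj h \<mu> L pd_imp_psd[OF sp(1)] sp(2,3) in auto)
qed

theorem theorem3p3:
  fixes \<kappa> :: real
  assumes "0 < \<kappa>"
  shows "\<exists>C > 0. \<forall>(n::nat) (m::nat) (r::nat) (A::real mat) (G::real mat)
      (X::real mat) (S::real mat) (Xs::real mat) (Ss::real mat) (Us::real mat)
      (W::real mat) (Q::real mat) (Qp::real mat)
      (L::real) (\<delta>::real) (chi1::real) (chi2::real) (\<mu>::real)
      (\<gamma>min::real) (\<gamma>max::real) (\<tau>::real) (BQ::real mat) (BSig::real mat) (M::real mat).
    A \<in> carrier_mat m (n * (n + 1) div 2) \<longrightarrow> lin_indpt_rows A \<longrightarrow>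
    centering_assumption n L \<delta> chi1 \<mu> X S Xs Ss \<longrightarrow> \<mu> \<le> 1 \<longrightarrow>
    tangent_injectivity n A chi2 Xs Us \<longrightarrow>
    W = scaling_point X S \<longrightarrow>
    mat_rank Xs \<le> r \<longrightarrow> r < n \<longrightarrow>
    \<tau> = ordered_eig W (r + 1) / 2 \<longrightarrow>
    eig_partition n r W Q Qp \<longrightarrow>
    BQ = bold_Q Q Qp \<longrightarrow>
    BSig = bold_Sigma \<tau> (top_eig_mat W r) (bottom_eig_mat W r) \<longrightarrow>
    G \<in> sym_mats m \<longrightarrow> 0 < \<gamma>min \<longrightarrow> \<gamma>min \<le> \<gamma>max \<longrightarrow>
    loewner_ge (\<gamma>max \<cdot>\<^sub>m (A * A\<^sup>T)) G \<longrightarrow>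
    loewner_ge G (\<gamma>min \<cdot>\<^sub>m (A * A\<^sup>T)) \<longrightarrow>
    bounded_below_by \<kappa> A L \<gamma>min \<longrightarrow>
    M = augmented_mat G A BQ \<tau> BSig \<longrightarrow>
    invertible_mat M \<and>
    cond_number M \<le> C * (cond_number (A * A\<^sup>T) * \<gamma>max ^ 4 * \<gamma>min powi (-8) *
      L ^ 12 * (1 - \<delta>) powi (-11) * chi1 ^ 2 * chi2 ^ 6)"
proof (intro exI[of _ "25 * 2 ^ 20 * (1 + 1 / \<kappa>) ^ 22"] conjI allI impI)
  show "0 < 25 * 2 ^ 20 * (1 + 1 / \<kappa>) ^ 22" 
    using assms by (intro mult_pos_pos zero_less_power add_pos_pos) auto
next
  fix n m r :: nat and A G X S Xs Ss Us W Q Qp BQ BSig M :: "real mat"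
    and L \<delta> chi1 chi2 \<mu> gmin gmax \<tau> :: real
  assume A: "A \<in> carrier_mat m (tri n)" and ind: "lin_indpt_rows A"
    and cent: "centering_assumption n L \<delta> chi1 \<mu> X S Xs Ss" and \<mu>: "\<mu> \<le> 1"
    and tan: "tangent_injectivity n A chi2 Xs Us" and W: "W = scaling_point X S"
    and kr: "mat_rank Xs \<le> r" and rn: "r < n" and \<tau>: "\<tau> = ordered_eig W (r + 1) / 2"
    and ep: "eig_partition n r W Q Qp" and BQ: "BQ = bold_Q Q Qp"
    and BSig: "BSig = bold_Sigma \<tau> (top_eig_mat W r) (bottom_eig_mat W r)"
    and G: "G \<in> sym_mats m" and gmin: "0 < gmin" and gm: "gmin \<le> gmax"
    and Gle: "loewner_ge (gmax \<cdot>\<^sub>m (A * A\<^sup>T)) G" and Gge: "loewner_ge G (gmin \<cdot>\<^sub>m (A * A\<^sup>T))"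
    and bb: "bounded_below_by \<kappa> A L gmin" and M: "M = augmented_mat G A BQ \<tau> BSig"
  let ?lam = "\<lambda>i. ordered_eig W (i + 1)" and ?N = "A * A\<^sup>T"
  have below: "\<kappa> \<le> spectral_norm ?N" "\<kappa> \<le> spectral_norm (inv_mat ?N)" "\<kappa> \<le> L" "\<kappa> \<le> 1 / gmin"
    using bb by (auto simp: bounded_below_by_def)
  note eb = eig_partition_eigenbasis[OF ep less_imp_le[OF rn]]
  have U: "Us \<in> carrier_mat n (mat_rank Xs)" and Xs: "Xs = Us * Us\<^sup>T" and chi2: "1 \<le> chi2"
    using tan by (auto simp: tangent_injectivity_def)
  \<comment> \<open>The strict inequality 0 < L comes from L \<ge> \<kappa> > 0.\<close>
  interpret centered_scaling n W "hcat Q Qp" ?lam "mat_rank Xs" Us X L "1 - \<delta>" chi1 \<mu>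
    unfolding W using assms below(3) eb(1)
    by (intro centering_imp_centered_scaling[OF cent \<mu> _ U Xs]) (auto simp: W)
  have N: "?N \<in> pd_mats m" by (rule lin_indpt_rows_gram_pd[OF A ind])
  have Nc: "?N \<in> carrier_mat m m" and Gc: "G \<in> carrier_mat m m" using pd_matsD(1)[OF N] G by (auto simp: sym_mats_def)
  have sc: "x \<bullet> ((c \<cdot>\<^sub>m ?N) *\<^sub>v x) = c * (qf ?N x)" if x: "x \<in> carrier_vec m" for c x
    unfolding smult_mat_mult_vec[OF Nc x] using Nc x by (intro scalar_prod_smult_distrib[of _ m]) auto
  have sN: "c \<cdot>\<^sub>m ?N \<in> carrier_mat m m" for c using Nc by simp
  interpret kkt_system n W "hcat Q Qp" ?lam "mat_rank Xs" Us X L "1 - \<delta>" chi1 \<mu> m A G gmin gmax r Q Qp \<tau> chi2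
  proof unfold_locales
    show "gmin * (qf ?N x) \<le> qf G x" "qf G x \<le> gmax * (qf ?N x)"
      if x: "x \<in> carrier_vec m" for x
      using loewner_ge_quad[OF Gge Gc sN x] loewner_ge_quad[OF Gle sN Gc x] by (simp_all only: sc[OF x])
    show "inverse chi2 * frobenius_norm (Us * V\<^sup>T + V * Us\<^sup>T) \<le>
        vec_norm (inv_mat (sqrt_mat ?N) *\<^sub>v (A *\<^sub>v vec_S (Us * V\<^sup>T + V * Us\<^sup>T)))"
      if "V \<in> carrier_mat n (mat_rank Xs)" for V
      using tan that by (auto simp: tangent_injectivity_def)
  qed (use A N G gmin gm eb(3,4) kr rn \<tau> chi2 in auto)
  have "dim_row W = n" using eb(2) by simp
  then have "top_eig_mat W r = mat_diag r ?lam" "bottom_eig_mat W r = mat_diag (n - r) (\<lambda>i. ?lam (r + i))"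
    by (simp_all add: top_eig_mat_def bottom_eig_mat_def)
  then have M': "M = augmented_mat G A (bold_Q Q Qp) \<tau> (bold_Sigma \<tau> (mat_diag r ?lam) (mat_diag (n - r) (\<lambda>i. ?lam (r + i))))"
    by (simp only: M BQ BSig)
  note kb = kkt_bounds[folded M']
  show "invertible_mat M" by (rule kb(1))
  obtain k0 where k0: "0 < k0" "1 / k0 \<le> 2 ^ 20 * L\<^sup>2 * chi1\<^sup>2 * chi2 ^ 4 * (1 + L) ^ 4 / (1 - \<delta>) ^ 6 \<or>
      1 / k0 \<le> 9 * chi2\<^sup>2 * (gmax + 16 * (1 + L)\<^sup>2 * L\<^sup>2 / (1 - \<delta>) ^ 4)"
    "spectral_norm (inv_mat M) \<le> alpha / gmin + (1 + sqrt alpha / gmin)\<^sup>2 * (1 / k0)"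
    using kb(3) by auto
  \<comment> \<open>In the arithmetic a and b are \<open>alpha\<close> and \<open>beta\<close>, so
    their product is the condition number of the Gram matrix.\<close>
  show "cond_number M \<le> 25 * 2 ^ 20 * (1 + 1 / \<kappa>) ^ 22 * (cond_number ?N * gmax ^ 4 * gmin powi (-8) *
      L ^ 12 * (1 - \<delta>) powi (-11) * chi1 ^ 2 * chi2 ^ 6)"
    using condition_arithmetic[OF assms below gmin gm \<epsilon> chi1 chi2
        spectral_norm_nonneg kb(2)[unfolded beta_def] spectral_norm_nonneg k0(3)[unfolded alpha_def] k0(2)]
    by (simp add: cond_number_def)
qed

end
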